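(* Let $t\in\mathbb R\setminus\{0\}$ and let $J\in\mathbb H_t^{n\times n}$ satisfy $J=J^{\circledast}=J^{-1}$. Let $R(x)=D+xC(I_{\mathbb H_t^N}-xA)^{-1}B$ be a minimal realization of an $\mathbb H_t^{n\times n}$-valued rational function satisfying $R(x)JR(-x)^{\circledast}=J$ at the real points where both $R(x)$ and $R(-x)$ are defined, and let $H$ be the $\circledast$-symmetric matrix associated to this realization. Up to $J$-unitary factorizations of $D$ (that is, once a factorization $D=D_1D_2$ with $D_jJD_j^{\circledast}=J$, $j=1,2$, is fixed and the factors are required to satisfy $R_j(0)=D_j$), there is a one-to-one correspondence between $J$-unitary minimal factorizations $R=R_1R_2$ of $R$ and $A$-invariant subspaces of $\mathbb H_t^N$ which are non-degenerate in the $H$-metric.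
   Context: For real $t\neq 0$, $\mathbb H_t$ is the real associative algebra of elements $q=a+bj_t$ with $a,b\in\mathbb C$, where $\mathbb C\subset\mathbb H_t$, $j_t^2=t$ and $j_t a=\overline a\, j_t$ for $a\in\mathbb C$. Let $I(a+bj_t)=\begin{pmatrix}a&tb\\ \overline b&\overline a\end{pmatrix}$ and $q^{\circledast}=\overline a-bj_t$ for $q=a+bj_t$; for a matrix $M=(m_{jk})$ over $\mathbb H_t$, $M^{\circledast}$ is the matrix with $(j,k)$ entry $m_{kj}^{\circledast}$. $M$ is $\circledast$-symmetric if $M=M^{\circledast}$. $I_{\mathbb H_t^N}$ is the identity matrix. The variable $x$ is real. An $\mathbb H_t^{n\times n}$-valued function $R$ of $x$, defined at $0$, is rational if $R(x)=D+xC(I_{\mathbb H_t^N}-xA)^{-1}B$ with $D=R(0)$ and $(C,A,B)\in\mathbb H_t^{n\times N}\times\mathbb H_t^{N\times N}\times\mathbb H_t^{N\times n}$ (a realization). $(C,A)$ is observable if for $h\in\mathbb H_t^N$: $C(I_{\mathbb H_t^N}-xA)^{-1}h=0$ on some interval $(-\varepsilon,\varepsilon)$ iff $h=0$. $(A,B)$ is controllable if for $h\in\mathbb H_t^{1\times N}$: $hA^kB=0$ for all $k\ge 0$ iff $h=0$. The realization is minimal if $(C,A)$ is observable and $(A,B)$ is controllable; then the degree of $R$ is $N$. A factorization $R=R_1R_2$ into $\mathbb H_t^{n\times n}$-valued rational functions is minimal if the degrees of $R_1$ and $R_2$ add up to the degree of $R$; it is $J$-unitary if both factors satisfy $R_j(x)JR_j(-x)^{\circledast}=J$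 at the real points where this makes sense. The associated $\circledast$-symmetric matrix $H\in\mathbb H_t^{N\times N}$ is the unique invertible $\circledast$-symmetric matrix satisfying $A^{\circledast}H+HA=-C^{\circledast}JC$ and $B=-H^{-1}C^{\circledast}JD$. For $f,g\in\mathbb H_t^N$, $[f,g]_{\circledast}=\sum_{k=1}^N\operatorname{Tr}\big(I(f_k^{\circledast})I(g_k)\big)$, a real-valued symmetric bilinear form, and the $H$-metric is $[f,g]_H=[f,Hg]_{\circledast}$. Subspaces of $\mathbb H_t^N$ are right $\mathbb H_t$-submodules. A subspace $\mathcal M$ is non-degenerate in the $H$-metric if $\mathcal M\cap\mathcal M^{\perp_H}=\{0\}$, where $\mathcal M^{\perp_H}=\{f\in\mathbb H_t^N: [f,m]_H=0\ \forall m\in\mathcal M\}$; it is $A$-invariant if $A\mathcal M\subset\mathcal M$. *)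

theory Defs
  imports "HOL-Analysis.Product_Vector" "Jordan_Normal_Form.Matrix"
begin

text \<open>The pair \<open>(a, b)\<close> stands for \<open>a + b j\<^sub>t\<close>.  The real vector space structure does not depend on
  \<open>t\<close> and is the one of the product type; only the multiplication takes the parameter \<open>t\<close>.
  Matrices over the algebra are library matrices, but their products are defined here because the
  library product uses the multiplication of a type class.\<close>

type_synonym ht = "complex \<times> complex"

definition ht_mult :: "real \<Rightarrow> ht \<Rightarrow> ht \<Rightarrow> ht" where
  "ht_mult t p q =
    (fst p * fst q + of_real t * snd p * cnj (snd q), fst p * snd q + snd p * cnj (fst q))"

definition ht_star :: "ht \<Rightarrow> ht" where
  "ht_star q = (cnj (fst q), - snd q)"

definition ht_I :: "real \<Rightarrow> ht \<Rightarrow> complex mat" where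
  "ht_I t q = mat_of_rows_list 2
    [[fst q, of_real t * snd q], [cnj (snd q), cnj (fst q)]]"

definition trace_mat :: "complex mat \<Rightarrow> complex" where
  "trace_mat M = (\<Sum>i<dim_row M. M $$ (i, i))"

subsection \<open>Matrices\<close>

definition ht_mat_mult :: "ht mat \<Rightarrow> real \<Rightarrow> ht mat \<Rightarrow> ht mat"
    ("(_ \<odot>\<^bsub>_\<^esub>/ _)" [70, 0, 71] 70) where
  "A \<odot>\<^bsub>t\<^esub> B = mat (dim_row A) (dim_col B)
    (\<lambda>(i, j). \<Sum>k<dim_col A. ht_mult t (A $$ (i, k)) (B $$ (k, j)))"

definition ht_one_mat :: "nat \<Rightarrow> ht mat" where
  "ht_one_mat N = mat N N (\<lambda>(i, j). if i = j then (1, 0) else 0)"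

definition ht_scaleR_mat :: "real \<Rightarrow> ht mat \<Rightarrow> ht mat" where
  "ht_scaleR_mat x A = map_mat (\<lambda>q. x *\<^sub>R q) A"

definition ht_star_mat :: "ht mat \<Rightarrow> ht mat" where
  "ht_star_mat M = mat (dim_col M) (dim_row M) (\<lambda>(j, k). ht_star (M $$ (k, j)))"

definition ht_inverse_of :: "real \<Rightarrow> ht mat \<Rightarrow> ht mat \<Rightarrow> bool" where
  "ht_inverse_of t A B \<longleftrightarrow> A \<in> carrier_mat (dim_row A) (dim_row A)
    \<and> B \<in> carrier_mat (dim_row A) (dim_row A)
    \<and> A \<odot>\<^bsub>t\<^esub> B = ht_one_mat (dim_row A) \<and> B \<odot>\<^bsub>t\<^esub> A = ht_one_mat (dim_row A)"

definition ht_invertible :: "real \<Rightarrow> ht mat \<Rightarrow> bool" where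
  "ht_invertible t A \<longleftrightarrow> (\<exists>B. ht_inverse_of t A B)"

definition ht_inv :: "real \<Rightarrow> ht mat \<Rightarrow> ht mat" where
  "ht_inv t A = (THE B. ht_inverse_of t A B)"

primrec ht_mat_pow :: "real \<Rightarrow> ht mat \<Rightarrow> nat \<Rightarrow> ht mat" where
  "ht_mat_pow t A 0 = ht_one_mat (dim_row A)"
| "ht_mat_pow t A (Suc k) = ht_mat_pow t A k \<odot>\<^bsub>t\<^esub> A"

subsection \<open>Rational functions and realizations\<close>

definition pencil :: "ht mat \<Rightarrow> real \<Rightarrow> ht mat" where
  "pencil A x = ht_one_mat (dim_row A) - ht_scaleR_mat x A"

definition transfer_fun ::
    "real \<Rightarrow> ht mat \<Rightarrow> ht mat \<Rightarrow> ht mat \<Rightarrow> ht mat \<Rightarrow> real \<Rightarrow> ht mat" where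
  "transfer_fun t D C A B x =
    D + ht_scaleR_mat x (C \<odot>\<^bsub>t\<^esub> ht_inv t (pencil A x) \<odot>\<^bsub>t\<^esub> B)"

text \<open>Matrix-valued functions of a real variable are partial functions; \<open>dom R\<close> is the set of points
  where \<open>R\<close> is defined.\<close>

definition is_realization :: "real \<Rightarrow> nat \<Rightarrow> (real \<rightharpoonup> ht mat) \<Rightarrow>
    nat \<Rightarrow> ht mat \<Rightarrow> ht mat \<Rightarrow> ht mat \<Rightarrow> ht mat \<Rightarrow> bool" where
  "is_realization t n R N D C A B \<longleftrightarrow>
     D \<in> carrier_mat n n \<and> C \<in> carrier_mat n N \<and> A \<in> carrier_mat N N \<and> B \<in> carrier_mat N n \<and>
     R 0 = Some D \<and>
     (\<forall>x\<in>dom R. ht_invertible t (pencil A x) \<longrightarrow> R x = Some (transfer_fun t D C A B x))"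

text \<open>The second conjunct makes the domain of a rational function maximal: \<open>R\<close> is defined at \<open>x\<close> as
  soon as one of its realizations is.  Two realizations that agree near \<open>0\<close> thus
  belong to the same partial function, so that equality of rational functions is equality in HOL.\<close>

definition rational_fun :: "real \<Rightarrow> nat \<Rightarrow> (real \<rightharpoonup> ht mat) \<Rightarrow> bool" where
  "rational_fun t n R \<longleftrightarrow>
     (\<exists>N D C A B. is_realization t n R N D C A B) \<and>
     dom R = {x. \<exists>N D C A B. is_realization t n R N D C A B \<and> ht_invertible t (pencil A x)}"

text \<open>Column vectors of length \<open>N\<close> are \<open>N \<times> 1\<close> matrices, row vectors are \<open>1 \<times> N\<close> matrices.\<close>

definition observable :: "real \<Rightarrow> nat \<Rightarrow> nat \<Rightarrow> ht mat \<Rightarrow> ht mat \<Rightarrow> bool" where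
  "observable t n N C A \<longleftrightarrow>
     (\<forall>h\<in>carrier_mat N 1.
        (\<exists>e>0. \<forall>x\<in>{-e<..<e}. ht_invertible t (pencil A x) \<and>
            C \<odot>\<^bsub>t\<^esub> ht_inv t (pencil A x) \<odot>\<^bsub>t\<^esub> h = 0\<^sub>m n 1)
        \<longleftrightarrow> h = 0\<^sub>m N 1)"

definition controllable :: "real \<Rightarrow> nat \<Rightarrow> nat \<Rightarrow> ht mat \<Rightarrow> ht mat \<Rightarrow> bool" where
  "controllable t n N A B \<longleftrightarrow>
     (\<forall>h\<in>carrier_mat 1 N.
        (\<forall>k. h \<odot>\<^bsub>t\<^esub> ht_mat_pow t A k \<odot>\<^bsub>t\<^esub> B = 0\<^sub>m 1 n) \<longleftrightarrow> h = 0\<^sub>m 1 N)"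

definition minimal_realization :: "real \<Rightarrow> nat \<Rightarrow> (real \<rightharpoonup> ht mat) \<Rightarrow>
    nat \<Rightarrow> ht mat \<Rightarrow> ht mat \<Rightarrow> ht mat \<Rightarrow> ht mat \<Rightarrow> bool" where
  "minimal_realization t n R N D C A B \<longleftrightarrow>
     is_realization t n R N D C A B \<and> observable t n N C A \<and> controllable t n N A B"

text \<open>A relation, since for \<open>t > 0\<close> a rational function need not have a minimal realization.\<close>

definition has_degree :: "real \<Rightarrow> nat \<Rightarrow> (real \<rightharpoonup> ht mat) \<Rightarrow> nat \<Rightarrow> bool" where
  "has_degree t n R N \<longleftrightarrow> (\<exists>D C A B. minimal_realization t n R N D C A B)"

definition J_unitary_fun :: "real \<Rightarrow> ht mat \<Rightarrow> (real \<rightharpoonup> ht mat) \<Rightarrow> bool" where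
  "J_unitary_fun t J R \<longleftrightarrow>
     (\<forall>x. x \<in> dom R \<and> - x \<in> dom R \<longrightarrow>
        the (R x) \<odot>\<^bsub>t\<^esub> J \<odot>\<^bsub>t\<^esub> ht_star_mat (the (R (- x))) = J)"

definition J_unitary_mat :: "real \<Rightarrow> ht mat \<Rightarrow> ht mat \<Rightarrow> bool" where
  "J_unitary_mat t J U \<longleftrightarrow> U \<odot>\<^bsub>t\<^esub> J \<odot>\<^bsub>t\<^esub> ht_star_mat U = J"

definition factorization ::
    "real \<Rightarrow> nat \<Rightarrow> (real \<rightharpoonup> ht mat) \<Rightarrow> (real \<rightharpoonup> ht mat) \<Rightarrow> (real \<rightharpoonup> ht mat) \<Rightarrow> bool" where
  "factorization t n R R1 R2 \<longleftrightarrow> rational_fun t n R1 \<and> rational_fun t n R2 \<and>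
     (\<forall>x\<in>dom R \<inter> dom R1 \<inter> dom R2. the (R x) = the (R1 x) \<odot>\<^bsub>t\<^esub> the (R2 x))"

definition minimal_factorization ::
    "real \<Rightarrow> nat \<Rightarrow> (real \<rightharpoonup> ht mat) \<Rightarrow> (real \<rightharpoonup> ht mat) \<Rightarrow> (real \<rightharpoonup> ht mat) \<Rightarrow> bool" where
  "minimal_factorization t n R R1 R2 \<longleftrightarrow> factorization t n R R1 R2 \<and>
     (\<exists>N1 N2. has_degree t n R1 N1 \<and> has_degree t n R2 N2 \<and> has_degree t n R (N1 + N2))"

definition J_unitary_minimal_factorizations ::
    "real \<Rightarrow> nat \<Rightarrow> ht mat \<Rightarrow> (real \<rightharpoonup> ht mat) \<Rightarrow> ht mat \<Rightarrow> ht mat \<Rightarrow>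
      ((real \<rightharpoonup> ht mat) \<times> (real \<rightharpoonup> ht mat)) set" where
  "J_unitary_minimal_factorizations t n J R D1 D2 =
     {(R1, R2). minimal_factorization t n R R1 R2 \<and>
        J_unitary_fun t J R1 \<and> J_unitary_fun t J R2 \<and> R1 0 = Some D1 \<and> R2 0 = Some D2}"

subsection \<open>The associated matrix and its metric\<close>

definition associated_matrix :: "real \<Rightarrow> nat \<Rightarrow> ht mat \<Rightarrow>
    ht mat \<Rightarrow> ht mat \<Rightarrow> ht mat \<Rightarrow> ht mat \<Rightarrow> ht mat \<Rightarrow> bool" where
  "associated_matrix t N J D C A B H \<longleftrightarrow>
     H \<in> carrier_mat N N \<and> ht_invertible t H \<and> ht_star_mat H = H \<and>
     ht_star_mat A \<odot>\<^bsub>t\<^esub> H + H \<odot>\<^bsub>t\<^esub> A = - (ht_star_mat C \<odot>\<^bsub>t\<^esub> J \<odot>\<^bsub>t\<^esub> C) \<and>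
     B = - (ht_inv t H \<odot>\<^bsub>t\<^esub> ht_star_mat C \<odot>\<^bsub>t\<^esub> J \<odot>\<^bsub>t\<^esub> D)"

text \<open>The traces below are real, because the diagonal of \<open>ht_I t q\<close> consists of two conjugate numbers
  and \<open>ht_I t\<close> is multiplicative; \<open>Re\<close> only changes the type.\<close>

definition ht_form :: "real \<Rightarrow> nat \<Rightarrow> ht mat \<Rightarrow> ht mat \<Rightarrow> real" where
  "ht_form t N f g =
     (\<Sum>k<N. Re (trace_mat (ht_I t (ht_star (f $$ (k, 0))) * ht_I t (g $$ (k, 0)))))"

definition H_form :: "real \<Rightarrow> nat \<Rightarrow> ht mat \<Rightarrow> ht mat \<Rightarrow> ht mat \<Rightarrow> real" where
  "H_form t N H f g = ht_form t N f (H \<odot>\<^bsub>t\<^esub> g)"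

definition right_submodule :: "real \<Rightarrow> nat \<Rightarrow> ht mat set \<Rightarrow> bool" where
  "right_submodule t N M \<longleftrightarrow> M \<subseteq> carrier_mat N 1 \<and> 0\<^sub>m N 1 \<in> M \<and>
     (\<forall>f\<in>M. \<forall>g\<in>M. f + g \<in> M) \<and> (\<forall>f\<in>M. \<forall>q. map_mat (\<lambda>y. ht_mult t y q) f \<in> M)"

definition H_perp :: "real \<Rightarrow> nat \<Rightarrow> ht mat \<Rightarrow> ht mat set \<Rightarrow> ht mat set" where
  "H_perp t N H M = {f \<in> carrier_mat N 1. \<forall>m\<in>M. H_form t N H f m = 0}"

definition H_nondegenerate :: "real \<Rightarrow> nat \<Rightarrow> ht mat \<Rightarrow> ht mat set \<Rightarrow> bool" where
  "H_nondegenerate t N H M \<longleftrightarrow> M \<inter> H_perp t N H M = {0\<^sub>m N 1}"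

definition nondegenerate_invariant_subspaces ::
    "real \<Rightarrow> nat \<Rightarrow> ht mat \<Rightarrow> ht mat \<Rightarrow> ht mat set set" where
  "nondegenerate_invariant_subspaces t N A H =
     {M. right_submodule t N M \<and> (\<forall>f\<in>M. A \<odot>\<^bsub>t\<^esub> f \<in> M) \<and> H_nondegenerate t N H M}"

text \<open>For non-degenerate \<open>M\<close>, the matrix of the projection of the column space onto \<open>M\<close> along the
  orthogonal companion of \<open>M\<close>.\<close>

definition is_H_projection :: "real \<Rightarrow> nat \<Rightarrow> ht mat \<Rightarrow> ht mat set \<Rightarrow> ht mat \<Rightarrow> bool" where
  "is_H_projection t N H M P \<longleftrightarrow> P \<in> carrier_mat N N \<and>
     (\<forall>f\<in>M. P \<odot>\<^bsub>t\<^esub> f = f) \<and> (\<forall>f\<in>H_perp t N H M. P \<odot>\<^bsub>t\<^esub> f = 0\<^sub>m N 1)"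

text \<open>\<open>M\<close> corresponds to \<open>(R1, R2)\<close> if it is the state space of the first factor: the factors
  are the compressions of the given realization to \<open>M\<close> and to its orthogonal companion, written
  with the full main operator \<open>A\<close> (so these realizations are not minimal in general).\<close>

definition supported_by :: "real \<Rightarrow> nat \<Rightarrow> nat \<Rightarrow> ht mat \<Rightarrow> ht mat \<Rightarrow> ht mat \<Rightarrow> ht mat \<Rightarrow>
    ht mat \<Rightarrow> ht mat \<Rightarrow> (real \<rightharpoonup> ht mat) \<Rightarrow> (real \<rightharpoonup> ht mat) \<Rightarrow> ht mat set \<Rightarrow> bool" where
  "supported_by t n N C A B H D1 D2 R1 R2 M \<longleftrightarrow>
     (\<exists>P. is_H_projection t N H M P \<and>
        is_realization t n R1 N D1 C A (P \<odot>\<^bsub>t\<^esub> B \<odot>\<^bsub>t\<^esub> ht_inv t D2) \<and>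
        is_realization t n R2 N D2 (ht_inv t D1 \<odot>\<^bsub>t\<^esub> C \<odot>\<^bsub>t\<^esub> (ht_one_mat N - P)) A B)"

end

theory Submission
  imports Defs
begin

text \<open>
A projection \<open>P\<close> of the state space splits \<open>R\<close> into the functions realized by
\<open>(D1, C, A, P B D2\<inverse>)\<close> and \<open>(D2, D1\<inverse> C (1 - P), A, B)\<close> as soon as it solves the Riccati equation
\<open>P A - A P = P B D\<inverse> C (1 - P)\<close>; this is \<open>supporting_factorization\<close>.  A solution is determined by
\<open>C P\<close> and \<open>P B\<close> (\<open>supporting_unique\<close>), which by minimality can be read off from the two factors.
The equations for \<open>H\<close> say that \<open>B D\<inverse> C\<close> is the sum of \<open>A\<close> and its \<open>H\<close>-adjoint, so an
\<open>H\<close>-self-adjoint projection with \<open>A\<close>-invariant range is a solution (\<open>supporting_of_invariant\<close>).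
The correspondence sends a factorization to the range of its projection.

Given a factorization, the series connection of minimal realizations of the factors has \<open>N\<close> states
and the Markov parameters of \<open>R\<close>, hence is isomorphic to the given realization
(\<open>state_space_isomorphism\<close>); the projection onto its first block gives a solution \<open>P\<close>.  If \<open>R1\<close> is
\<open>J\<close>-unitary, then \<open>R2(x) = J R1(-x)\<star> J R(x)\<close>, and by \<open>adjoint_left_factor\<close> the right-hand side is
the second factor that belongs to the \<open>H\<close>-adjoint of \<open>P\<close>.  By uniqueness \<open>P\<close> is its own adjoint, so
its range is non-degenerate (\<open>subspace_of_factorization\<close>).

Conversely, a non-degenerate submodule has a finite \<open>H\<close>-orthogonal basis, by Gram and Schmidt
(\<open>nondegenerate_submodule_basis\<close>).  This works for both signs of \<open>t\<close>, although for \<open>t > 0\<close> the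
algebra has zero divisors: the scalar \<open>f\<star> H f\<close> is fixed by the involution, therefore real, therefore
zero or invertible.  So the submodule and its orthogonal companion are free, with ranks that add up
to \<open>N\<close>.  The compressions of the realization to them are minimal, whence the degrees of the factors
add up, and \<open>adjoint_left_factor\<close>, read for a self-adjoint \<open>P\<close>, makes both factors \<open>J\<close>-unitary
(\<open>factorization_of_subspace\<close>).

Two principles replace the linear algebra over a field.  Every square matrix satisfies a real
polynomial equation, so that an injective one is invertible and its inverse is a polynomial in it;
this also turns vanishing Markov parameters into vanishing of the resolvent expression at every
point.  And observability yields a left inverse of the observability map, through a Gram matrix for
an involution that is positive for either sign of \<open>t\<close>.
\<close>

section \<open>The algebra and its matrices\<close>

text \<open>The product of \<open>ht_sharp t q\<close> and \<open>q\<close> has a positive real part for \<open>q \<noteq> 0\<close> and either sign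
  of \<open>t\<close>.  The involution \<open>ht_star\<close> has this property for negative \<open>t\<close> only.\<close>

definition ht_sharp :: "real \<Rightarrow> ht \<Rightarrow> ht" where
  "ht_sharp t q = (cnj (fst q), of_real (sgn t) * snd q)"

locale ht_algebra =
  fixes t :: real
  assumes t0: "t \<noteq> 0"
begin

abbreviation hmul :: "ht \<Rightarrow> ht \<Rightarrow> ht" where "hmul \<equiv> ht_mult t"

lemma hmul_assoc: "hmul (hmul p q) r = hmul p (hmul q r)"
  by (simp add: ht_mult_def algebra_simps)

lemma hmul_add_left: "hmul (p + q) r = hmul p r + hmul q r"
  and hmul_add_right: "hmul r (p + q) = hmul r p + hmul r q"
  by (simp_all add: ht_mult_def algebra_simps)

lemma hmul_zero [simp]: "hmul 0 q = 0" "hmul q 0 = 0"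
  by (simp_all add: ht_mult_def zero_prod_def)

lemma hmul_one [simp]: "hmul (1, 0) q = q" "hmul q (1, 0) = q"
  by (simp_all add: ht_mult_def)

lemma hmul_minus: "hmul (- p) q = - hmul p q" "hmul p (- q) = - hmul p q"
  by (simp_all add: ht_mult_def)

lemma hmul_diff: "hmul (p - q) r = hmul p r - hmul q r" "hmul r (p - q) = hmul r p - hmul r q"
  by (simp_all add: ht_mult_def algebra_simps)

lemma hmul_scaleR: "hmul (c *\<^sub>R p) q = c *\<^sub>R hmul p q" "hmul p (c *\<^sub>R q) = c *\<^sub>R hmul p q"
  by (simp_all add: ht_mult_def scaleR_conv_of_real algebra_simps)

lemma hmul_sum_left: "hmul (sum f S) r = (\<Sum>i\<in>S. hmul (f i) r)"
  and hmul_sum_right: "hmul r (sum f S) = (\<Sum>i\<in>S. hmul r (f i))"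
  by (induction S rule: infinite_finite_induct) (auto simp: hmul_add_left hmul_add_right)

lemma ht_star_simps [simp]:
  "ht_star (ht_star q) = q" "ht_star 0 = 0" "ht_star (1, 0) = (1, 0)"
  by (simp_all add: ht_star_def zero_prod_def)

lemma ht_star_add: "ht_star (p + q) = ht_star p + ht_star q"
  and ht_star_diff: "ht_star (p - q) = ht_star p - ht_star q"
  and ht_star_minus: "ht_star (- q) = - ht_star q"
  and ht_star_scaleR: "ht_star (c *\<^sub>R q) = c *\<^sub>R ht_star q"
  by (simp_all add: ht_star_def prod_eq_iff)

lemma ht_star_sum: "ht_star (sum f S) = (\<Sum>i\<in>S. ht_star (f i))"
  by (induction S rule: infinite_finite_induct) (auto simp: ht_star_add)

lemma ht_star_mult: "ht_star (hmul p q) = hmul (ht_star q) (ht_star p)"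
  by (simp add: ht_star_def ht_mult_def algebra_simps)

abbreviation mul :: "ht mat \<Rightarrow> ht mat \<Rightarrow> ht mat" (infixl "**" 70) where
  "A ** B \<equiv> A \<odot>\<^bsub>t\<^esub> B"

abbreviation star :: "ht mat \<Rightarrow> ht mat" ("_\<star>" [1000] 1000) where
  "A\<star> \<equiv> ht_star_mat A"

abbreviation scl :: "real \<Rightarrow> ht mat \<Rightarrow> ht mat" (infixr "*s" 75) where
  "x *s A \<equiv> ht_scaleR_mat x A"

lemmas dimD = carrier_matD

abbreviation mats :: "nat \<Rightarrow> nat \<Rightarrow> ht mat set" where "mats \<equiv> carrier_mat"

abbreviation fixed :: "nat \<Rightarrow> ht mat \<Rightarrow> ht mat set" where
  "fixed N P \<equiv> {f \<in> mats N 1. P ** f = f}"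

abbreviation ker :: "nat \<Rightarrow> ht mat \<Rightarrow> ht mat set" where
  "ker N P \<equiv> {f \<in> mats N 1. P ** f = 0\<^sub>m N 1}"

abbreviation one :: "nat \<Rightarrow> ht mat" where "one \<equiv> ht_one_mat"

lemma mul_dim [simp]: "dim_row (A ** B) = dim_row A" "dim_col (A ** B) = dim_col B"
  by (simp_all add: ht_mat_mult_def)

lemma star_dim [simp]: "dim_row (A\<star>) = dim_col A" "dim_col (A\<star>) = dim_row A"
  by (simp_all add: ht_star_mat_def)

lemma scl_dim [simp]: "dim_row (x *s A) = dim_row A" "dim_col (x *s A) = dim_col A"
  by (simp_all add: ht_scaleR_mat_def)

lemma one_dim [simp]: "dim_row (one n) = n" "dim_col (one n) = n"
  by (simp_all add: ht_one_mat_def)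

lemma mul_index: "i < dim_row A \<Longrightarrow> j < dim_col B \<Longrightarrow>
    (A ** B) $$ (i, j) = (\<Sum>k<dim_col A. hmul (A $$ (i, k)) (B $$ (k, j)))"
  by (simp add: ht_mat_mult_def)

lemma star_index [simp]: "i < dim_col A \<Longrightarrow> j < dim_row A \<Longrightarrow> A\<star> $$ (i, j) = ht_star (A $$ (j, i))"
  by (simp add: ht_star_mat_def)

lemma scl_index [simp]: "i < dim_row A \<Longrightarrow> j < dim_col A \<Longrightarrow> (x *s A) $$ (i, j) = x *\<^sub>R (A $$ (i, j))"
  by (simp add: ht_scaleR_mat_def)

lemma one_index [simp]: "i < n \<Longrightarrow> j < n \<Longrightarrow> one n $$ (i, j) = (if i = j then (1, 0) else 0)"
  by (simp add: ht_one_mat_def)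

lemma mul_carrier: "A \<in> mats a b \<Longrightarrow> B \<in> mats b c \<Longrightarrow> A ** B \<in> mats a c"
  by auto

lemma star_carrier: "A \<in> mats a b \<Longrightarrow> A\<star> \<in> mats b a"
  by auto

lemma scl_carrier: "A \<in> mats a b \<Longrightarrow> x *s A \<in> mats a b"
  by auto

lemma one_carrier [simp]: "one n \<in> mats n n"
  by auto

text \<open>The laws are stated with equations between dimensions instead of carriers, so that the
  simplifier can discharge their hypotheses when it knows the dimensions of the atoms.\<close>

lemma mul_assoc: "dim_col A = dim_row B \<Longrightarrow> dim_col B = dim_row C \<Longrightarrow> A ** B ** C = A ** (B ** C)"
proof (rule eq_matI, goal_cases)
  case (1 i j)
  have "(A ** B ** C) $$ (i, j) =
    (\<Sum>k<dim_col B. \<Sum>l<dim_col A. hmul (A $$ (i, l)) (hmul (B $$ (l, k)) (C $$ (k, j))))"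
    using 1 by (simp add: mul_index hmul_sum_left hmul_assoc)
  also have "\<dots> = (A ** (B ** C)) $$ (i, j)"
    using 1 by (subst sum.swap) (simp add: mul_index hmul_sum_right)
  finally show ?case .
qed auto

lemma mul_add_left: "dim_row A = dim_row B \<Longrightarrow> dim_col A = dim_col B \<Longrightarrow> dim_col A = dim_row C \<Longrightarrow>
    (A + B) ** C = A ** C + B ** C"
  by (rule eq_matI) (auto simp: mul_index hmul_add_left sum.distrib)

lemma mul_add_right: "dim_row A = dim_row B \<Longrightarrow> dim_col A = dim_col B \<Longrightarrow> dim_col C = dim_row A \<Longrightarrow>
    C ** (A + B) = C ** A + C ** B"
  by (rule eq_matI) (auto simp: mul_index hmul_add_right sum.distrib)

lemma mul_diff_left: "dim_row A = dim_row B \<Longrightarrow> dim_col A = dim_col B \<Longrightarrow> dim_col A = dim_row C \<Longrightarrow>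
    (A - B) ** C = A ** C - B ** C"
  by (rule eq_matI) (auto simp: mul_index hmul_diff sum_subtractf)

lemma mul_diff_right: "dim_row A = dim_row B \<Longrightarrow> dim_col A = dim_col B \<Longrightarrow> dim_col C = dim_row A \<Longrightarrow>
    C ** (A - B) = C ** A - C ** B"
  by (rule eq_matI) (auto simp: mul_index hmul_diff sum_subtractf)

lemma mul_uminus_left: "dim_col A = dim_row C \<Longrightarrow> (- A) ** C = - (A ** C)"
  by (rule eq_matI) (auto simp: mul_index hmul_minus sum_negf)

lemma mul_uminus_right: "dim_col C = dim_row A \<Longrightarrow> C ** (- A) = - (C ** A)"
  by (rule eq_matI) (auto simp: mul_index hmul_minus sum_negf)

lemma mul_scl_left: "dim_col A = dim_row B \<Longrightarrow> (x *s A) ** B = x *s (A ** B)"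
  by (rule eq_matI) (auto simp: mul_index hmul_scaleR scaleR_right.sum)

lemma mul_scl_right: "dim_col A = dim_row B \<Longrightarrow> A ** (x *s B) = x *s (A ** B)"
  by (rule eq_matI) (auto simp: mul_index hmul_scaleR scaleR_right.sum)

lemma mul_one_left [simp]: "dim_row A = n \<Longrightarrow> one n ** A = A"
  by (rule eq_matI) (auto simp: mul_index if_distrib[of "\<lambda>q. hmul q _"] cong: if_cong)

lemma mul_one_right [simp]: "dim_col A = n \<Longrightarrow> A ** one n = A"
  by (rule eq_matI) (auto simp: mul_index if_distrib[of "\<lambda>q. hmul _ q"] cong: if_cong)

lemma mul_zero_left [simp]: "dim_row A = n \<Longrightarrow> 0\<^sub>m m n ** A = 0\<^sub>m m (dim_col A)"
  by (rule eq_matI) (auto simp: mul_index)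

lemma mul_zero_right [simp]: "dim_col A = n \<Longrightarrow> A ** 0\<^sub>m n m = 0\<^sub>m (dim_row A) m"
  by (rule eq_matI) (auto simp: mul_index)

lemma star_mul: "dim_col A = dim_row B \<Longrightarrow> (A ** B)\<star> = B\<star> ** A\<star>"
  by (rule eq_matI) (auto simp: mul_index ht_star_sum ht_star_mult)

lemma star_star [simp]: "A\<star>\<star> = A"
  by (rule eq_matI) auto

lemma star_add: "dim_row A = dim_row B \<Longrightarrow> dim_col A = dim_col B \<Longrightarrow> (A + B)\<star> = A\<star> + B\<star>"
  by (rule eq_matI) (auto simp: ht_star_add)

lemma star_diff: "dim_row A = dim_row B \<Longrightarrow> dim_col A = dim_col B \<Longrightarrow> (A - B)\<star> = A\<star> - B\<star>"
  by (rule eq_matI) (auto simp: ht_star_diff)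

lemma star_uminus: "(- A)\<star> = - A\<star>"
  by (rule eq_matI) (auto simp: ht_star_minus)

lemma star_scl: "(x *s A)\<star> = x *s A\<star>"
  by (rule eq_matI) (auto simp: ht_star_scaleR)

lemma star_one [simp]: "(one n)\<star> = one n"
  by (rule eq_matI) auto

lemma star_zero [simp]: "(0\<^sub>m a b)\<star> = 0\<^sub>m b a"
  by (rule eq_matI) auto

lemma scl_scl [simp]: "x *s y *s A = (x * y) *s A"
  by (rule eq_matI) auto

lemma scl_zero [simp]: "0 *s A = 0\<^sub>m (dim_row A) (dim_col A)"
  by (rule eq_matI) auto

lemma scl_zero_mat [simp]: "x *s 0\<^sub>m a b = 0\<^sub>m a b"
  by (rule eq_matI) auto

lemmas mul_distribs = mul_add_left mul_add_right mul_diff_left mul_diff_right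
  mul_uminus_left mul_uminus_right mul_scl_left mul_scl_right
lemmas star_distribs = star_mul star_add star_diff star_uminus star_scl

lemma mul_cancel_assoc: "A ** B = E \<Longrightarrow> dim_col A = dim_row B \<Longrightarrow> dim_col B = dim_row X \<Longrightarrow>
    A ** (B ** X) = E ** X"
  by (metis mul_assoc)

subsection \<open>Finite sums of matrices\<close>

text \<open>The format is a parameter because an empty sum does not determine it.\<close>

definition msum :: "nat \<Rightarrow> nat \<Rightarrow> (nat \<Rightarrow> ht mat) \<Rightarrow> nat \<Rightarrow> ht mat" where
  "msum a b f K = mat a b (\<lambda>ij. \<Sum>k<K. f k $$ ij)"

lemma msum_dim [simp]: "dim_row (msum a b f K) = a" "dim_col (msum a b f K) = b"
  by (simp_all add: msum_def)

lemma msum_carrier [simp]: "msum a b f K \<in> mats a b"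
  by auto

lemma msum_index [simp]: "i < a \<Longrightarrow> j < b \<Longrightarrow> msum a b f K $$ (i, j) = (\<Sum>k<K. f k $$ (i, j))"
  by (simp add: msum_def)

lemma msum_cong: "(\<And>k. k < K \<Longrightarrow> f k = g k) \<Longrightarrow> msum a b f K = msum a b g K"
  by (simp add: msum_def)

lemma msum_zero [simp]: "msum a b (\<lambda>_. 0\<^sub>m a b) K = 0\<^sub>m a b"
  by (rule eq_matI) auto

lemma mul_msum: "dim_col X = a \<Longrightarrow> (\<And>k. k < K \<Longrightarrow> f k \<in> mats a b) \<Longrightarrow>
    X ** msum a b f K = msum (dim_row X) b (\<lambda>k. X ** f k) K"
proof (rule eq_matI, goal_cases)
  case (1 i j)
  then have "(X ** msum a b f K) $$ (i, j) = (\<Sum>l<a. \<Sum>k<K. hmul (X $$ (i, l)) (f k $$ (l, j)))"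
    by (simp add: mul_index hmul_sum_right)
  also have "\<dots> = (\<Sum>k<K. \<Sum>l<a. hmul (X $$ (i, l)) (f k $$ (l, j)))"
    by (rule sum.swap)
  also have "\<dots> = (\<Sum>k<K. (X ** f k) $$ (i, j))"
  proof (rule sum.cong)
    fix k assume "k \<in> {..<K}"
    then have "f k \<in> mats a b" using 1 by auto
    then show "(\<Sum>l<a. hmul (X $$ (i, l)) (f k $$ (l, j))) = (X ** f k) $$ (i, j)"
      using 1 by (auto simp: mul_index)
  qed simp
  finally show ?case using 1 by simp
qed auto

lemma msum_mul: "dim_row X = b \<Longrightarrow> (\<And>k. k < K \<Longrightarrow> f k \<in> mats a b) \<Longrightarrow>
    msum a b f K ** X = msum a (dim_col X) (\<lambda>k. f k ** X) K"
proof (rule eq_matI, goal_cases)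
  case (1 i j)
  then have "(msum a b f K ** X) $$ (i, j) = (\<Sum>l<b. \<Sum>k<K. hmul (f k $$ (i, l)) (X $$ (l, j)))"
    by (simp add: mul_index hmul_sum_left)
  also have "\<dots> = (\<Sum>k<K. \<Sum>l<b. hmul (f k $$ (i, l)) (X $$ (l, j)))"
    by (rule sum.swap)
  also have "\<dots> = (\<Sum>k<K. (f k ** X) $$ (i, j))"
  proof (rule sum.cong)
    fix k assume "k \<in> {..<K}"
    then have "f k \<in> mats a b" using 1 by auto
    then show "(\<Sum>l<b. hmul (f k $$ (i, l)) (X $$ (l, j))) = (f k ** X) $$ (i, j)"
      using 1 by (auto simp: mul_index)
  qed simp
  finally show ?case using 1 by simp
qed auto

lemma star_msum: "(\<And>k. k < K \<Longrightarrow> f k \<in> mats a b) \<Longrightarrow>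
    (msum a b f K)\<star> = msum b a (\<lambda>k. (f k)\<star>) K"
proof (rule eq_matI, goal_cases)
  case (1 i j)
  have "ht_star (f k $$ (j, i)) = (f k)\<star> $$ (i, j)" if "k < K" for k
    using 1 that 1(1)[OF that] by (subst star_index) auto
  then show ?case using 1 by (simp add: ht_star_sum)
qed auto

subsection \<open>Powers\<close>

abbreviation mpow :: "ht mat \<Rightarrow> nat \<Rightarrow> ht mat" where "mpow \<equiv> ht_mat_pow t"

lemma mpow_carrier: "A \<in> mats n n \<Longrightarrow> mpow A k \<in> mats n n"
  by (induction k) auto

lemma mpow_dim: "A \<in> mats n n \<Longrightarrow> dim_row (mpow A k) = n \<and> dim_col (mpow A k) = n"
  using mpow_carrier[of A n k] by blast

lemma mpow_add: "A \<in> mats n n \<Longrightarrow> mpow A (j + k) = mpow A j ** mpow A k"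
proof (induction k)
  case (Suc k)
  then show ?case using mpow_dim[OF Suc.prems] by (auto simp: mul_assoc)
qed (auto simp: mpow_dim)

lemma mpow_1 [simp]: "A \<in> mats n n \<Longrightarrow> mpow A (Suc 0) = A"
  by auto

lemma mpow_Suc_left: "A \<in> mats n n \<Longrightarrow> mpow A (Suc k) = A ** mpow A k"
  using mpow_add[of A n 1 k] by (simp del: ht_mat_pow.simps)

lemma star_mpow: "A \<in> mats n n \<Longrightarrow> (mpow A k)\<star> = mpow (A\<star>) k"
proof (induction k)
  case (Suc k)
  then have "(mpow A (Suc k))\<star> = A\<star> ** mpow (A\<star>) k"
    using mpow_dim[OF Suc.prems] by (simp add: star_mul)
  then show ?case using mpow_Suc_left[OF star_carrier[OF Suc.prems], of k] by simp
qed auto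

end

section \<open>Inverses without a division ring\<close>

text \<open>Elimination: a vector with a non-zero coordinate is used to clear that coordinate in the others.\<close>

lemma linear_dependency:
  fixes f :: "'i \<Rightarrow> 'j \<Rightarrow> real"
  assumes "finite K" "finite I" "card K < card I"
  shows "\<exists>c. (\<exists>i\<in>I. c i \<noteq> 0) \<and> (\<forall>j\<in>K. (\<Sum>i\<in>I. c i * f i j) = 0)"
  using assms
proof (induction K arbitrary: I f rule: finite_induct)
  case empty
  then obtain i where "i \<in> I" by fastforce
  then show ?case by (intro exI[of _ "\<lambda>_. 1"]) auto
next
  case (insert a K)
  show ?case
  proof (cases "\<exists>p\<in>I. f p a \<noteq> 0")
    case False
    then show ?thesis using insert.IH[of I f] insert.prems insert.hyps by auto
  next
    case True
    then obtain p where p: "p \<in> I" "f p a \<noteq> 0" by blast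
    let ?g = "\<lambda>i j. f i j - f i a / f p a * f p j"
    have "card K < card (I - {p})"
      using insert.prems insert.hyps p by auto
    from insert.IH[OF _ this, of ?g] insert.prems obtain c i0 where
      c: "i0 \<in> I - {p}" "c i0 \<noteq> 0" "\<forall>j\<in>K. (\<Sum>i\<in>I - {p}. c i * ?g i j) = 0" by auto
    define d where "d = c(p := - (\<Sum>i\<in>I - {p}. c i * f i a) / f p a)"
    have d: "(\<Sum>i\<in>I. d i * f i j) = (\<Sum>i\<in>I - {p}. c i * ?g i j)" for j
    proof -
      have "(\<Sum>i\<in>I. d i * f i j) = d p * f p j + (\<Sum>i\<in>I - {p}. d i * f i j)"
        using insert.prems p by (simp add: sum.remove)
      also have "(\<Sum>i\<in>I - {p}. d i * f i j) = (\<Sum>i\<in>I - {p}. c i * f i j)"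
        by (rule sum.cong) (auto simp: d_def)
      also have "d p * f p j = - (\<Sum>i\<in>I - {p}. c i * (f i a / f p a * f p j))"
        by (simp add: d_def sum_distrib_right sum_divide_distrib mult.assoc)
      also have "\<dots> + (\<Sum>i\<in>I - {p}. c i * f i j) = (\<Sum>i\<in>I - {p}. c i * ?g i j)"
        by (simp add: right_diff_distrib sum_subtractf)
      finally show ?thesis .
    qed
    have "\<exists>i\<in>I. d i \<noteq> 0" using c by (intro bexI[of _ i0]) (auto simp: d_def)
    moreover have "\<forall>j\<in>insert a K. (\<Sum>i\<in>I. d i * f i j) = 0"
      using c(3) p(2) by (auto simp: d)
    ultimately show ?thesis by blast
  qed
qed

context ht_algebra
begin

text \<open>All powers of \<open>A\<close> lie in a real vector space of dimension \<open>4 N\<^sup>2\<close>.\<close>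

lemma annihilating_polynomial:
  assumes A: "A \<in> mats N N"
  shows "\<exists>K c. (\<exists>i<K. c i \<noteq> 0) \<and> msum N N (\<lambda>i. c i *s mpow A i) K = 0\<^sub>m N N"
proof -
  define f where "f = (\<lambda>k (i, j, m). let q = mpow A k $$ (i, j) in
      if m = 0 then Re (fst q) else if m = 1 then Im (fst q)
      else if m = (2::nat) then Re (snd q) else Im (snd q))"
  let ?K = "{..<N} \<times> {..<N} \<times> {..<4::nat}"
  obtain c where c: "\<exists>i\<in>{..<Suc (card ?K)}. c i \<noteq> 0"
      "\<forall>j\<in>?K. (\<Sum>i\<in>{..<Suc (card ?K)}. c i * f i j) = 0"
    using linear_dependency[of ?K "{..<Suc (card ?K)}" f] by auto
  have "(\<Sum>k<Suc (card ?K). c k *\<^sub>R mpow A k $$ (i, j)) = 0" if "i < N" "j < N" for i j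
  proof -
    let ?s = "\<Sum>k<Suc (card ?K). c k *\<^sub>R mpow A k $$ (i, j)"
    have z: "(\<Sum>k<Suc (card ?K). c k * f k (i, j, m)) = 0" if "m < 4" for m
      using c(2) \<open>i < N\<close> \<open>j < N\<close> that by blast
    have "Re (fst ?s) = 0" "Im (fst ?s) = 0" "Re (snd ?s) = 0" "Im (snd ?s) = 0"
      using z[of 0] z[of 1] z[of 2] z[of 3]
      by (simp_all add: f_def fst_sum snd_sum Let_def del: sum.lessThan_Suc)
    then show ?thesis by (simp add: prod_eq_iff complex_eq_iff)
  qed
  then have "msum N N (\<lambda>i. c i *s mpow A i) (Suc (card ?K)) = 0\<^sub>m N N"
    using A by (intro eq_matI) (auto simp: mpow_dim[OF A] simp del: sum.lessThan_Suc)
  then show ?thesis using c(1) by blast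
qed

text \<open>An annihilating polynomial is divided by its lowest non-zero coefficient.\<close>

lemma power_eq_higher_powers:
  assumes A: "A \<in> mats N N"
  shows "\<exists>k m c. mpow A k = mpow A k ** (A ** msum N N (\<lambda>i. c i *s mpow A i) m)"
proof -
  note [simp] = mpow_dim[OF A] dimD[OF A]
  obtain K c where c: "\<exists>i<K. c i \<noteq> (0::real)" "msum N N (\<lambda>i. c i *s mpow A i) K = 0\<^sub>m N N"
    using annihilating_polynomial[OF A] by blast
  define k where "k = (LEAST i. c i \<noteq> 0)"
  obtain i0 where i0: "i0 < K" "c i0 \<noteq> 0" using c(1) by blast
  have k: "c k \<noteq> 0" "k < K" "\<And>i. i < k \<Longrightarrow> c i = 0"
    unfolding k_def
      apply (rule LeastI[of "\<lambda>i. c i \<noteq> 0", OF i0(2)])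
     apply (rule le_less_trans[OF Least_le[of "\<lambda>i. c i \<noteq> 0", OF i0(2)] i0(1)])
    using not_less_Least by blast
  obtain m where m: "K = k + Suc m" using k(2) by (metis add_Suc_right less_imp_Suc_add)
  define d where "d i = - c (Suc (k + i)) / c k" for i
  have "mpow A k = msum N N (\<lambda>i. d i *s mpow A (Suc (k + i))) m"
  proof (rule eq_matI, goal_cases)
    case (1 p q)
    let ?a = "\<lambda>i. mpow A i $$ (p, q)"
    have "0 = (\<Sum>i<K. c i *\<^sub>R ?a i)"
      using arg_cong[OF c(2), of "\<lambda>M. M $$ (p, q)"] 1 by simp
    also have "\<dots> = (\<Sum>i\<in>{..<k} \<union> {k..<K}. c i *\<^sub>R ?a i)"
      using k(2) by (auto intro!: sum.cong)
    also have "\<dots> = (\<Sum>i<k. c i *\<^sub>R ?a i) + (\<Sum>i=k..<K. c i *\<^sub>R ?a i)"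
      by (rule sum.union_disjoint) auto
    also have "(\<Sum>i<k. c i *\<^sub>R ?a i) = 0"
      by (rule sum.neutral) (auto simp: k)
    also have "(\<Sum>i=k..<K. c i *\<^sub>R ?a i) = (\<Sum>i<Suc m. c (k + i) *\<^sub>R ?a (k + i))"
      by (subst sum.atLeastLessThan_shift_0) (simp add: m atLeast0LessThan)
    also have "\<dots> = c k *\<^sub>R ?a k + (\<Sum>i<m. c (Suc (k + i)) *\<^sub>R ?a (Suc (k + i)))"
      by (subst sum.lessThan_Suc_shift) simp
    finally have "c k *\<^sub>R ?a k = - (\<Sum>i<m. c (Suc (k + i)) *\<^sub>R ?a (Suc (k + i)))"
      by (simp only: eq_neg_iff_add_eq_0 add_0)
    then have "(1 / c k) *\<^sub>R (c k *\<^sub>R ?a k) =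
        (1 / c k) *\<^sub>R - (\<Sum>i<m. c (Suc (k + i)) *\<^sub>R ?a (Suc (k + i)))" by (rule arg_cong)
    then have "?a k = (\<Sum>i<m. d i *\<^sub>R ?a (Suc (k + i)))"
      using k(1) by (simp add: d_def scaleR_sum_right sum_negf del: ht_mat_pow.simps)
    then show ?case using 1 by (simp del: ht_mat_pow.simps)
  qed auto
  also have "\<dots> = msum N N (\<lambda>i. mpow A k ** (A ** (d i *s mpow A i))) m"
  proof (rule msum_cong)
    fix i
    have "mpow A (Suc (k + i)) = mpow A k ** (A ** mpow A i)"
      by (metis add_Suc_right mpow_add[OF A] mpow_Suc_left[OF A])
    then show "d i *s mpow A (Suc (k + i)) = mpow A k ** (A ** (d i *s mpow A i))"
      by (simp add: mul_scl_right del: ht_mat_pow.simps)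
  qed
  also have "\<dots> = mpow A k ** (A ** msum N N (\<lambda>i. d i *s mpow A i) m)"
  proof -
    have c1: "d i *s mpow A i \<in> mats N N" for i by (intro scl_carrier mpow_carrier A)
    have c2: "A ** (d i *s mpow A i) \<in> mats N N" for i by (rule mul_carrier[OF A c1])
    have e: "A ** msum N N (\<lambda>i. d i *s mpow A i) m = msum N N (\<lambda>i. A ** (d i *s mpow A i)) m"
      using mul_msum[of A N m "\<lambda>i. d i *s mpow A i" N] c1 by simp
    show ?thesis
      unfolding e using mul_msum[of "mpow A k" N m "\<lambda>i. A ** (d i *s mpow A i)" N] c2 by simp
  qed
  finally show ?thesis by blast
qed

text \<open>An annihilating polynomial is divided by its leading coefficient.\<close>

lemma power_eq_lower_powers:
  assumes A: "A \<in> mats N N"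
  shows "\<exists>K c. mpow A K = msum N N (\<lambda>i. c i *s mpow A i) K"
proof -
  note [simp] = mpow_dim[OF A] dimD[OF A]
  obtain K c where c: "\<exists>i<K. c i \<noteq> (0::real)" "msum N N (\<lambda>i. c i *s mpow A i) K = 0\<^sub>m N N"
    using annihilating_polynomial[OF A] by blast
  define k where "k = Max {i. i < K \<and> c i \<noteq> 0}"
  have fin: "finite {i. i < K \<and> c i \<noteq> 0}" by simp
  have "k \<in> {i. i < K \<and> c i \<noteq> 0}" unfolding k_def using c(1) by (intro Max_in) auto
  then have k: "c k \<noteq> 0" "k < K" by auto
  have z: "c i = 0" if "k < i" "i < K" for i
    using Max_ge[OF fin, of i, folded k_def] that by (cases "c i = 0") auto
  have "mpow A k = msum N N (\<lambda>i. (- c i / c k) *s mpow A i) k"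
  proof (rule eq_matI, goal_cases)
    case (1 p q)
    let ?a = "\<lambda>i. mpow A i $$ (p, q)"
    have "0 = (\<Sum>i<K. c i *\<^sub>R ?a i)"
      using arg_cong[OF c(2), of "\<lambda>M. M $$ (p, q)"] 1 by simp
    also have "\<dots> = (\<Sum>i<Suc k. c i *\<^sub>R ?a i)"
      using k(2) z by (intro sum.mono_neutral_right) (auto simp: not_less_eq)
    finally have "c k *\<^sub>R ?a k = - (\<Sum>i<k. c i *\<^sub>R ?a i)"
      by (simp only: eq_neg_iff_add_eq_0 sum.lessThan_Suc add.commute)
    then have "(1 / c k) *\<^sub>R (c k *\<^sub>R ?a k) = (1 / c k) *\<^sub>R - (\<Sum>i<k. c i *\<^sub>R ?a i)"
      by (rule arg_cong)
    then have "?a k = (\<Sum>i<k. (- c i / c k) *\<^sub>R ?a i)"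
      using k(1) by (simp add: scaleR_sum_right sum_negf)
    then show ?case using 1 by simp
  qed auto
  then show ?thesis by (intro exI)
qed

lemma ht_inverse_of_unique:
  assumes "ht_inverse_of t A B" "ht_inverse_of t A B'"
  shows "B = B'"
proof -
  have d: "dim_col A = dim_row A" "dim_row B = dim_row A" "dim_col B = dim_row A"
    "dim_row B' = dim_row A" "dim_col B' = dim_row A"
    using assms unfolding ht_inverse_of_def by auto
  have e: "A ** B' = one (dim_row A)" "B ** A = one (dim_row A)"
    using assms unfolding ht_inverse_of_def by auto
  have "B = B ** (A ** B')" by (simp add: e d)
  also have "\<dots> = B ** A ** B'" by (simp add: mul_assoc d)
  also have "\<dots> = B'" by (simp add: e d)
  finally show ?thesis .
qed

lemma ht_inv_eq: "ht_inverse_of t A B \<Longrightarrow> ht_inv t A = B"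
  unfolding ht_inv_def using ht_inverse_of_unique by blast

lemma ht_inverse_of_ht_inv: "ht_invertible t A \<Longrightarrow> ht_inverse_of t A (ht_inv t A)"
  unfolding ht_invertible_def using ht_inv_eq by blast

lemma ht_inverse_ofI: "A \<in> mats N N \<Longrightarrow> B \<in> mats N N \<Longrightarrow> A ** B = one N \<Longrightarrow>
    B ** A = one N \<Longrightarrow> ht_inverse_of t A B"
  by (auto simp: ht_inverse_of_def)

lemma ht_invD:
  assumes "ht_invertible t A" "A \<in> mats N N"
  shows "ht_inv t A \<in> mats N N" "A ** ht_inv t A = one N" "ht_inv t A ** A = one N"
  using ht_inverse_of_ht_inv[OF assms(1)] assms(2) by (auto simp: ht_inverse_of_def)

text \<open>An injective \<open>T\<close> can be cancelled \<open>k\<close> times from \<open>T\<^sup>k = T\<^sup>k (T S)\<close>.\<close>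

lemma injective_imp_polynomial_inverse:
  assumes T: "T \<in> mats N N"
    and inj: "\<And>X. X \<in> mats N N \<Longrightarrow> T ** X = 0\<^sub>m N N \<Longrightarrow> X = 0\<^sub>m N N"
  shows "\<exists>m c. ht_inverse_of t T (msum N N (\<lambda>i. c i *s mpow T i) m)"
proof -
  note [simp] = mpow_dim[OF T] dimD[OF T]
  obtain k m c where *: "mpow T k = mpow T k ** (T ** msum N N (\<lambda>i. c i *s mpow T i) m)"
    using power_eq_higher_powers[OF T] by blast
  define S where "S = msum N N (\<lambda>i. c i *s mpow T i) m"
  have S: "S \<in> mats N N" by (simp add: S_def)
  note [simp] = dimD[OF S]
  have pinj: "X = 0\<^sub>m N N" if "X \<in> mats N N" "mpow T k ** X = 0\<^sub>m N N" for X k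
    using that
  proof (induction k arbitrary: X)
    case (Suc k)
    have "mpow T k ** (T ** X) = 0\<^sub>m N N"
      using Suc.prems(2) dimD[OF Suc.prems(1)] by (simp add: mul_assoc)
    then have "T ** X = 0\<^sub>m N N" by (rule Suc.IH[OF mul_carrier[OF T Suc.prems(1)]])
    then show ?case by (rule inj[OF Suc.prems(1)])
  qed auto
  have "mpow T k ** (one N - T ** S) = 0\<^sub>m N N"
    using * by (simp add: mul_distribs flip: S_def) (rule eq_matI; simp)
  then have "one N - T ** S = 0\<^sub>m N N" by (rule pinj[rotated]) auto
  then have TS: "T ** S = one N"
    by (intro eq_matI) (auto simp: mat_eq_iff)
  have cs: "c i *s mpow T i \<in> mats N N" for i by (intro scl_carrier mpow_carrier T)
  have comm: "mpow T i ** T = T ** mpow T i" for i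
    by (metis ht_mat_pow.simps(2) mpow_Suc_left[OF T])
  have "S ** T = T ** S"
    unfolding S_def using cs
    by (subst mul_msum, simp, simp, subst msum_mul, simp, simp)
       (auto intro!: msum_cong simp: mul_scl_left mul_scl_right comm)
  with TS T S have "ht_inverse_of t T S" by (auto intro: ht_inverse_ofI)
  then show ?thesis unfolding S_def by blast
qed

lemma ht_inv_polynomial:
  assumes T: "T \<in> mats N N" and "ht_invertible t T"
  shows "\<exists>m c. ht_inv t T = msum N N (\<lambda>i. c i *s mpow T i) m"
proof -
  note i = ht_invD[OF assms(2,1)]
  note [simp] = dimD[OF i(1)] dimD[OF T]
  have "X = 0\<^sub>m N N" if "X \<in> mats N N" "T ** X = 0\<^sub>m N N" for X
  proof -
    have "X = ht_inv t T ** (T ** X)" using dimD[OF that(1)] by (simp add: mul_cancel_assoc[OF i(3)])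
    also have "\<dots> = 0\<^sub>m N N" unfolding that(2) by simp
    finally show ?thesis .
  qed
  from injective_imp_polynomial_inverse[OF T this] show ?thesis using ht_inv_eq by blast
qed

lemma injective_imp_invertible:
  assumes "T \<in> mats N N"
    and "\<And>X. X \<in> mats N N \<Longrightarrow> T ** X = 0\<^sub>m N N \<Longrightarrow> X = 0\<^sub>m N N"
  shows "ht_invertible t T"
  using injective_imp_polynomial_inverse[OF assms] unfolding ht_invertible_def by blast

text \<open>The right factor is injective because it has a left inverse.\<close>

lemma one_sided_inverse:
  assumes A: "A \<in> mats N N" and B: "B \<in> mats N N" and AB: "A ** B = one N"
  shows "B ** A = one N"
proof -
  note [simp] = dimD[OF A] dimD[OF B]
  have "ht_invertible t B"
  proof (rule injective_imp_invertible[OF B])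
    fix X assume X: "X \<in> mats N N" "B ** X = 0\<^sub>m N N"
    have "X = A ** (B ** X)" using X(1) AB by (subst mul_assoc[symmetric]) auto
    then show "X = 0\<^sub>m N N" by (simp add: X(2))
  qed
  note i = ht_invD[OF this B]
  note [simp] = dimD[OF i(1)]
  have "A = A ** (B ** ht_inv t B)" by (simp add: i)
  also have "\<dots> = ht_inv t B" by (simp add: AB flip: mul_assoc)
  finally show ?thesis using i by simp
qed

subsection \<open>Direct sums of coordinate spaces\<close>

text \<open>The inclusions of the two summands.  Their entries are real, so that \<open>star\<close> transposes them into
  the projections; blocks of a matrix are cut out by multiplication, without index arithmetic.\<close>

definition inl :: "nat \<Rightarrow> nat \<Rightarrow> ht mat" where
  "inl a b = mat (a + b) a (\<lambda>(i, j). if i = j then (1, 0) else 0)"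

definition inr :: "nat \<Rightarrow> nat \<Rightarrow> ht mat" where
  "inr a b = mat (a + b) b (\<lambda>(i, j). if i = a + j then (1, 0) else 0)"

lemma inl_dim [simp]: "dim_row (inl a b) = a + b" "dim_col (inl a b) = a"
  and inr_dim [simp]: "dim_row (inr a b) = a + b" "dim_col (inr a b) = b"
  by (simp_all add: inl_def inr_def)

lemma inl_carrier [simp]: "inl a b \<in> mats (a + b) a"
  and inr_carrier [simp]: "inr a b \<in> mats (a + b) b"
  by auto

lemma direct_sum_relations [simp]:
  "(inl a b)\<star> ** inl a b = one a" "(inr a b)\<star> ** inr a b = one b"
  "(inl a b)\<star> ** inr a b = 0\<^sub>m a b" "(inr a b)\<star> ** inl a b = 0\<^sub>m b a"
proof -
  have d: "hmul (if P then (1, 0) else 0) q = (if P then q else 0)" for P q by simp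
  have e: "ht_star (if P then (1, 0) else 0) = (if P then (1, 0) else 0)" for P by simp
  show "(inl a b)\<star> ** inl a b = one a" "(inr a b)\<star> ** inr a b = one b"
    "(inl a b)\<star> ** inr a b = 0\<^sub>m a b" "(inr a b)\<star> ** inl a b = 0\<^sub>m b a"
    by (rule eq_matI; auto simp: mul_index inl_def inr_def e d)+
qed

lemma direct_sum_total: "inl a b ** (inl a b)\<star> + inr a b ** (inr a b)\<star> = one (a + b)"
proof (rule eq_matI, goal_cases)
  case (1 i j)
  have d: "hmul (if P then (1, 0) else 0) q = (if P then q else 0)" for P q by simp
  have e: "ht_star (if P then (1, 0) else 0) = (if P then (1, 0) else 0)" for P by simp
  have l: "(inl a b ** (inl a b)\<star>) $$ (i, j) = (if i = j \<and> i < a then (1, 0) else 0)"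
    using 1 by (auto simp: mul_index inl_def e d if_distrib[of "\<lambda>q. hmul _ q"] cong: if_cong)
  have "(inr a b ** (inr a b)\<star>) $$ (i, j) = (\<Sum>k<b. if i = a + k then (if j = a + k then (1, 0) else 0) else 0)"
    using 1 by (simp add: mul_index inr_def e d)
  also have "\<dots> = (\<Sum>k<b. if k = i - a then (if i = j \<and> a \<le> i then (1, 0) else 0) else 0)"
    by (rule sum.cong) auto
  also have "\<dots> = (if i = j \<and> a \<le> i then (1, 0) else 0)"
    using 1 by (auto simp: sum.delta')
  finally show ?case using 1 l by auto
qed auto

lemma direct_sum_cancel [simp]:
  "dim_row X = a \<Longrightarrow> (inl a b)\<star> ** (inl a b ** X) = X"
  "dim_row X = b \<Longrightarrow> (inr a b)\<star> ** (inr a b ** X) = X"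
  "dim_row X = b \<Longrightarrow> (inl a b)\<star> ** (inr a b ** X) = 0\<^sub>m a (dim_col X)"
  "dim_row X = a \<Longrightarrow> (inr a b)\<star> ** (inl a b ** X) = 0\<^sub>m b (dim_col X)"
  by (simp_all flip: mul_assoc)

text \<open>If \<open>k > N\<close>, then padding with zeros produces square matrices with product \<open>1\<close> in one order, but
  with a zero block in the other order.\<close>

lemma left_invertible_imp_le:
  assumes V: "V \<in> mats N k" and L: "L \<in> mats k N" and LV: "L ** V = one k"
  shows "k \<le> N"
proof (rule ccontr)
  assume "\<not> k \<le> N"
  then obtain b where k: "k = N + b" and b: "b > 0"
    using less_imp_add_positive[of N k] by (auto simp: not_le)
  note V = V[unfolded k] and L = L[unfolded k] and LV = LV[unfolded k]
  note [simp] = dimD[OF V] dimD[OF L] LV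
  let ?E = "inl N b" let ?F = "inr N b"
  have "(L ** ?E\<star>) ** (?E ** V) = one (N + b)"
    by (simp add: mul_assoc)
  then have *: "(?E ** V) ** (L ** ?E\<star>) = one (N + b)"
    by (rule one_sided_inverse[rotated 2]) auto
  have "?F\<star> ** ((?E ** V) ** (L ** ?E\<star>)) ** ?F = 0\<^sub>m b b"
    by (simp add: mul_assoc)
  then have "one b = 0\<^sub>m b b" unfolding * by simp
  then have "one b $$ (0, 0) = 0\<^sub>m b b $$ (0, 0)" by simp
  then show False using b by (simp add: zero_prod_def)
qed

section \<open>Resolvents and Markov parameters\<close>

definition mnorm :: "ht mat \<Rightarrow> real" where
  "mnorm A = (\<Sum>i<dim_row A. \<Sum>j<dim_col A. norm (A $$ (i, j)))"

text \<open>Each of the four products of complex numbers in \<open>p q\<close> is at most \<open>|p| |q|\<close>, and one of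
  them carries the factor \<open>t\<close>.\<close>

lemma norm_hmul: "norm (hmul p q) \<le> (3 + \<bar>t\<bar>) * (norm p * norm q)"
proof -
  obtain a b where p: "p = (a, b)" by (cases p)
  obtain c d where q: "q = (c, d)" by (cases q)
  have n: "norm a \<le> norm p" "norm b \<le> norm p" "norm c \<le> norm q" "norm d \<le> norm q"
    by (auto simp: p q norm_fst_le norm_snd_le intro: order_trans[OF _ norm_fst_le] order_trans[OF _ norm_snd_le])
  have m: "norm (u * v) \<le> norm p * norm q" if "norm u \<le> norm p" "norm v \<le> norm q" for u v :: complex
    using that by (simp add: norm_mult mult_mono)
  have "norm (hmul p q) \<le> norm (a * c + of_real t * b * cnj d) + norm (a * d + b * cnj c)"
    by (simp add: ht_mult_def p q norm_Pair_le)
  also have "\<dots> \<le> (norm (a * c) + norm (of_real t * b * cnj d)) + (norm (a * d) + norm (b * cnj c))"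
    by (intro add_mono norm_triangle_ineq)
  also have "norm (of_real t * b * cnj d) = \<bar>t\<bar> * norm (b * cnj d)"
    by (simp add: norm_mult mult.assoc)
  also have "(norm (a * c) + \<bar>t\<bar> * norm (b * cnj d)) + (norm (a * d) + norm (b * cnj c))
      \<le> (norm p * norm q + \<bar>t\<bar> * (norm p * norm q)) + (norm p * norm q + norm p * norm q)"
    using n by (intro add_mono mult_left_mono m) auto
  also have "\<dots> = (3 + \<bar>t\<bar>) * (norm p * norm q)" by (simp add: algebra_simps)
  finally show ?thesis .
qed

lemma mnorm_nonneg [simp]: "0 \<le> mnorm A"
  by (simp add: mnorm_def sum_nonneg)

lemma mnorm_eq_0: "mnorm A = 0 \<Longrightarrow> A = 0\<^sub>m (dim_row A) (dim_col A)"
  by (rule eq_matI) (auto simp: mnorm_def sum_nonneg_eq_0_iff sum_nonneg)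

lemma mnorm_mul:
  assumes "dim_col A = dim_row B"
  shows "mnorm (A ** B) \<le> (3 + \<bar>t\<bar>) * (mnorm A * mnorm B)"
proof -
  let ?c = "3 + \<bar>t\<bar>"
  have "norm ((A ** B) $$ (i, j)) \<le>
      ?c * ((\<Sum>k<dim_col A. norm (A $$ (i, k))) * (\<Sum>l<dim_row B. norm (B $$ (l, j))))"
    if "i < dim_row A" "j < dim_col B" for i j
  proof -
    have "norm ((A ** B) $$ (i, j)) \<le> (\<Sum>k<dim_col A. norm (hmul (A $$ (i, k)) (B $$ (k, j))))"
      using that by (simp add: mul_index norm_sum)
    also have "\<dots> \<le> (\<Sum>k<dim_col A. ?c * (norm (A $$ (i, k)) * norm (B $$ (k, j))))"
      by (rule sum_mono) (rule norm_hmul)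
    also have "\<dots> \<le> (\<Sum>k<dim_col A. ?c * (norm (A $$ (i, k)) * (\<Sum>l<dim_row B. norm (B $$ (l, j)))))"
      using assms by (intro sum_mono mult_left_mono member_le_sum) auto
    also have "\<dots> = ?c * ((\<Sum>k<dim_col A. norm (A $$ (i, k))) * (\<Sum>l<dim_row B. norm (B $$ (l, j))))"
      by (simp only: sum_distrib_left[symmetric] sum_distrib_right[symmetric])
    finally show ?thesis .
  qed
  then have "mnorm (A ** B) \<le> (\<Sum>i<dim_row A. \<Sum>j<dim_col B.
      ?c * ((\<Sum>k<dim_col A. norm (A $$ (i, k))) * (\<Sum>l<dim_row B. norm (B $$ (l, j)))))"
    unfolding mnorm_def mul_dim by (intro sum_mono) auto
  also have "\<dots> = ?c * ((\<Sum>i<dim_row A. \<Sum>k<dim_col A. norm (A $$ (i, k))) *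
      (\<Sum>j<dim_col B. \<Sum>l<dim_row B. norm (B $$ (l, j))))"
    by (simp only: sum_distrib_left[symmetric] sum_distrib_right[symmetric])
  also have "(\<Sum>j<dim_col B. \<Sum>l<dim_row B. norm (B $$ (l, j))) = mnorm B"
    unfolding mnorm_def by (rule sum.swap)
  finally show ?thesis unfolding mnorm_def[of A] .
qed

lemma mnorm_add: "dim_row A = dim_row B \<Longrightarrow> dim_col A = dim_col B \<Longrightarrow> mnorm (A + B) \<le> mnorm A + mnorm B"
  by (simp add: mnorm_def sum.distrib[symmetric] sum_mono norm_triangle_ineq)

lemma mnorm_scl [simp]: "mnorm (x *s A) = \<bar>x\<bar> * mnorm A"
  by (simp add: mnorm_def sum_distrib_left)

abbreviation regular :: "ht mat \<Rightarrow> real \<Rightarrow> bool" where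
  "regular A x \<equiv> ht_invertible t (pencil A x)"

abbreviation res :: "ht mat \<Rightarrow> real \<Rightarrow> ht mat" where
  "res A x \<equiv> ht_inv t (pencil A x)"

lemma pencil_dim [simp]: "dim_row (pencil A x) = dim_row A" "dim_col (pencil A x) = dim_col A"
  by (simp_all add: pencil_def)

lemma pencil_carrier [simp]: "A \<in> mats N N \<Longrightarrow> pencil A x \<in> mats N N"
  by (auto simp: pencil_def)

lemma pencil_mul: "A \<in> mats N N \<Longrightarrow> dim_row X = N \<Longrightarrow> pencil A x ** X = X - x *s (A ** X)"
  by (auto simp: pencil_def mul_distribs)

lemma mul_pencil: "A \<in> mats N N \<Longrightarrow> dim_col X = N \<Longrightarrow> X ** pencil A x = X - x *s (X ** A)"
  by (auto simp: pencil_def mul_distribs)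

lemma pencil_zero [simp]: "A \<in> mats N N \<Longrightarrow> pencil A 0 = one N"
  by (rule eq_matI) (auto simp: pencil_def)

lemma invertible_one [simp]: "ht_invertible t (one N)"
  unfolding ht_invertible_def by (rule exI[of _ "one N"]) (auto simp: ht_inverse_of_def)

lemma res_carrier:
  assumes "regular A x" "A \<in> mats N N"
  shows "res A x \<in> mats N N" "dim_row (res A x) = N" "dim_col (res A x) = N"
  using ht_invD(1)[OF assms(1) pencil_carrier[OF assms(2)]] by auto

lemma res_eq:
  assumes "regular A x" "A \<in> mats N N"
  shows "res A x = one N + x *s (A ** res A x)" "res A x = one N + x *s (res A x ** A)"
proof -
  note i = ht_invD[OF assms(1) pencil_carrier[OF assms(2)]]
  note [simp] = dimD[OF i(1)] dimD[OF assms(2)]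
  have 1: "res A x - x *s (A ** res A x) = one N"
    using i(2) by (subst (asm) pencil_mul[OF assms(2)]) auto
  have 2: "res A x - x *s (res A x ** A) = one N"
    using i(3) by (subst (asm) mul_pencil[OF assms(2)]) auto
  show "res A x = one N + x *s (A ** res A x)"
    unfolding 1[symmetric] by (rule eq_matI) auto
  show "res A x = one N + x *s (res A x ** A)"
    unfolding 2[symmetric] by (rule eq_matI) auto
qed

lemma res_eqI:
  assumes "A \<in> mats N N" "Z \<in> mats N N" "Z - x *s (A ** Z) = one N"
  shows "regular A x" "res A x = Z"
proof -
  have 1: "pencil A x ** Z = one N" using assms by (subst pencil_mul[OF assms(1)]) auto
  then have "Z ** pencil A x = one N"
    using assms by (intro one_sided_inverse[OF _ _ 1]) auto
  then have "ht_inverse_of t (pencil A x) Z"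
    using assms 1 by (intro ht_inverse_ofI) auto
  then show "regular A x" "res A x = Z"
    using ht_inv_eq by (auto simp: ht_invertible_def)
qed

text \<open>Multiplication by \<open>x A\<close> at least halves the norm, so that \<open>1 - x A\<close> is injective.\<close>

lemma small_pencil:
  assumes A: "A \<in> mats N N" and x: "\<bar>x\<bar> * ((3 + \<bar>t\<bar>) * mnorm A) \<le> 1 / 2"
  shows "regular A x" "mnorm (res A x) \<le> 2 * mnorm (one N)"
proof -
  note [simp] = dimD[OF A]
  have b: "mnorm (x *s (A ** X)) \<le> 1 / 2 * mnorm X" if "dim_row X = N" for X
  proof -
    have "\<bar>x\<bar> * mnorm (A ** X) \<le> \<bar>x\<bar> * ((3 + \<bar>t\<bar>) * (mnorm A * mnorm X))"
      using that by (intro mult_left_mono mnorm_mul) auto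
    also have "\<dots> = \<bar>x\<bar> * ((3 + \<bar>t\<bar>) * mnorm A) * mnorm X" by simp
    also have "\<dots> \<le> 1 / 2 * mnorm X" by (intro mult_right_mono x) auto
    finally show ?thesis by simp
  qed
  show inv: "regular A x"
  proof (rule injective_imp_invertible[OF pencil_carrier[OF A]])
    fix X assume X: "X \<in> mats N N" "pencil A x ** X = 0\<^sub>m N N"
    then have e: "X - x *s (A ** X) = 0\<^sub>m N N" by (subst (asm) pencil_mul[OF A]) auto
    have "X = x *s (A ** X)"
    proof (rule eq_matI, goal_cases)
      case (1 i j)
      then show ?case using arg_cong[OF e, of "\<lambda>M. M $$ (i, j)"] X(1) by auto
    qed (use X in auto)
    then have "mnorm X \<le> 1 / 2 * mnorm X" using b[of X] X(1) by auto
    then have "mnorm X = 0" using mnorm_nonneg[of X] by linarith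
    then show "X = 0\<^sub>m N N" using mnorm_eq_0[of X] X(1) by auto
  qed
  note r = res_carrier[OF inv A]
  have "mnorm (res A x) = mnorm (one N + x *s (A ** res A x))"
    using res_eq(1)[OF inv A] by simp
  also have "\<dots> \<le> mnorm (one N) + 1 / 2 * mnorm (res A x)"
    using r by (intro order_trans[OF mnorm_add] add_mono b) auto
  finally show "mnorm (res A x) \<le> 2 * mnorm (one N)" by simp
qed

lemma eventually_small:
  assumes A: "A \<in> mats N N"
  shows "\<forall>\<^sub>F x in nhds 0. regular A x \<and> mnorm (res A x) \<le> 2 * mnorm (one N)"
proof -
  have "((\<lambda>x::real. \<bar>x\<bar> * ((3 + \<bar>t\<bar>) * mnorm A)) \<longlongrightarrow> \<bar>0\<bar> * ((3 + \<bar>t\<bar>) * mnorm A)) (nhds 0)"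
    by (intro tendsto_intros) (simp add: filterlim_def)
  then have "\<forall>\<^sub>F x in nhds 0. \<bar>x::real\<bar> * ((3 + \<bar>t\<bar>) * mnorm A) < 1 / 2"
    by (rule order_tendstoD) simp
  then show ?thesis
    by eventually_elim (use small_pencil[OF A] in auto)
qed

lemma eventually_pencil:
  "A \<in> mats N N \<Longrightarrow> \<forall>\<^sub>F x in nhds 0. regular A x"
  using eventually_small by (rule eventually_mono) auto

lemma eventually_at_of_nhds: "\<forall>\<^sub>F x in nhds a. P x \<Longrightarrow> \<forall>\<^sub>F x in at (a::real). P x"
  by (auto simp: eventually_at_filter elim: eventually_mono)

text \<open>The resolvent is bounded near \<open>0\<close>, so the last term of \<open>X r Y = X Y + x X A r Y\<close> tends to \<open>0\<close>.  The
  hypothesis leaves out the point \<open>0\<close>, which allows a division by \<open>x\<close> before the lemma is applied.\<close>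

lemma resolvent_value_at_0:
  assumes A: "A \<in> mats N N" and X: "X \<in> mats a N" and Y: "Y \<in> mats N b"
    and z: "\<forall>\<^sub>F x in at 0. X ** res A x ** Y = 0\<^sub>m a b"
  shows "X ** Y = 0\<^sub>m a b"
proof -
  note [simp] = dimD[OF A] dimD[OF X] dimD[OF Y]
  let ?c = "3 + \<bar>t\<bar>"
  define M where "M = ?c * (mnorm X * (?c * (mnorm A * (?c * (2 * mnorm (one N) * mnorm Y)))))"
  have "\<forall>\<^sub>F x in at 0. mnorm (X ** Y) \<le> \<bar>x\<bar> * M"
    using z eventually_at_of_nhds[OF eventually_small[OF A]]
  proof eventually_elim
    case (elim x)
    then have inv: "regular A x" and sm: "mnorm (res A x) \<le> 2 * mnorm (one N)" by auto
    note [simp] = res_carrier[OF inv A]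
    have "0\<^sub>m a b = X ** (one N + x *s (A ** res A x)) ** Y"
      using elim res_eq(1)[OF inv A] by simp
    also have "\<dots> = X ** Y + x *s (X ** (A ** (res A x ** Y)))"
      by (simp add: mul_distribs mul_assoc)
    finally have e: "0\<^sub>m a b = X ** Y + x *s (X ** (A ** (res A x ** Y)))" .
    have "X ** Y = (- x) *s (X ** (A ** (res A x ** Y)))"
    proof (rule eq_matI, goal_cases)
      case (1 i j)
      then show ?case
        using arg_cong[OF e, of "\<lambda>M. M $$ (i, j)"] by (simp add: eq_neg_iff_add_eq_0)
    qed auto
    then have "mnorm (X ** Y) = \<bar>x\<bar> * mnorm (X ** (A ** (res A x ** Y)))" by simp
    also have "\<dots> \<le> \<bar>x\<bar> * M"
      unfolding M_def using sm
      by (intro mult_left_mono order_trans[OF mnorm_mul] mult_right_mono) auto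
    finally show ?case .
  qed
  moreover have "((\<lambda>x::real. \<bar>x\<bar> * M) \<longlongrightarrow> \<bar>0\<bar> * M) (at 0)"
    by (intro tendsto_intros)
  ultimately have "mnorm (X ** Y) \<le> \<bar>0\<bar> * M"
    by (intro tendsto_lowerbound) auto
  then have "mnorm (X ** Y) = 0" using mnorm_nonneg[of "X ** Y"] by linarith
  from mnorm_eq_0[OF this] show ?thesis by simp
qed

text \<open>With \<open>X Y = 0\<close>, division by \<open>x\<close> replaces \<open>X\<close> by \<open>X A\<close>; this is repeated.\<close>

lemma markov_zero_of_resolvent_zero:
  assumes A: "A \<in> mats N N" and X: "X \<in> mats a N" and Y: "Y \<in> mats N b"
    and z: "\<forall>\<^sub>F x in at 0. X ** res A x ** Y = 0\<^sub>m a b"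
  shows "X ** mpow A k ** Y = 0\<^sub>m a b"
proof -
  note [simp] = dimD[OF A] dimD[OF X] dimD[OF Y] mpow_dim[OF A]
  have "\<forall>\<^sub>F x in at 0. X ** mpow A k ** res A x ** Y = 0\<^sub>m a b"
  proof (induction k)
    case (Suc k)
    have z: "X ** mpow A k ** Y = 0\<^sub>m a b"
      by (rule resolvent_value_at_0[OF A _ Y Suc]) (rule carrier_matI; simp)
    have "\<forall>\<^sub>F x in at (0::real). x \<noteq> 0" by (simp add: eventually_at_filter)
    with Suc eventually_at_of_nhds[OF eventually_pencil[OF A]] show ?case
    proof eventually_elim
      case (elim x)
      note [simp] = res_carrier[OF elim(2) A]
      have "0\<^sub>m a b = X ** mpow A k ** (one N + x *s (A ** res A x)) ** Y"
        using elim(1) res_eq(1)[OF elim(2) A] by simp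
      also have "\<dots> = X ** mpow A k ** Y + x *s (X ** mpow A (Suc k) ** res A x ** Y)"
        by (simp add: mul_distribs mul_assoc)
      finally have e: "0\<^sub>m a b = 0\<^sub>m a b + x *s (X ** mpow A (Suc k) ** res A x ** Y)"
        unfolding z .
      show ?case
      proof (rule eq_matI, goal_cases)
        case (1 i j)
        then show ?case
          using arg_cong[OF e, of "\<lambda>M. M $$ (i, j)"] elim(3) by simp
      qed auto
    qed
  qed (use z in simp)
  then show ?thesis by (rule resolvent_value_at_0[OF A _ Y, rotated]) (rule carrier_matI; simp)
qed

text \<open>The resolvent is a polynomial in \<open>1 - x A\<close>, hence in \<open>A\<close>.  So the conclusion reaches all points where
  the resolvent exists, also those beyond a pole.\<close>

lemma resolvent_zero_of_markov_zero:
  assumes A: "A \<in> mats N N" and X: "X \<in> mats a N" and Y: "Y \<in> mats N b"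
    and z: "\<And>k. X ** mpow A k ** Y = 0\<^sub>m a b" and inv: "regular A x"
  shows "X ** res A x ** Y = 0\<^sub>m a b"
proof -
  let ?T = "pencil A x"
  note T = pencil_carrier[OF A, of x]
  note [simp] = dimD[OF A] dimD[OF X] dimD[OF Y] mpow_dim[OF A] mpow_dim[OF T]
  have p: "X ** mpow A j ** mpow ?T i ** Y = 0\<^sub>m a b" for i j
  proof (induction i arbitrary: j)
    case (Suc i)
    have "X ** mpow A j ** mpow ?T (Suc i) ** Y = X ** mpow A j ** (?T ** mpow ?T i) ** Y"
      using mpow_Suc_left[OF T, of i] by simp
    also have "\<dots> = X ** mpow A j ** mpow ?T i ** Y - x *s (X ** mpow A (Suc j) ** mpow ?T i ** Y)"
      by (simp add: pencil_mul[OF A] mul_distribs mul_assoc)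
    also have "\<dots> = 0\<^sub>m a b" unfolding Suc by (rule eq_matI) auto
    finally show ?case .
  qed (use z in simp)
  obtain m c where r: "res A x = msum N N (\<lambda>i. c i *s mpow ?T i) m"
    using ht_inv_polynomial[OF T inv] by blast
  have c1: "c i *s mpow ?T i \<in> mats N N" for i by (intro scl_carrier mpow_carrier T)
  have "X ** res A x ** Y = msum a b (\<lambda>i. X ** (c i *s mpow ?T i) ** Y) m"
    unfolding r using c1 by (subst mul_msum, simp, simp, subst msum_mul) auto
  also have "\<dots> = msum a b (\<lambda>i. 0\<^sub>m a b) m"
  proof (rule msum_cong)
    fix i
    have "X ** (c i *s mpow ?T i) ** Y = c i *s (X ** mpow A 0 ** mpow ?T i ** Y)"
      by (simp add: mul_distribs mul_assoc)
    then show "X ** (c i *s mpow ?T i) ** Y = 0\<^sub>m a b" unfolding p by simp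
  qed
  finally show ?thesis by simp
qed

lemma eventually_nhds_0_iff: "(\<forall>\<^sub>F x in nhds (0::real). P x) \<longleftrightarrow> (\<exists>e>0. \<forall>x\<in>{-e<..<e}. P x)"
  unfolding eventually_nhds_metric dist_real_def by (auto simp: abs_less_iff)

lemma observable_iff:
  assumes C: "C \<in> mats n N" and A: "A \<in> mats N N"
  shows "observable t n N C A \<longleftrightarrow>
    (\<forall>h\<in>mats N 1. (\<forall>k. C ** mpow A k ** h = 0\<^sub>m n 1) \<longrightarrow> h = 0\<^sub>m N 1)"
proof -
  have "(\<exists>e>0. \<forall>x\<in>{-e<..<e}. regular A x \<and> C ** res A x ** h = 0\<^sub>m n 1)
      \<longleftrightarrow> (\<forall>k. C ** mpow A k ** h = 0\<^sub>m n 1)" if h: "h \<in> mats N 1" for h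
    unfolding eventually_nhds_0_iff[symmetric]
  proof
    assume "\<forall>\<^sub>F x in nhds 0. regular A x \<and> C ** res A x ** h = 0\<^sub>m n 1"
    then have "\<forall>\<^sub>F x in at 0. C ** res A x ** h = 0\<^sub>m n 1"
      by (intro eventually_at_of_nhds) (auto elim: eventually_mono)
    then show "\<forall>k. C ** mpow A k ** h = 0\<^sub>m n 1"
      using markov_zero_of_resolvent_zero[OF A C h] by blast
  next
    assume "\<forall>k. C ** mpow A k ** h = 0\<^sub>m n 1"
    then have "C ** res A x ** h = 0\<^sub>m n 1" if "regular A x" for x
      using resolvent_zero_of_markov_zero[OF A C h _ that] by blast
    then show "\<forall>\<^sub>F x in nhds 0. regular A x \<and> C ** res A x ** h = 0\<^sub>m n 1"
      using eventually_pencil[OF A] by (auto elim: eventually_mono)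
  qed
  moreover have "\<forall>k. C ** mpow A k ** 0\<^sub>m N 1 = 0\<^sub>m n 1"
    using C mpow_dim[OF A] by auto
  ultimately show ?thesis unfolding observable_def by auto
qed

subsection \<open>Transfer functions\<close>

definition is_sys :: "nat \<Rightarrow> nat \<Rightarrow> ht mat \<Rightarrow> ht mat \<Rightarrow> ht mat \<Rightarrow> ht mat \<Rightarrow> bool" where
  "is_sys n N D C A B \<longleftrightarrow> D \<in> mats n n \<and> C \<in> mats n N \<and> A \<in> mats N N
     \<and> B \<in> mats N n"

lemma is_sysD:
  assumes "is_sys n N D C A B"
  shows "D \<in> mats n n" "C \<in> mats n N" "A \<in> mats N N" "B \<in> mats N n"
    "dim_row D = n" "dim_col D = n" "dim_row C = n" "dim_col C = N"
    "dim_row A = N" "dim_col A = N" "dim_row B = N" "dim_col B = n"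
  using assms by (auto simp: is_sys_def)

abbreviation tf :: "ht mat \<Rightarrow> ht mat \<Rightarrow> ht mat \<Rightarrow> ht mat \<Rightarrow> real \<Rightarrow> ht mat" where
  "tf \<equiv> transfer_fun t"

lemma tf_eq: "tf D C A B x = D + x *s (C ** res A x ** B)"
  by (simp add: transfer_fun_def)

lemma tf_carrier: "is_sys n N D C A B \<Longrightarrow> regular A x \<Longrightarrow> tf D C A B x \<in> mats n n"
  by (auto simp: is_sys_def tf_eq)

lemma tf_0: "is_sys n N D C A B \<Longrightarrow> tf D C A B 0 = D"
  by (auto simp: is_sys_def tf_eq)

text \<open>Two systems are compared through their difference, which is again a system.\<close>

definition diffC :: "nat \<Rightarrow> nat \<Rightarrow> ht mat \<Rightarrow> ht mat \<Rightarrow> ht mat" where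
  "diffC N N' C C' = C ** (inl N N')\<star> - C' ** (inr N N')\<star>"

definition diffA :: "nat \<Rightarrow> nat \<Rightarrow> ht mat \<Rightarrow> ht mat \<Rightarrow> ht mat" where
  "diffA N N' A A' = inl N N' ** A ** (inl N N')\<star> + inr N N' ** A' ** (inr N N')\<star>"

definition diffB :: "nat \<Rightarrow> nat \<Rightarrow> ht mat \<Rightarrow> ht mat \<Rightarrow> ht mat" where
  "diffB N N' B B' = inl N N' ** B + inr N N' ** B'"

lemma difference_system:
  assumes s: "is_sys n N D C A B" and s': "is_sys n N' D' C' A' B'"
  defines "Cd \<equiv> diffC N N' C C'" and "Ad \<equiv> diffA N N' A A'" and "Bd \<equiv> diffB N N' B B'"
  shows "Cd \<in> mats n (N + N')" "Ad \<in> mats (N + N') (N + N')"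
    "Bd \<in> mats (N + N') n"
    "Cd ** mpow Ad k ** Bd = C ** mpow A k ** B - C' ** mpow A' k ** B'"
    "regular A x \<Longrightarrow> regular A' x \<Longrightarrow> regular Ad x"
    "regular A x \<Longrightarrow> regular A' x \<Longrightarrow>
       Cd ** res Ad x ** Bd = C ** res A x ** B - C' ** res A' x ** B'"
proof -
  let ?E = "inl N N'" let ?F = "inr N N'"
  note c = is_sysD[OF s] and c' = is_sysD[OF s']
  note [simp] = c(5-) c'(5-) mpow_dim[OF c(3)] mpow_dim[OF c'(3)]
  show cC: "Cd \<in> mats n (N + N')" and cA: "Ad \<in> mats (N + N') (N + N')"
    and "Bd \<in> mats (N + N') n"
    by (auto simp: Cd_def diffC_def Ad_def diffA_def Bd_def diffB_def)
  have sandwich: "Cd ** (?E ** P ** ?E\<star> + ?F ** Q ** ?F\<star>) ** Bd = C ** P ** B - C' ** Q ** B'"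
    if "P \<in> mats N N" "Q \<in> mats N' N'" for P Q
    using that dimD[OF that(1)] dimD[OF that(2)]
    unfolding Cd_def diffC_def Bd_def diffB_def
    by (simp add: mul_distribs mul_assoc) (rule eq_matI; simp)
  have "mpow Ad k = ?E ** mpow A k ** ?E\<star> + ?F ** mpow A' k ** ?F\<star>"
  proof (induction k)
    case 0
    then show ?case using direct_sum_total[of N N'] cA by simp
  next
    case (Suc k)
    then show ?case by (simp add: Ad_def diffA_def mul_distribs mul_assoc) (rule eq_matI; simp)
  qed
  then show "Cd ** mpow Ad k ** Bd = C ** mpow A k ** B - C' ** mpow A' k ** B'"
    using c(3) c'(3) by (simp add: sandwich mpow_carrier)
  assume inv: "regular A x" "regular A' x"
  note r = res_carrier[OF inv(1) c(3)] and r' = res_carrier[OF inv(2) c'(3)]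
  note [simp] = r r'
  let ?Z = "?E ** res A x ** ?E\<star> + ?F ** res A' x ** ?F\<star>"
  have "?Z - x *s (Ad ** ?Z) =
      ?E ** (res A x - x *s (A ** res A x)) ** ?E\<star> + ?F ** (res A' x - x *s (A' ** res A' x)) ** ?F\<star>"
    by (simp add: Ad_def diffA_def mul_distribs mul_assoc) (rule eq_matI; simp add: algebra_simps)
  also have "res A x - x *s (A ** res A x) = one N"
    by (subst res_eq(1)[OF inv(1) c(3)]) (rule eq_matI; simp)
  also have "res A' x - x *s (A' ** res A' x) = one N'"
    by (subst res_eq(1)[OF inv(2) c'(3)]) (rule eq_matI; simp)
  finally have "?Z - x *s (Ad ** ?Z) = one (N + N')"
    using direct_sum_total[of N N'] by simp
  moreover have "?Z \<in> mats (N + N') (N + N')" by auto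
  ultimately have "regular Ad x" "res Ad x = ?Z"
    using res_eqI[OF cA] by blast+
  then show "regular Ad x"
    "Cd ** res Ad x ** Bd = C ** res A x ** B - C' ** res A' x ** B'"
    by (auto simp: sandwich r r')
qed

lemma mat_diff_eq_0: "A - B = 0\<^sub>m a b \<Longrightarrow> A \<in> mats a b \<Longrightarrow> B \<in> mats a b \<Longrightarrow> A = (B :: ht mat)"
proof (rule eq_matI, goal_cases)
  case (1 i j)
  then have "A $$ (i, j) - B $$ (i, j) = (A - B) $$ (i, j)" by (subst index_minus_mat) auto
  also have "\<dots> = 0" unfolding 1(1) using 1 by auto
  finally show ?case by simp
qed auto

lemma markov_eq_of_tf_eq:
  assumes s: "is_sys n N D C A B" and s': "is_sys n N' D' C' A' B'"
    and eq: "\<forall>\<^sub>F x in nhds 0. tf D C A B x = tf D' C' A' B' x"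
  shows "D = D'" "C ** mpow A k ** B = C' ** mpow A' k ** B'"
proof -
  note c = is_sysD[OF s] and c' = is_sysD[OF s']
  note [simp] = c(5-) c'(5-) mpow_dim[OF c(3)] mpow_dim[OF c'(3)]
  show D: "D = D'" using eventually_nhds_x_imp_x[OF eq] tf_0[OF s] tf_0[OF s'] by simp
  note d = difference_system[OF s s']
  have "\<forall>\<^sub>F x in at (0::real). x \<noteq> 0" by (simp add: eventually_at_filter)
  with eventually_at_of_nhds[OF eq] eventually_at_of_nhds[OF eventually_pencil[OF c(3)]]
    eventually_at_of_nhds[OF eventually_pencil[OF c'(3)]]
  have "\<forall>\<^sub>F x in at 0. diffC N N' C C' ** res (diffA N N' A A') x ** diffB N N' B B' = 0\<^sub>m n n"
  proof eventually_elim
    case (elim x)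
    have e: "D + x *s (C ** res A x ** B) = D + x *s (C' ** res A' x ** B')"
      using elim(1) by (simp add: tf_eq D)
    show ?case
      unfolding d(6)[OF elim(2,3)]
    proof (rule eq_matI, goal_cases)
      case (1 i j)
      then show ?case using arg_cong[OF e, of "\<lambda>M. M $$ (i, j)"] elim(4) by simp
    qed auto
  qed
  from markov_zero_of_resolvent_zero[OF d(2,1,3) this, of k, unfolded d(4)]
  have 1: "C ** mpow A k ** B - C' ** mpow A' k ** B' = 0\<^sub>m n n" .
  have 2: "C ** mpow A k ** B \<in> mats n n"
    by (rule carrier_matI) simp_all
  have 3: "C' ** mpow A' k ** B' \<in> mats n n"
    by (rule carrier_matI) simp_all
  show "C ** mpow A k ** B = C' ** mpow A' k ** B'"
    by (rule mat_diff_eq_0[OF 1 2 3])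
qed

lemma tf_eq_of_markov_eq:
  assumes s: "is_sys n N D C A B" and s': "is_sys n N' D' C' A' B'"
    and "D = D'" and m: "\<And>k. C ** mpow A k ** B = C' ** mpow A' k ** B'"
    and inv: "regular A x" "regular A' x"
  shows "tf D C A B x = tf D' C' A' B' x"
proof -
  note c = is_sysD[OF s] and c' = is_sysD[OF s']
  note [simp] = c(5-) c'(5-) mpow_dim[OF c(3)] mpow_dim[OF c'(3)]
  note d = difference_system[OF s s']
  have "C ** res A x ** B - C' ** res A' x ** B' = 0\<^sub>m n n"
    unfolding d(6)[OF inv, symmetric]
  proof (rule resolvent_zero_of_markov_zero[OF d(2,1,3) _ d(5)[OF inv]])
    fix k
    show "diffC N N' C C' ** mpow (diffA N N' A A') k ** diffB N N' B B' = 0\<^sub>m n n"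
      unfolding d(4) m by (rule eq_matI) simp_all
  qed
  then have "C ** res A x ** B = C' ** res A' x ** B'"
    by (rule mat_diff_eq_0) (rule carrier_matI; simp add: res_carrier[OF inv(1) c(3)] res_carrier[OF inv(2) c'(3)])+
  then show ?thesis using \<open>D = D'\<close> by (simp add: tf_eq)
qed

section \<open>Minimal realizations\<close>


definition sharp_mat :: "ht mat \<Rightarrow> ht mat" where
  "sharp_mat M = mat (dim_col M) (dim_row M) (\<lambda>(i, j). ht_sharp t (M $$ (j, i)))"

lemma sharp_dim [simp]: "dim_row (sharp_mat A) = dim_col A" "dim_col (sharp_mat A) = dim_row A"
  by (simp_all add: sharp_mat_def)

lemma sharp_index [simp]:
  "i < dim_col A \<Longrightarrow> j < dim_row A \<Longrightarrow> sharp_mat A $$ (i, j) = ht_sharp t (A $$ (j, i))"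
  by (simp add: sharp_mat_def)

lemma ht_sharp_mult: "ht_sharp t (hmul p q) = hmul (ht_sharp t q) (ht_sharp t p)"
proof -
  have "sgn t * sgn t = 1" using t0 by (simp add: sgn_real_def)
  then have s1: "complex_of_real (sgn t) * of_real (sgn t) = 1" by (metis of_real_1 of_real_mult)
  then have s: "complex_of_real (sgn t) * (of_real (sgn t) * z) = z" for z
    by (simp flip: mult.assoc)
  show ?thesis
    by (simp add: ht_sharp_def ht_mult_def algebra_simps s s1)
qed

lemma ht_sharp_sum: "ht_sharp t (sum f S) = (\<Sum>i\<in>S. ht_sharp t (f i))"
  by (simp add: ht_sharp_def fst_sum snd_sum sum_distrib_left prod_eq_iff)

lemma sharp_mul: "dim_col A = dim_row B \<Longrightarrow> sharp_mat (A ** B) = sharp_mat B ** sharp_mat A"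
  by (rule eq_matI) (auto simp: mul_index ht_sharp_sum ht_sharp_mult)

lemma sharp_positive: "Re (fst (hmul (ht_sharp t q) q)) = (norm (fst q))\<^sup>2 + \<bar>t\<bar> * (norm (snd q))\<^sup>2"
proof -
  have "fst (hmul (ht_sharp t q) q) =
      cnj (fst q) * fst q + of_real (t * sgn t) * (snd q * cnj (snd q))"
    by (simp add: ht_mult_def ht_sharp_def)
  also have "t * sgn t = \<bar>t\<bar>" by (simp add: abs_sgn)
  also have "cnj (fst q) * fst q = of_real ((norm (fst q))\<^sup>2)"
    by (metis complex_norm_square mult.commute)
  also have "snd q * cnj (snd q) = of_real ((norm (snd q))\<^sup>2)"
    by (metis complex_norm_square)
  finally show ?thesis by simp
qed

text \<open>The diagonal entries of the sum have weighted sums of squares as real parts, with weights \<open>1\<close> and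
  \<open>|t|\<close>.\<close>

lemma sharp_gram_zero:
  assumes z: "msum b b (\<lambda>j. sharp_mat (Y j) ** Y j) K = 0\<^sub>m b b"
    and Y: "\<And>j. j < K \<Longrightarrow> Y j \<in> mats a b" and j: "j < K"
  shows "Y j = 0\<^sub>m a b"
proof (rule eq_matI, goal_cases)
  case (1 i p)
  let ?w = "\<lambda>q. (norm (fst q))\<^sup>2 + \<bar>t\<bar> * (norm (snd q :: complex))\<^sup>2"
  have e: "Re (fst ((sharp_mat (Y k) ** Y k) $$ (p, p))) = (\<Sum>l<a. ?w (Y k $$ (l, p)))" if "k < K" for k
    using dimD[OF Y[OF that]] 1 by (simp add: mul_index fst_sum sharp_positive)
  have "0 = Re (fst (\<Sum>k<K. (sharp_mat (Y k) ** Y k) $$ (p, p)))"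
    using arg_cong[OF z, of "\<lambda>M. M $$ (p, p)"] 1 by simp
  also have "\<dots> = (\<Sum>k<K. \<Sum>l<a. ?w (Y k $$ (l, p)))"
    using e by (simp add: fst_sum)
  finally have "(\<Sum>k<K. \<Sum>l<a. ?w (Y k $$ (l, p))) = 0" by simp
  then have "(\<Sum>l<a. ?w (Y j $$ (l, p))) = 0"
    using j by (subst (asm) sum_nonneg_eq_0_iff) (auto intro!: sum_nonneg)
  then have "?w (Y j $$ (i, p)) = 0"
    using 1 by (subst (asm) sum_nonneg_eq_0_iff) auto
  then have "(norm (fst (Y j $$ (i, p))))\<^sup>2 = 0 \<and> \<bar>t\<bar> * (norm (snd (Y j $$ (i, p))))\<^sup>2 = 0"
    by (subst (asm) add_nonneg_eq_0_iff) auto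
  then have "Y j $$ (i, p) = 0" using t0 by (simp add: prod_eq_iff)
  then show ?case using 1 by simp
qed (use Y[OF j] in auto)

definition unit_col :: "nat \<Rightarrow> nat \<Rightarrow> ht mat" where
  "unit_col N p = mat N 1 (\<lambda>(i, _). if i = p then (1, 0) else 0)"

lemma unit_col_carrier [simp]: "unit_col N p \<in> mats N 1"
  by (simp add: unit_col_def)

lemma unit_col_dim [simp]: "dim_row (unit_col N p) = N" "dim_col (unit_col N p) = 1"
  by (simp_all add: unit_col_def)

lemma mul_unit_col: "dim_col X = N \<Longrightarrow> i < dim_row X \<Longrightarrow> p < N \<Longrightarrow> (X ** unit_col N p) $$ (i, 0) = X $$ (i, p)"
  by (simp add: mul_index unit_col_def if_distrib[of "\<lambda>q. hmul _ q"] cong: if_cong)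

lemma mat_eq_by_columns:
  assumes "X \<in> mats a b" "Y \<in> mats a b"
    and "\<And>h. h \<in> mats b 1 \<Longrightarrow> X ** h = Y ** h"
  shows "X = Y"
proof (rule eq_matI, goal_cases)
  case (1 i j)
  then show ?case
    using assms(1,2) arg_cong[OF assms(3)[OF unit_col_carrier[of b j]], of "\<lambda>M. M $$ (i, 0)"]
    by (simp add: mul_unit_col)
qed (use assms in auto)

text \<open>The Gram matrix \<open>G\<close> of the maps \<open>C A\<^sup>j\<close>, \<open>j < K\<close>, is injective when \<open>A\<^sup>K\<close> is a combination of lower
  powers: the kernel of \<open>G\<close> is killed by these maps, then by all \<open>C A\<^sup>j\<close>, so it is trivial by
  observability.\<close>

lemma observable_left_inverse:
  assumes C: "C \<in> mats n N" and A: "A \<in> mats N N"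
    and obs: "\<And>h. h \<in> mats N 1 \<Longrightarrow> (\<And>k. C ** mpow A k ** h = 0\<^sub>m n 1) \<Longrightarrow> h = 0\<^sub>m N 1"
  shows "\<exists>K L. (\<forall>j. L j \<in> mats N n) \<and> msum N N (\<lambda>j. L j ** (C ** mpow A j)) K = one N"
proof -
  note [simp] = dimD[OF C] dimD[OF A] mpow_dim[OF A]
  obtain K c where K: "mpow A K = msum N N (\<lambda>i. c i *s mpow A i) K"
    using power_eq_lower_powers[OF A] by blast
  define Obs where "Obs j = C ** mpow A j" for j
  have Obs: "Obs j \<in> mats n N" for j by (auto simp: Obs_def)
  note [simp] = Obs[THEN dimD(1)] Obs[THEN dimD(2)]
  define G where "G = msum N N (\<lambda>j. sharp_mat (Obs j) ** Obs j) K"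
  have G: "G \<in> mats N N" by (simp add: G_def)
  have OO: "sharp_mat (Obs j) ** Obs j \<in> mats N N" for j by auto
  have "ht_invertible t G"
  proof (rule injective_imp_invertible[OF G])
    fix X assume X: "X \<in> mats N N" and GX: "G ** X = 0\<^sub>m N N"
    note [simp] = dimD[OF X]
    have OX: "Obs j ** X \<in> mats n N" for j by (rule carrier_matI; simp)
    have "msum N N (\<lambda>j. sharp_mat (Obs j ** X) ** (Obs j ** X)) K =
        msum N N (\<lambda>j. sharp_mat X ** (sharp_mat (Obs j) ** Obs j ** X)) K"
      by (intro msum_cong) (simp add: sharp_mul mul_assoc)
    also have "\<dots> = sharp_mat X ** (G ** X)"
      unfolding G_def using OO by (subst msum_mul, simp, simp, subst mul_msum) auto
    also have "\<dots> = 0\<^sub>m N N" by (simp add: GX)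
    finally have low: "Obs j ** X = 0\<^sub>m n N" if "j < K" for j
      using sharp_gram_zero[of N "\<lambda>j. Obs j ** X" K n j] OX that by auto
    have all: "Obs j ** X = 0\<^sub>m n N" for j
    proof (induction j rule: less_induct)
      case (less j)
      show ?case
      proof (cases "j < K")
        case False
        then obtain m where m: "j = K + m" by (metis le_add_diff_inverse not_le)
        have c1: "c i *s mpow A i \<in> mats N N" for i by (intro scl_carrier mpow_carrier A)
        have c2: "c i *s mpow A i ** (mpow A m ** X) \<in> mats N N" for i
          by (rule carrier_matI; simp)
        have "Obs j ** X = C ** (mpow A K ** (mpow A m ** X))"
          by (simp add: Obs_def m mpow_add[OF A] mul_assoc)
        also have "\<dots> = msum n N (\<lambda>i. C ** (c i *s mpow A i ** (mpow A m ** X))) K"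
          unfolding K using c1 c2 by (subst msum_mul, simp, simp, subst mul_msum) simp_all
        also have "\<dots> = msum n N (\<lambda>i. 0\<^sub>m n N) K"
        proof (rule msum_cong)
          fix i assume "i < K"
          have "C ** (c i *s mpow A i ** (mpow A m ** X)) = c i *s (Obs (i + m) ** X)"
            by (simp add: Obs_def mpow_add[OF A] mul_assoc mul_scl_left mul_scl_right)
          also have "Obs (i + m) ** X = 0\<^sub>m n N" using \<open>i < K\<close> m by (intro less) simp
          finally show "C ** (c i *s mpow A i ** (mpow A m ** X)) = 0\<^sub>m n N" by simp
        qed
        finally show ?thesis by simp
      qed (rule low)
    qed
    show "X = 0\<^sub>m N N"
    proof (rule mat_eq_by_columns[OF X])
      fix h :: "ht mat" assume h: "h \<in> mats N 1"
      note [simp] = dimD[OF h]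
      have "C ** mpow A k ** (X ** h) = 0\<^sub>m n 1" for k
      proof -
        have "C ** mpow A k ** (X ** h) = Obs k ** X ** h"
          by (simp add: Obs_def mul_assoc)
        also have "\<dots> = 0\<^sub>m n 1" unfolding all by simp
        finally show ?thesis .
      qed
      then have "X ** h = 0\<^sub>m N 1" by (intro obs carrier_matI) simp_all
      then show "X ** h = 0\<^sub>m N N ** h" by simp
    qed simp
  qed
  note i = ht_invD[OF this G]
  note [simp] = dimD[OF i(1)]
  have "msum N N (\<lambda>j. (ht_inv t G ** sharp_mat (Obs j)) ** (C ** mpow A j)) K = ht_inv t G ** G"
    unfolding G_def using OO
    by (subst mul_msum) (auto simp: mul_assoc simp flip: Obs_def G_def intro!: msum_cong)
  also have "\<dots> = one N" by (rule i)
  finally show ?thesis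
    by (intro exI[of _ K] exI[of _ "\<lambda>j. ht_inv t G ** sharp_mat (Obs j)"]) (auto simp: i)
qed

lemma controllable_right_inverse:
  assumes A: "A \<in> mats N N" and B: "B \<in> mats N n"
    and con: "controllable t n N A B"
  shows "\<exists>K L. (\<forall>k. L k \<in> mats n N) \<and> msum N N (\<lambda>k. mpow A k ** B ** L k) K = one N"
proof -
  note [simp] = dimD[OF A] dimD[OF B] mpow_dim[OF A]
  have "\<exists>K L. (\<forall>j. L j \<in> mats N n) \<and> msum N N (\<lambda>j. L j ** (B\<star> ** mpow (A\<star>) j)) K = one N"
  proof (rule observable_left_inverse[of "B\<star>" n N "A\<star>"])
    fix h :: "ht mat" assume h: "h \<in> mats N 1" and z: "\<And>k. B\<star> ** mpow (A\<star>) k ** h = 0\<^sub>m n 1"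
    note [simp] = dimD[OF h]
    have "h\<star> ** mpow A k ** B = 0\<^sub>m 1 n" for k
    proof -
      have "(B\<star> ** mpow (A\<star>) k ** h)\<star> = h\<star> ** mpow A k ** B"
        by (simp add: star_mul mul_assoc flip: star_mpow[OF A])
      then show ?thesis unfolding z by simp
    qed
    moreover have "h\<star> \<in> mats 1 N" by (rule carrier_matI) simp_all
    ultimately have "h\<star> = 0\<^sub>m 1 N"
      using con[unfolded controllable_def, THEN bspec, THEN iffD1, rule_format] by blast
    then have "h\<star>\<star> = 0\<^sub>m N 1" by simp
    then show "h = 0\<^sub>m N 1" by simp
  qed (rule carrier_matI; simp)+
  then obtain K L where L: "\<And>j. L j \<in> mats N n"
    and e: "msum N N (\<lambda>j. L j ** (B\<star> ** mpow (A\<star>) j)) K = one N" by blast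
  note [simp] = L[THEN dimD(1)] L[THEN dimD(2)]
  have c: "L j ** (B\<star> ** mpow (A\<star>) j) \<in> mats N N" for j
    by (auto simp flip: star_mpow[OF A])
  have "one N = (msum N N (\<lambda>j. L j ** (B\<star> ** mpow (A\<star>) j)) K)\<star>" unfolding e by simp
  also have "\<dots> = msum N N (\<lambda>k. mpow A k ** B ** (L k)\<star>) K"
    using c by (subst star_msum) (auto intro!: msum_cong simp: star_mul mul_assoc simp flip: star_mpow[OF A])
  finally show ?thesis using L by (intro exI[of _ K] exI[of _ "\<lambda>k. (L k)\<star>"]) auto
qed

lemma observable_cancel:
  assumes C: "C \<in> mats n N" and A: "A \<in> mats N N" and obs: "observable t n N C A"
    and X: "X \<in> mats N b" and Y: "Y \<in> mats N b"
    and eq: "\<And>k. C ** mpow A k ** X = C ** mpow A k ** Y"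
  shows "X = Y"
proof -
  note [simp] = dimD[OF C] dimD[OF A] mpow_dim[OF A]
  have "h = 0\<^sub>m N 1" if "h \<in> mats N 1" "\<And>k. C ** mpow A k ** h = 0\<^sub>m n 1" for h
    using obs that unfolding observable_iff[OF C A] by blast
  then obtain K L where L: "\<And>j. L j \<in> mats N n"
    and e: "msum N N (\<lambda>j. L j ** (C ** mpow A j)) K = one N"
    using observable_left_inverse[OF C A] by blast
  note [simp] = L[THEN dimD(1)] L[THEN dimD(2)]
  have c: "L j ** (C ** mpow A j) \<in> mats N N" for j by auto
  have "Z = msum N b (\<lambda>j. L j ** (C ** mpow A j ** Z)) K" if Z: "Z \<in> mats N b" for Z
  proof -
    have "Z = msum N N (\<lambda>j. L j ** (C ** mpow A j)) K ** Z" unfolding e using Z by simp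
    also have "\<dots> = msum N b (\<lambda>j. L j ** (C ** mpow A j ** Z)) K"
      using c dimD[OF Z] by (subst msum_mul) (simp_all add: mul_assoc)
    finally show ?thesis .
  qed
  from this[OF X] this[OF Y] show ?thesis by (simp add: eq)
qed

lemma controllable_cancel:
  assumes A: "A \<in> mats N N" and B: "B \<in> mats N n" and con: "controllable t n N A B"
    and X: "X \<in> mats b N" and Y: "Y \<in> mats b N"
    and eq: "\<And>k. X ** mpow A k ** B = Y ** mpow A k ** B"
  shows "X = Y"
proof -
  note [simp] = dimD[OF B] dimD[OF A] mpow_dim[OF A]
  obtain K L where L: "\<And>j. L j \<in> mats n N"
    and e: "msum N N (\<lambda>k. mpow A k ** B ** L k) K = one N"
    using controllable_right_inverse[OF A B con] by blast
  note [simp] = L[THEN dimD(1)] L[THEN dimD(2)]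
  have c: "mpow A j ** B ** L j \<in> mats N N" for j by auto
  have "Z = msum b N (\<lambda>j. (Z ** mpow A j ** B) ** L j) K" if Z: "Z \<in> mats b N" for Z
  proof -
    have "Z = Z ** msum N N (\<lambda>k. mpow A k ** B ** L k) K" unfolding e using Z by simp
    also have "\<dots> = msum b N (\<lambda>j. (Z ** mpow A j ** B) ** L j) K"
      using c dimD[OF Z] by (subst mul_msum) (simp_all add: mul_assoc)
    finally show ?thesis .
  qed
  from this[OF X] this[OF Y] show ?thesis by (simp add: eq)
qed

text \<open>Let \<open>L\<close> be a left inverse of the observability map of the first system and \<open>L'\<close> a right inverse of
  its controllability map.  Then \<open>U\<close> is \<open>L\<close> applied to the observability map of the second system, and
  \<open>V\<close> is the controllability map of the second system applied to \<open>L'\<close>.  In products of these maps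
  only Markov parameters occur, so that the second system may be exchanged for the first.\<close>

lemma minimal_comparison:
  assumes s: "is_sys n N D C A B" and obs: "observable t n N C A" and con: "controllable t n N A B"
    and s': "is_sys n N' D' C' A' B'" and m: "\<And>k. C ** mpow A k ** B = C' ** mpow A' k ** B'"
  shows "\<exists>U V. U \<in> mats N N' \<and> V \<in> mats N' N \<and> U ** V = one N \<and>
    (\<forall>k. C' ** mpow A' k ** V = C ** mpow A k) \<and> (\<forall>k. U ** mpow A' k ** B' = mpow A k ** B)"
proof -
  note c = is_sysD[OF s] and c' = is_sysD[OF s']
  note [simp] = c(5-) c'(5-) mpow_dim[OF c(3)] mpow_dim[OF c'(3)]
  have m': "C' ** (mpow A' j ** (mpow A' k ** B')) = C ** (mpow A j ** (mpow A k ** B))" for j k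
    using m[of "j + k"] by (simp add: mpow_add[OF c(3)] mpow_add[OF c'(3)] mul_assoc)
  have m'': "C' ** (mpow A' j ** (mpow A' k ** (B' ** X))) = C ** (mpow A j ** (mpow A k ** (B ** X)))"
    if "dim_row X = n" for j k X
    using arg_cong[OF m'[of j k], of "\<lambda>M. M ** X"] that by (simp add: mul_assoc)
  have "h = 0\<^sub>m N 1" if "h \<in> mats N 1" "\<And>k. C ** mpow A k ** h = 0\<^sub>m n 1" for h
    using obs that unfolding observable_iff[OF c(2,3)] by blast
  then obtain K L where L: "\<And>j. L j \<in> mats N n"
    and e: "msum N N (\<lambda>j. L j ** (C ** mpow A j)) K = one N"
    using observable_left_inverse[OF c(2,3)] by blast
  obtain K' L' where L': "\<And>j. L' j \<in> mats n N"
    and e': "msum N N (\<lambda>k. mpow A k ** B ** L' k) K' = one N"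
    using controllable_right_inverse[OF c(3,4) con] by blast
  note [simp] = L[THEN dimD(1)] L[THEN dimD(2)]
    L'[THEN dimD(1)] L'[THEN dimD(2)]
  define U where "U = msum N N' (\<lambda>j. L j ** (C' ** mpow A' j)) K"
  define V where "V = msum N' N (\<lambda>k. mpow A' k ** B' ** L' k) K'"
  have U: "U \<in> mats N N'" and V: "V \<in> mats N' N" by (simp_all add: U_def V_def)
  note [simp] = dimD[OF U] dimD[OF V]
  have cU: "L j ** (C' ** mpow A' j) \<in> mats N N'" "L j ** (C ** mpow A j) \<in> mats N N" for j
    by auto
  have cV: "mpow A' k ** B' ** L' k \<in> mats N' N" "mpow A k ** B ** L' k \<in> mats N N" for k
    by auto
  have 1: "C' ** mpow A' j ** V = C ** mpow A j" for j
  proof -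
    have "C' ** mpow A' j ** V = msum n N (\<lambda>k. C' ** mpow A' j ** (mpow A' k ** B' ** L' k)) K'"
      unfolding V_def using cV by (subst mul_msum) simp_all
    also have "\<dots> = msum n N (\<lambda>k. C ** mpow A j ** (mpow A k ** B ** L' k)) K'"
      by (rule msum_cong) (simp add: mul_assoc m'')
    also have "\<dots> = C ** mpow A j ** msum N N (\<lambda>k. mpow A k ** B ** L' k) K'"
      using cV by (subst mul_msum) simp_all
    also have "\<dots> = C ** mpow A j" unfolding e' by simp
    finally show ?thesis .
  qed
  have 2: "U ** mpow A' k ** B' = mpow A k ** B" for k
  proof -
    have "U ** mpow A' k ** B' = U ** (mpow A' k ** B')" by (simp add: mul_assoc)
    also have "\<dots> = msum N n (\<lambda>j. L j ** (C' ** mpow A' j) ** (mpow A' k ** B')) K"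
      unfolding U_def using cU by (subst msum_mul) simp_all
    also have "\<dots> = msum N n (\<lambda>j. L j ** (C ** mpow A j) ** (mpow A k ** B)) K"
      by (rule msum_cong) (simp add: mul_assoc m')
    also have "\<dots> = msum N N (\<lambda>j. L j ** (C ** mpow A j)) K ** (mpow A k ** B)"
      using cU by (subst msum_mul) simp_all
    also have "\<dots> = mpow A k ** B" unfolding e by simp
    finally show ?thesis .
  qed
  have "U ** V = msum N N (\<lambda>j. L j ** (C' ** mpow A' j) ** V) K"
    unfolding U_def using cU by (subst msum_mul) simp_all
  also have "\<dots> = msum N N (\<lambda>j. L j ** (C ** mpow A j)) K"
    using 1 by (intro msum_cong) (simp add: mul_assoc)
  also have "\<dots> = one N" by (rule e)
  finally show ?thesis using U V 1 2 by blast
qed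

lemma minimal_size_le:
  assumes "is_sys n N D C A B" "observable t n N C A" "controllable t n N A B"
    and "is_sys n N' D' C' A' B'" "\<And>k. C ** mpow A k ** B = C' ** mpow A' k ** B'"
  shows "N \<le> N'"
  using minimal_comparison[OF assms] left_invertible_imp_le by blast

lemma state_space_isomorphism:
  assumes s: "is_sys n N D C A B" and obs: "observable t n N C A" and con: "controllable t n N A B"
    and s': "is_sys n N D' C' A' B'" and m: "\<And>k. C ** mpow A k ** B = C' ** mpow A' k ** B'"
  shows "\<exists>U V. U \<in> mats N N \<and> V \<in> mats N N \<and> U ** V = one N \<and> V ** U = one N \<and>
    C' = C ** U \<and> U ** A' = A ** U \<and> U ** B' = B"
proof -
  obtain U V where U: "U \<in> mats N N" and V: "V \<in> mats N N" and UV: "U ** V = one N"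
    and 1: "\<And>k. C' ** mpow A' k ** V = C ** mpow A k" and 2: "\<And>k. U ** mpow A' k ** B' = mpow A k ** B"
    using minimal_comparison[OF assms] by blast
  have VU: "V ** U = one N" by (rule one_sided_inverse[OF U V UV])
  note c = is_sysD[OF s] and c' = is_sysD[OF s']
  note [simp] = c(5-) c'(5-) mpow_dim[OF c(3)] mpow_dim[OF c'(3)]
    dimD[OF U] dimD[OF V]
  have 3: "C' ** mpow A' k = C ** mpow A k ** U" for k
    unfolding 1[symmetric] using VU by (simp add: mul_assoc)
  have "U ** A' = A ** U"
  proof (rule observable_cancel[OF c(2,3) obs])
    fix k
    have "C ** mpow A k ** (U ** A') = C' ** mpow A' (Suc k)"
      using 3[of k] by (simp flip: mul_assoc)
    also have "\<dots> = C ** mpow A k ** (A ** U)"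
      unfolding 3 by (simp add: mul_assoc)
    finally show "C ** mpow A k ** (U ** A') = C ** mpow A k ** (A ** U)" .
  qed (rule carrier_matI; simp)+
  moreover have "C' = C ** U" using 3[of 0] by simp
  moreover have "U ** B' = B" using 2[of 0] by simp
  ultimately show ?thesis using U V UV VU by blast
qed

section \<open>Products, adjoints and rational functions\<close>

lemma res_diff:
  assumes "regular A x" "A \<in> mats N N"
  shows "res A x - x *s (A ** res A x) = one N" "res A x - x *s (res A x ** A) = one N"
proof -
  note [simp] = res_carrier[OF assms] dimD[OF assms(2)]
  show "res A x - x *s (A ** res A x) = one N"
    by (subst res_eq(1)[OF assms]) (rule eq_matI; simp)
  show "res A x - x *s (res A x ** A) = one N"
    by (subst res_eq(2)[OF assms]) (rule eq_matI; simp)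
qed

definition prodC :: "nat \<Rightarrow> nat \<Rightarrow> ht mat \<Rightarrow> ht mat \<Rightarrow> ht mat \<Rightarrow> ht mat" where
  "prodC N1 N2 D1 C1 C2 = C1 ** (inl N1 N2)\<star> + D1 ** C2 ** (inr N1 N2)\<star>"

definition prodA :: "nat \<Rightarrow> nat \<Rightarrow> ht mat \<Rightarrow> ht mat \<Rightarrow> ht mat \<Rightarrow> ht mat \<Rightarrow> ht mat" where
  "prodA N1 N2 A1 B1 C2 A2 = inl N1 N2 ** A1 ** (inl N1 N2)\<star>
     + inl N1 N2 ** B1 ** C2 ** (inr N1 N2)\<star> + inr N1 N2 ** A2 ** (inr N1 N2)\<star>"

definition prodB :: "nat \<Rightarrow> nat \<Rightarrow> ht mat \<Rightarrow> ht mat \<Rightarrow> ht mat \<Rightarrow> ht mat" where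
  "prodB N1 N2 B1 D2 B2 = inl N1 N2 ** B1 ** D2 + inr N1 N2 ** B2"

text \<open>This is the series connection.  The resolvent of its block triangular main operator is
  explicit; it is called \<open>?Z\<close> below.\<close>

lemma product_system:
  assumes s1: "is_sys n N1 D1 C1 A1 B1" and s2: "is_sys n N2 D2 C2 A2 B2"
  defines "C \<equiv> prodC N1 N2 D1 C1 C2" and "A \<equiv> prodA N1 N2 A1 B1 C2 A2" and "B \<equiv> prodB N1 N2 B1 D2 B2"
  shows "is_sys n (N1 + N2) (D1 ** D2) C A B"
    "regular A1 x \<Longrightarrow> regular A2 x \<Longrightarrow> regular A x"
    "regular A1 x \<Longrightarrow> regular A2 x \<Longrightarrow>
       tf (D1 ** D2) C A B x = tf D1 C1 A1 B1 x ** tf D2 C2 A2 B2 x"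
proof -
  note d1 = is_sysD[OF s1] and d2 = is_sysD[OF s2]
  note [simp] = d1(5-) d2(5-)
  let ?E = "inl N1 N2" let ?F = "inr N1 N2"
  show s: "is_sys n (N1 + N2) (D1 ** D2) C A B"
    by (auto simp: is_sys_def A_def B_def C_def prodA_def prodB_def prodC_def)
  assume inv: "regular A1 x" "regular A2 x"
  note [simp] = res_carrier(2-)[OF inv(1) d1(3)] res_carrier(2-)[OF inv(2) d2(3)]
  let ?r = "res A1 x" let ?s = "res A2 x"
  let ?Z = "?E ** ?r ** ?E\<star> + ?F ** ?s ** ?F\<star> + x *s (?E ** ?r ** B1 ** C2 ** ?s ** ?F\<star>)"
  let ?R = "?r - x *s (A1 ** ?r)" let ?S = "?s - x *s (A2 ** ?s)"
  have "?Z - x *s (A ** ?Z) =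
      ?E ** ?R ** ?E\<star> + ?F ** ?S ** ?F\<star> + x *s (?E ** (?R - one N1) ** B1 ** C2 ** ?s ** ?F\<star>)"
    by (simp add: A_def prodA_def mul_distribs mul_assoc) (rule eq_matI; simp add: algebra_simps)
  also have "\<dots> = one (N1 + N2)"
    unfolding res_diff(1)[OF inv(1) d1(3)] res_diff(1)[OF inv(2) d2(3)]
    using direct_sum_total[of N1 N2] by (simp add: mul_distribs) (rule eq_matI; simp)
  finally have z: "?Z - x *s (A ** ?Z) = one (N1 + N2)" .
  have "?Z \<in> mats (N1 + N2) (N1 + N2)" by (rule carrier_matI) simp_all
  note r = res_eqI[OF is_sysD(3)[OF s] this z]
  show "regular A x" by (rule r)
  show "tf (D1 ** D2) C A B x = tf D1 C1 A1 B1 x ** tf D2 C2 A2 B2 x"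
    unfolding tf_eq r(2)
    by (simp add: B_def C_def prodB_def prodC_def mul_distribs mul_assoc)
       (rule eq_matI; simp add: algebra_simps)
qed

lemma pencil_star: "A \<in> mats N N \<Longrightarrow> pencil (- A\<star>) x = (pencil A (- x))\<star>"
  by (rule eq_matI) (auto simp: pencil_def ht_star_diff ht_star_scaleR ht_star_minus ht_star_add)

lemma adjoint_system:
  assumes s: "is_sys n N D C A B"
  shows "is_sys n N (D\<star>) (B\<star>) (- A\<star>) (- C\<star>)"
    "regular A (- x) \<Longrightarrow> regular (- A\<star>) x"
    "regular A (- x) \<Longrightarrow> res (- A\<star>) x = (res A (- x))\<star>"
    "regular A (- x) \<Longrightarrow> tf (D\<star>) (B\<star>) (- A\<star>) (- C\<star>) x = (tf D C A B (- x))\<star>"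
proof -
  note d = is_sysD[OF s]
  note [simp] = d(5-)
  show s': "is_sys n N (D\<star>) (B\<star>) (- A\<star>) (- C\<star>)"
    by (auto simp: is_sys_def)
  assume inv: "regular A (- x)"
  note i = ht_invD[OF inv pencil_carrier[OF d(3)]]
  note [simp] = res_carrier(2-)[OF inv d(3)]
  have "ht_inverse_of t (pencil (- A\<star>) x) ((res A (- x))\<star>)"
    using arg_cong[OF i(2), of ht_star_mat] arg_cong[OF i(3), of ht_star_mat]
    by (intro ht_inverse_ofI[of _ N] carrier_matI) (simp_all add: pencil_star[OF d(3)] star_mul)
  then show "regular (- A\<star>) x" and r: "res (- A\<star>) x = (res A (- x))\<star>"
    using ht_inv_eq by (auto simp: ht_invertible_def)
  show "tf (D\<star>) (B\<star>) (- A\<star>) (- C\<star>) x = (tf D C A B (- x))\<star>"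
    unfolding tf_eq r by (simp add: star_distribs mul_distribs mul_assoc) (rule eq_matI; simp)
qed

text \<open>The property is inherited by products and adjoints, and the value at \<open>a\<close> is determined
  by the values near \<open>0\<close>.  So identities between rational functions need to be checked
  near \<open>0\<close> only.\<close>

definition realizable_at :: "nat \<Rightarrow> (real \<Rightarrow> ht mat) \<Rightarrow> real \<Rightarrow> bool" where
  "realizable_at n F a \<longleftrightarrow> (\<exists>N D C A B. is_sys n N D C A B \<and> regular A a \<and>
     F a = tf D C A B a \<and> (\<forall>\<^sub>F x in nhds 0. F x = tf D C A B x))"

lemma realizable_at_tf:
  "is_sys n N D C A B \<Longrightarrow> regular A a \<Longrightarrow> realizable_at n (tf D C A B) a"
  unfolding realizable_at_def
  by (rule exI[of _ N], rule exI[of _ D], rule exI[of _ C], rule exI[of _ A], rule exI[of _ B]) simp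

lemma realizable_at_const:
  assumes "G \<in> mats n n"
  shows "realizable_at n (\<lambda>_. G) a"
proof -
  let ?C = "0\<^sub>m n 0 :: ht mat" let ?A = "0\<^sub>m 0 0 :: ht mat" let ?B = "0\<^sub>m 0 n :: ht mat"
  have s: "is_sys n 0 G ?C ?A ?B" using assms by (simp add: is_sys_def)
  have i: "regular ?A x" for x
  proof -
    have "pencil ?A x = one 0" by (rule eq_matI) auto
    then show ?thesis by simp
  qed
  have "tf G ?C ?A ?B x = G" for x
    using assms res_carrier[OF i, of 0] by (intro eq_matI) (auto simp: tf_eq mul_index)
  then have "is_sys n 0 G ?C ?A ?B \<and> regular ?A a \<and> G = tf G ?C ?A ?B a \<and>
      (\<forall>\<^sub>F x in nhds 0. G = tf G ?C ?A ?B x)" using s i by simp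
  then show ?thesis unfolding realizable_at_def by blast
qed

lemma realizable_at_mult:
  assumes "realizable_at n F a" "realizable_at n G a"
  shows "realizable_at n (\<lambda>x. F x ** G x) a"
proof -
  obtain N1 D1 C1 A1 B1 where 1: "is_sys n N1 D1 C1 A1 B1" "regular A1 a"
    "F a = tf D1 C1 A1 B1 a" "\<forall>\<^sub>F x in nhds 0. F x = tf D1 C1 A1 B1 x"
    using assms(1) unfolding realizable_at_def by blast
  obtain N2 D2 C2 A2 B2 where 2: "is_sys n N2 D2 C2 A2 B2" "regular A2 a"
    "G a = tf D2 C2 A2 B2 a" "\<forall>\<^sub>F x in nhds 0. G x = tf D2 C2 A2 B2 x"
    using assms(2) unfolding realizable_at_def by blast
  note p = product_system[OF 1(1) 2(1)]
  have "\<forall>\<^sub>F x in nhds 0. F x ** G x =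
      tf (D1 ** D2) (prodC N1 N2 D1 C1 C2) (prodA N1 N2 A1 B1 C2 A2) (prodB N1 N2 B1 D2 B2) x"
    using 1(4) 2(4) eventually_pencil[OF is_sysD(3)[OF 1(1)]] eventually_pencil[OF is_sysD(3)[OF 2(1)]]
    by eventually_elim (simp add: p(3))
  moreover have "F a ** G a =
      tf (D1 ** D2) (prodC N1 N2 D1 C1 C2) (prodA N1 N2 A1 B1 C2 A2) (prodB N1 N2 B1 D2 B2) a"
    using 1 2 by (simp add: p(3))
  ultimately show ?thesis
    unfolding realizable_at_def using p(1) p(2)[OF 1(2) 2(2)] by blast
qed

lemma eventually_nhds_0_minus: "\<forall>\<^sub>F x in nhds (0::real). P x \<Longrightarrow> \<forall>\<^sub>F x in nhds 0. P (- x)"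
  unfolding eventually_nhds_metric dist_real_def by (metis abs_minus_cancel diff_zero)

lemma realizable_at_adjoint:
  assumes "realizable_at n F (- a)"
  shows "realizable_at n (\<lambda>x. (F (- x))\<star>) a"
proof -
  obtain N D C A B where 1: "is_sys n N D C A B" "regular A (- a)"
    "F (- a) = tf D C A B (- a)" "\<forall>\<^sub>F x in nhds 0. F x = tf D C A B x"
    using assms unfolding realizable_at_def by blast
  note p = adjoint_system[OF 1(1)]
  have "\<forall>\<^sub>F x in nhds 0. (F (- x))\<star> = tf (D\<star>) (B\<star>) (- A\<star>) (- C\<star>) x"
    using eventually_nhds_0_minus[OF 1(4)] eventually_nhds_0_minus[OF eventually_pencil[OF is_sysD(3)[OF 1(1)]]]
    by eventually_elim (simp add: p(4))
  moreover have "(F (- a))\<star> = tf (D\<star>) (B\<star>) (- A\<star>) (- C\<star>) a"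
    using 1 by (simp add: p(4))
  ultimately show ?thesis
    unfolding realizable_at_def using p(1) p(2)[OF 1(2)] by blast
qed

text \<open>Equality near \<open>0\<close> gives equal Markov parameters, and these determine the value at \<open>a\<close>.\<close>

lemma realizable_at_unique:
  assumes "realizable_at n F a" "realizable_at n G a" "\<forall>\<^sub>F x in nhds 0. F x = G x"
  shows "F a = G a"
proof -
  obtain N1 D1 C1 A1 B1 where 1: "is_sys n N1 D1 C1 A1 B1" "regular A1 a"
    "F a = tf D1 C1 A1 B1 a" "\<forall>\<^sub>F x in nhds 0. F x = tf D1 C1 A1 B1 x"
    using assms(1) unfolding realizable_at_def by blast
  obtain N2 D2 C2 A2 B2 where 2: "is_sys n N2 D2 C2 A2 B2" "regular A2 a"
    "G a = tf D2 C2 A2 B2 a" "\<forall>\<^sub>F x in nhds 0. G x = tf D2 C2 A2 B2 x"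
    using assms(2) unfolding realizable_at_def by blast
  have "\<forall>\<^sub>F x in nhds 0. tf D1 C1 A1 B1 x = tf D2 C2 A2 B2 x"
    using assms(3) 1(4) 2(4) by eventually_elim simp
  from tf_eq_of_markov_eq[OF 1(1) 2(1) markov_eq_of_tf_eq[OF 1(1) 2(1) this] 1(2) 2(2)]
  show ?thesis using 1(3) 2(3) by simp
qed

subsection \<open>Rational functions\<close>

lemma is_realization_sys:
  "is_realization t n R N D C A B \<longleftrightarrow> is_sys n N D C A B \<and> R 0 = Some D \<and>
     (\<forall>x\<in>dom R. regular A x \<longrightarrow> R x = Some (tf D C A B x))"
  by (auto simp: is_realization_def is_sys_def)

lemma rational_near_0:
  assumes R: "rational_fun t n R" and r: "is_realization t n R N D C A B"
  shows "\<forall>\<^sub>F x in nhds 0. R x = Some (tf D C A B x)"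
proof -
  have s: "is_sys n N D C A B" using r by (simp add: is_realization_sys)
  show ?thesis using eventually_pencil[OF is_sysD(3)[OF s]]
  proof eventually_elim
    case (elim x)
    then have "x \<in> dom R" using R r unfolding rational_fun_def by blast
    then show ?case using r elim unfolding is_realization_sys by blast
  qed
qed

lemma rational_realizable_at:
  assumes R: "rational_fun t n R" and x: "x \<in> dom R"
  shows "realizable_at n (\<lambda>x. the (R x)) x"
proof -
  obtain N D C A B where r: "is_realization t n R N D C A B" and i: "regular A x"
    using R x unfolding rational_fun_def by blast
  have "\<forall>\<^sub>F x in nhds 0. the (R x) = tf D C A B x"
    using rational_near_0[OF R r] by eventually_elim simp
  moreover have "the (R x) = tf D C A B x" using r x i by (auto simp: is_realization_sys)
  ultimately show ?thesis using r i unfolding realizable_at_def is_realization_sys by blast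
qed

lemma rational_near_0_dom:
  assumes R: "rational_fun t n R"
  shows "\<forall>\<^sub>F x in nhds 0. x \<in> dom R"
proof -
  obtain N D C A B where "is_realization t n R N D C A B"
    using R unfolding rational_fun_def by blast
  from rational_near_0[OF R this] show ?thesis by eventually_elim auto
qed

lemma is_realizationI:
  assumes R: "rational_fun t n R" and s: "is_sys n N D C A B"
    and near: "\<forall>\<^sub>F x in nhds 0. the (R x) = tf D C A B x"
  shows "is_realization t n R N D C A B"
proof -
  have "R x = Some (tf D C A B x)" if x: "x \<in> dom R" and i: "regular A x" for x
  proof -
    from realizable_at_unique[OF rational_realizable_at[OF R x] realizable_at_tf[OF s i] near] show ?thesis
      using x by auto
  qed
  moreover have "0 \<in> dom R" using eventually_nhds_x_imp_x[OF rational_near_0_dom[OF R]] .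
  moreover have "regular A 0" using is_sysD(3)[OF s] by simp
  ultimately show ?thesis using s tf_0[OF s] unfolding is_realization_sys by metis
qed

lemma rational_fun_eqI:
  assumes R: "rational_fun t n R" and S: "rational_fun t n S"
    and near: "\<forall>\<^sub>F x in nhds 0. the (R x) = the (S x)"
  shows "R = S"
proof -
  have sub: "is_realization t n S N D C A B"
    if "rational_fun t n R" "rational_fun t n S" "\<forall>\<^sub>F x in nhds 0. the (R x) = the (S x)"
      "is_realization t n R N D C A B" for R S N D C A B
  proof (rule is_realizationI[OF that(2)])
    show "is_sys n N D C A B" using that(4) by (simp add: is_realization_sys)
    show "\<forall>\<^sub>F x in nhds 0. the (S x) = tf D C A B x"
      using that(3) rational_near_0[OF that(1,4)] by eventually_elim simp
  qed
  have near': "\<forall>\<^sub>F x in nhds 0. the (S x) = the (R x)"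
    using near by eventually_elim simp
  have eq: "is_realization t n R N D C A B \<longleftrightarrow> is_realization t n S N D C A B" for N D C A B
    using sub[OF R S near] sub[OF S R near'] by blast
  then have dom: "dom R = dom S" using R S by (simp add: rational_fun_def)
  show "R = S"
  proof
    fix x
    show "R x = S x"
    proof (cases "x \<in> dom R")
      case True
      then have "the (R x) = the (S x)"
        using realizable_at_unique[OF rational_realizable_at[OF R] rational_realizable_at[OF S] near] dom
        by blast
      moreover obtain a b where "R x = Some a" "S x = Some b" using True dom by blast
      ultimately show ?thesis by simp
    qed (use dom in auto)
  qed
qed

text \<open>The maximal extension collects the values of all systems whose transfer functions agree with the
  given one near \<open>0\<close>.\<close>

lemma rational_fun_exists:
  assumes s: "is_sys n N D C A B"
  shows "\<exists>R. rational_fun t n R \<and> is_realization t n R N D C A B"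
proof -
  define good where "good = (\<lambda>(N', D', C', A', B'). is_sys n N' D' C' A' B' \<and>
      (\<forall>\<^sub>F x in nhds 0. tf D C A B x = tf D' C' A' B' x))"
  define R where "R x = (if \<exists>N' D' C' A' B'. good (N', D', C', A', B') \<and> regular A' x
      then Some (SOME q. \<exists>N' D' C' A' B'. good (N', D', C', A', B') \<and> regular A' x \<and>
        q = tf D' C' A' B' x) else None)" for x
  have uniq: "tf D' C' A' B' x = tf D'' C'' A'' B'' x"
    if "good (N', D', C', A', B')" "regular A' x"
      "good (N'', D'', C'', A'', B'')" "regular A'' x"
    for N' D' C' A' B' N'' D'' C'' A'' B'' x
  proof (rule realizable_at_unique)
    show "realizable_at n (tf D' C' A' B') x" "realizable_at n (tf D'' C'' A'' B'') x"
      using that by (auto simp: good_def intro: realizable_at_tf)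
    have "\<forall>\<^sub>F x in nhds 0. tf D C A B x = tf D' C' A' B' x"
      "\<forall>\<^sub>F x in nhds 0. tf D C A B x = tf D'' C'' A'' B'' x"
      using that unfolding good_def by auto
    then show "\<forall>\<^sub>F x in nhds 0. tf D' C' A' B' x = tf D'' C'' A'' B'' x"
      by eventually_elim simp
  qed
  have val: "R x = Some (tf D' C' A' B' x)"
    if g: "good (N', D', C', A', B')" and i: "regular A' x" for N' D' C' A' B' x
  proof -
    have "(SOME q. \<exists>N' D' C' A' B'. good (N', D', C', A', B') \<and> regular A' x \<and>
        q = tf D' C' A' B' x) = tf D' C' A' B' x"
    proof (rule some_equality)
      show "\<exists>N'' D'' C'' A'' B''. good (N'', D'', C'', A'', B'') \<and> regular A'' x \<and>
        tf D' C' A' B' x = tf D'' C'' A'' B'' x" using g i by blast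
      fix q
      assume "\<exists>N' D' C' A' B'. good (N', D', C', A', B') \<and> regular A' x \<and>
        q = tf D' C' A' B' x"
      then show "q = tf D' C' A' B' x" using uniq[OF _ _ g i] by blast
    qed
    moreover have "\<exists>N' D' C' A' B'. good (N', D', C', A', B') \<and> regular A' x"
      using g i by blast
    ultimately show ?thesis unfolding R_def by simp
  qed
  have real: "is_realization t n R N' D' C' A' B'" if g: "good (N', D', C', A', B')" for N' D' C' A' B'
  proof -
    have s': "is_sys n N' D' C' A' B'" using g by (simp add: good_def)
    have "R 0 = Some D'" using val[OF g, of 0] tf_0[OF s'] is_sysD(3)[OF s'] by simp
    then show ?thesis unfolding is_realization_sys using s' val[OF g] by blast
  qed
  have g0: "good (N, D, C, A, B)" using s by (simp add: good_def)
  have good: "good (N', D', C', A', B')" if r: "is_realization t n R N' D' C' A' B'" for N' D' C' A' B'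
  proof -
    have s': "is_sys n N' D' C' A' B'" using r by (simp add: is_realization_sys)
    have "\<forall>\<^sub>F x in nhds 0. tf D C A B x = tf D' C' A' B' x"
      using eventually_pencil[OF is_sysD(3)[OF s]] eventually_pencil[OF is_sysD(3)[OF s']]
    proof eventually_elim
      case (elim x)
      have "R x = Some (tf D C A B x)" using val[OF g0 elim(1)] .
      moreover from this have "R x = Some (tf D' C' A' B' x)"
        using r elim(2) unfolding is_realization_sys by blast
      ultimately show ?case by simp
    qed
    then show ?thesis using s' by (simp add: good_def)
  qed
  have "dom R = {x. \<exists>N D C A B. is_realization t n R N D C A B \<and> regular A x}"
  proof (rule Set.set_eqI, rule iffI)
    fix x assume "x \<in> dom R"
    then have "\<exists>N' D' C' A' B'. good (N', D', C', A', B') \<and> regular A' x"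
      by (rule contrapos_pp) (simp only: R_def domIff if_False not_not)
    then show "x \<in> {x. \<exists>N D C A B. is_realization t n R N D C A B \<and> regular A x}"
      using real by blast
  next
    fix x assume "x \<in> {x. \<exists>N D C A B. is_realization t n R N D C A B \<and> regular A x}"
    then show "x \<in> dom R" using good val by blast
  qed
  then have "rational_fun t n R" unfolding rational_fun_def using real[OF g0] by blast
  then show ?thesis using real[OF g0] by blast
qed

lemma has_degree_unique:
  assumes R: "rational_fun t n R" and "has_degree t n R N" "has_degree t n R N'"
  shows "N = N'"
proof -
  obtain D C A B where 1: "minimal_realization t n R N D C A B"
    using assms(2) unfolding has_degree_def by blast
  obtain D' C' A' B' where 2: "minimal_realization t n R N' D' C' A' B'"
    using assms(3) unfolding has_degree_def by blast
  have s: "is_sys n N D C A B" "is_sys n N' D' C' A' B'"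
    and r: "is_realization t n R N D C A B" "is_realization t n R N' D' C' A' B'"
    and m: "observable t n N C A" "controllable t n N A B" "observable t n N' C' A'" "controllable t n N' A' B'"
    using 1 2 unfolding minimal_realization_def is_realization_sys by blast+
  have e: "\<forall>\<^sub>F x in nhds 0. tf D C A B x = tf D' C' A' B' x"
    using rational_near_0[OF R r(1)] rational_near_0[OF R r(2)] by eventually_elim simp
  note mk = markov_eq_of_tf_eq(2)[OF s e]
  show ?thesis
    using minimal_size_le[OF s(1) m(1,2) s(2) mk] minimal_size_le[OF s(2) m(3,4) s(1) mk[symmetric]]
    by simp
qed

section \<open>Non-degenerate submodules\<close>

text \<open>This is half of the real form \<open>ht_form\<close>, which in terms of the algebra is the real part of
  \<open>f\<star> g\<close>.\<close>

definition sform :: "ht mat \<Rightarrow> ht mat \<Rightarrow> real" where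
  "sform f g = Re (fst ((f\<star> ** g) $$ (0, 0)))"

lemma trace_ht_I: "trace_mat (ht_I t p * ht_I t q) = of_real (2 * Re (fst (hmul p q)))"
  by (simp add: trace_mat_def ht_I_def mat_of_rows_list_def scalar_prod_def ht_mult_def
      lessThan_Suc numeral_2_eq_2 atLeast0_lessThan_Suc complex_eq_iff algebra_simps)

lemma ht_form_eq_sform: "f \<in> mats N 1 \<Longrightarrow> g \<in> mats N 1 \<Longrightarrow> ht_form t N f g = 2 * sform f g"
  by (auto simp: ht_form_def trace_ht_I sform_def mul_index fst_sum sum_distrib_left)

lemma H_form_eq_sform:
  "H \<in> mats N N \<Longrightarrow> f \<in> mats N 1 \<Longrightarrow> g \<in> mats N 1 \<Longrightarrow>
    H_form t N H f g = 2 * sform f (H ** g)"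
  unfolding H_form_def by (rule ht_form_eq_sform) auto

lemma Re_fst_star [simp]: "Re (fst (ht_star q)) = Re (fst q)"
  by (simp add: ht_star_def)

lemma sform_sym: "f \<in> mats N 1 \<Longrightarrow> g \<in> mats N 1 \<Longrightarrow> sform f g = sform g f"
proof -
  assume a: "f \<in> mats N 1" "g \<in> mats N 1"
  note [simp] = dimD[OF a(1)] dimD[OF a(2)]
  have "g\<star> ** f = (f\<star> ** g)\<star>" by (simp add: star_mul)
  then show ?thesis by (simp add: sform_def)
qed

lemma sform_add:
  "f \<in> mats N 1 \<Longrightarrow> g \<in> mats N 1 \<Longrightarrow> h \<in> mats N 1 \<Longrightarrow> sform f (g + h) = sform f g + sform f h"
  unfolding sform_def by (subst mul_add_right) auto

lemma sform_adj:
  assumes "f \<in> mats N 1" "g \<in> mats N 1" "P \<in> mats N N"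
  shows "sform f (P ** g) = sform (P\<star> ** f) g"
proof -
  note [simp] = assms[THEN dimD(1)] assms[THEN dimD(2)]
  show ?thesis by (simp add: sform_def star_mul mul_assoc)
qed

text \<open>The entry \<open>(a, b)\<close> of \<open>v\<close> is tested with \<open>(a, - t b)\<close>, which gives \<open>|a|\<^sup>2 + t\<^sup>2 |b|\<^sup>2\<close>.\<close>

lemma sform_nondegenerate:
  assumes v: "v \<in> mats N 1" and z: "\<And>m. m \<in> mats N 1 \<Longrightarrow> sform v m = 0"
  shows "v = 0\<^sub>m N 1"
proof (rule eq_matI, goal_cases)
  case (1 k j)
  obtain a b where ab: "v $$ (k, 0) = (a, b)" by fastforce
  define m where "m = mat N 1 (\<lambda>(i, _). if i = k then (a, - of_real t * b) else 0)"
  have m: "m \<in> mats N 1" by (simp add: m_def)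
  have "sform v m = (\<Sum>i<N. Re (fst (hmul (ht_star (v $$ (i, 0))) (m $$ (i, 0)))))"
    using dimD[OF v] dimD[OF m] by (simp add: sform_def mul_index fst_sum)
  also have "\<dots> = (\<Sum>i<N. if i = k then Re (fst (hmul (ht_star (a, b)) (a, - of_real t * b))) else 0)"
    by (rule sum.cong) (auto simp: m_def ab)
  also have "\<dots> = Re (cnj a * a + of_real (t * t) * (b * cnj b))"
    using 1 by (simp add: ht_star_def ht_mult_def algebra_simps)
  also have "cnj a * a = of_real ((norm a)\<^sup>2)" by (metis complex_norm_square mult.commute)
  also have "b * cnj b = of_real ((norm b)\<^sup>2)" by (metis complex_norm_square)
  finally have "(norm a)\<^sup>2 + t * t * (norm b)\<^sup>2 = 0" using z[OF m] by simp
  then have "(norm a)\<^sup>2 = 0 \<and> t * t * (norm b)\<^sup>2 = 0" by (subst (asm) add_nonneg_eq_0_iff) auto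
  then have "v $$ (k, 0) = 0" using t0 by (simp add: ab zero_prod_def)
  then show ?case using 1 by simp
qed (use v in auto)

lemma right_scale_eq_mul:
  assumes "f \<in> mats N 1"
  shows "map_mat (\<lambda>y. hmul y q) f = f ** mat 1 1 (\<lambda>_. q)"
  using assms by (intro eq_matI) (auto simp: mul_index)

lemma right_submodule_mul:
  assumes M: "right_submodule t N M" and f: "f \<in> M" and w: "w \<in> mats 1 1"
  shows "f ** w \<in> M"
proof -
  have fc: "f \<in> mats N 1" using M f unfolding right_submodule_def by blast
  have "w = mat 1 1 (\<lambda>_. w $$ (0, 0))" using w by (intro eq_matI) auto
  then have "f ** w = map_mat (\<lambda>y. hmul y (w $$ (0, 0))) f"
    using right_scale_eq_mul[OF fc] by simp
  moreover have "\<forall>f\<in>M. \<forall>q. map_mat (\<lambda>y. hmul y q) f \<in> M"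
    using M unfolding right_submodule_def by (elim conjE)
  ultimately show ?thesis using f by (metis (no_types))
qed

text \<open>The fixed points of the involution of the algebra are the real numbers.\<close>

lemma self_adjoint_scalar:
  assumes "w \<in> mats 1 1" "w\<star> = w"
  shows "w = Re (fst (w $$ (0, 0))) *s one 1"
proof (rule eq_matI, goal_cases)
  case (1 i j)
  then have ij: "i = 0" "j = 0" by auto
  have "ht_star (w $$ (0, 0)) = w $$ (0, 0)"
    using arg_cong[OF assms(2), of "\<lambda>M. M $$ (0, 0)"] assms(1) by simp
  then show ?case
    unfolding ij by (simp add: ht_star_def prod_eq_iff complex_eq_iff)
qed (use assms in auto)

text \<open>One step of the Gram-Schmidt process.  The columns of \<open>V\<close> are the basis found so far, \<open>V L\<close> is the
  \<open>H\<close>-orthogonal projection onto their span, and \<open>g\<close> is orthogonal to it.\<close>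

lemma extend_orthogonal_basis:
  assumes H: "H \<in> mats N N" "H\<star> = H"
    and V: "V \<in> mats N k" and L: "L \<in> mats k N" and LV: "L ** V = one k"
    and HP: "H ** (V ** L) = (V ** L)\<star> ** H"
    and g: "g \<in> mats N 1" and Lg: "L ** g = 0\<^sub>m k 1" and r: "g\<star> ** H ** g = r *s one 1" "r \<noteq> 0"
  defines "V' \<equiv> V ** (inl k 1)\<star> + g ** (inr k 1)\<star>"
    and "L' \<equiv> inl k 1 ** L + (1 / r) *s (inr k 1 ** g\<star> ** H)"
  shows "V' \<in> mats N (k + 1)" "L' \<in> mats (k + 1) N" "L' ** V' = one (k + 1)"
    "H ** (V' ** L') = (V' ** L')\<star> ** H"
proof -
  note [simp] = dimD[OF H(1)] dimD[OF V] dimD[OF L] dimD[OF g]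
  show "V' \<in> mats N (k + 1)" "L' \<in> mats (k + 1) N"
    by (auto simp: V'_def L'_def)
  have "g\<star> ** H ** V = g\<star> ** (H ** (V ** L)) ** V"
    by (simp add: mul_assoc LV)
  also have "\<dots> = (V ** (L ** g))\<star> ** H ** V"
    unfolding HP by (simp add: mul_assoc star_mul)
  finally have gV: "g\<star> ** (H ** V) = 0\<^sub>m 1 k" by (simp add: Lg mul_assoc)
  have gg: "g\<star> ** (H ** g) = r *s one 1" using r by (simp add: mul_assoc)
  note cs = mul_cancel_assoc[OF LV] mul_cancel_assoc[OF Lg]
  have gVX: "g\<star> ** (H ** (V ** X)) = 0\<^sub>m 1 (dim_col X)" if "dim_row X = k" for X
    using arg_cong[OF gV, of "\<lambda>M. M ** X"] that by (simp add: mul_assoc)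
  have ggX: "g\<star> ** (H ** (g ** X)) = r *s X" if "dim_row X = 1" for X
    using arg_cong[OF gg, of "\<lambda>M. M ** X"] that by (simp add: mul_assoc mul_scl_left)
  have "L' ** V' = inl k 1 ** (inl k 1)\<star> + inr k 1 ** (inr k 1)\<star>"
    unfolding L'_def V'_def using r(2)
    by (simp add: mul_distribs mul_assoc cs gVX ggX) (rule eq_matI; simp)
  then show "L' ** V' = one (k + 1)" by (simp only: direct_sum_total)
  have P: "V' ** L' = V ** L + (1 / r) *s (g ** (g\<star> ** H))"
    unfolding L'_def V'_def
    by (simp add: mul_distribs mul_assoc) (rule eq_matI; simp)
  have "H ** (V' ** L') = H ** (V ** L) + (1 / r) *s (H ** (g ** (g\<star> ** H)))"
    unfolding P by (simp add: mul_distribs mul_assoc)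
  also have "\<dots> = (V' ** L')\<star> ** H"
    unfolding P HP by (simp add: star_distribs mul_distribs mul_assoc H(2))
  finally show "H ** (V' ** L') = (V' ** L')\<star> ** H" .
qed

text \<open>A basis of maximal length spans \<open>M\<close>: by maximality all vectors of \<open>M\<close> that are orthogonal to it are
  isotropic, by polarization they are orthogonal to each other, so they belong to the radical of \<open>M\<close>.\<close>

lemma nondegenerate_submodule_basis:
  assumes H: "H \<in> mats N N" "H\<star> = H"
    and M: "right_submodule t N M" and nd: "H_nondegenerate t N H M"
  shows "\<exists>k V L. V \<in> mats N k \<and> L \<in> mats k N \<and> L ** V = one k \<and>
    H ** (V ** L) = (V ** L)\<star> ** H \<and> M = fixed N (V ** L)"
proof -
  have MD: "M \<subseteq> mats N 1" "0\<^sub>m N 1 \<in> M" "\<And>f g. f \<in> M \<Longrightarrow> g \<in> M \<Longrightarrow> f + g \<in> M"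
    using M unfolding right_submodule_def by auto
  define Q where "Q k \<longleftrightarrow> (\<exists>V L. V \<in> mats N k \<and> L \<in> mats k N \<and> L ** V = one k \<and>
    H ** (V ** L) = (V ** L)\<star> ** H \<and> (\<forall>u\<in>mats k 1. V ** u \<in> M))" for k
  have "\<exists>k. Q k \<and> \<not> Q (Suc k)"
  proof (rule ccontr)
    assume "\<nexists>k. Q k \<and> \<not> Q (Suc k)"
    then have step: "Q k \<Longrightarrow> Q (Suc k)" for k by blast
    have "Q 0"
    proof -
      let ?V = "0\<^sub>m N 0 :: ht mat" let ?L = "0\<^sub>m 0 N :: ht mat"
      have z: "?V ** ?L = 0\<^sub>m N N" by (rule eq_matI) (auto simp: mul_index)
      have "?V ** u = 0\<^sub>m N 1" if "u \<in> mats 0 1" for u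
        using that by (intro eq_matI) (auto simp: mul_index)
      moreover have "?L ** ?V = one 0" by (rule eq_matI) auto
      ultimately show ?thesis
        unfolding Q_def using MD(2) dimD[OF H(1)]
        by (intro exI[of _ ?V] exI[of _ ?L]) (simp add: z)
    qed
    then have "Q k" for k by (induction k) (auto intro: step)
    then have "Q (Suc N)" .
    then have "Suc N \<le> N" unfolding Q_def using left_invertible_imp_le by blast
    then show False by simp
  qed
  then obtain k V L where nQ: "\<not> Q (Suc k)"
    and V: "V \<in> mats N k" and L: "L \<in> mats k N" and LV: "L ** V = one k"
    and HP: "H ** (V ** L) = (V ** L)\<star> ** H" and VM: "\<And>u. u \<in> mats k 1 \<Longrightarrow> V ** u \<in> M"
    unfolding Q_def by blast
  note [simp] = dimD[OF H(1)] dimD[OF V] dimD[OF L]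
  note cLV = mul_cancel_assoc[OF LV]
  have isotropic: "sform g (H ** g) = 0" if g: "g \<in> M" "L ** g = 0\<^sub>m k 1" for g
  proof (rule ccontr)
    assume nz: "sform g (H ** g) \<noteq> 0"
    have gc: "g \<in> mats N 1" using g MD(1) by blast
    note [simp] = dimD[OF gc]
    define r where "r = Re (fst ((g\<star> ** H ** g) $$ (0, 0)))"
    let ?V = "V ** (inl k 1)\<star> + g ** (inr k 1)\<star>"
    let ?L = "inl k 1 ** L + (1 / r) *s (inr k 1 ** g\<star> ** H)"
    have "g\<star> ** H ** g = r *s one 1"
      unfolding r_def by (rule self_adjoint_scalar) (auto simp: star_mul mul_assoc H(2))
    moreover have "r \<noteq> 0" using nz by (simp add: r_def sform_def mul_assoc)
    ultimately have ext: "?V \<in> mats N (k + 1)" "?L \<in> mats (k + 1) N"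
      "?L ** ?V = one (k + 1)" "H ** (?V ** ?L) = (?V ** ?L)\<star> ** H"
      using extend_orthogonal_basis[OF H V L LV HP gc g(2)] by blast+
    have "?V ** u \<in> M" if u: "u \<in> mats (k + 1) 1" for u
    proof -
      note [simp] = dimD[OF u]
      have "?V ** u = V ** ((inl k 1)\<star> ** u) + g ** ((inr k 1)\<star> ** u)"
        by (simp add: mul_distribs mul_assoc)
      moreover have "V ** ((inl k 1)\<star> ** u) \<in> M" by (rule VM) auto
      moreover have "g ** ((inr k 1)\<star> ** u) \<in> M"
        by (rule right_submodule_mul[OF M g(1)]) auto
      ultimately show ?thesis using MD(3) by simp
    qed
    with ext have "Q (k + 1)" unfolding Q_def by blast
    then show False using nQ by simp
  qed
  have dec: "f + V ** (- (L ** f)) \<in> M \<and> L ** (f + V ** (- (L ** f))) = 0\<^sub>m k 1" if f: "f \<in> M" for f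
  proof
    have fc: "f \<in> mats N 1" using f MD(1) by blast
    note [simp] = dimD[OF fc]
    show "f + V ** (- (L ** f)) \<in> M" by (intro MD(3) f VM) auto
    show "L ** (f + V ** (- (L ** f))) = 0\<^sub>m k 1"
      by (simp add: mul_distribs mul_assoc cLV) (rule eq_matI; simp)
  qed
  have zero: "g = 0\<^sub>m N 1" if g: "g \<in> M" "L ** g = 0\<^sub>m k 1" for g
  proof -
    have gc: "g \<in> mats N 1" using g MD(1) by blast
    note [simp] = dimD[OF gc]
    have Hc: "H ** h \<in> mats N 1" if "h \<in> mats N 1" for h using that by (intro mul_carrier[OF H(1)])
    have polar: "sform g (H ** h) = 0" if h: "h \<in> M" "L ** h = 0\<^sub>m k 1" for h
    proof -
      have hc: "h \<in> mats N 1" using h MD(1) by blast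
      note [simp] = dimD[OF hc]
      have "L ** (g + h) = 0\<^sub>m k 1" by (simp add: mul_distribs g h)
      then have 0: "sform (g + h) (H ** (g + h)) = 0" by (intro isotropic MD(3) g h)
      have e1: "H ** (g + h) = H ** g + H ** h" by (simp add: mul_distribs)
      have ghc: "g + h \<in> mats N 1" by (rule carrier_matI) simp_all
      have sw: "sform (g + h) x = sform g x + sform h x" if "x \<in> mats N 1" for x
        using sform_add[OF that gc hc] sform_sym[OF ghc that] sform_sym[OF gc that] sform_sym[OF hc that]
        by simp
      have "sform (g + h) (H ** (g + h)) = sform g (H ** g) + sform g (H ** h) + (sform h (H ** g) + sform h (H ** h))"
        unfolding e1 by (simp add: sform_add[OF ghc Hc[OF gc] Hc[OF hc]] sw[OF Hc[OF gc]] sw[OF Hc[OF hc]])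
      moreover have "sform h (H ** g) = sform g (H ** h)"
        using sform_adj[OF hc gc H(1)] sform_sym[OF Hc[OF hc] gc] H(2) by simp
      ultimately show ?thesis using 0 isotropic[OF g] isotropic[OF h] by simp
    qed
    have "sform g (H ** m) = 0" if m: "m \<in> M" for m
    proof -
      have mc: "m \<in> mats N 1" using m MD(1) by blast
      note [simp] = dimD[OF mc]
      let ?h = "m + V ** (- (L ** m))"
      have hc: "?h \<in> mats N 1" "V ** (L ** m) \<in> mats N 1" by auto
      have "H ** (V ** (L ** m)) = H ** (V ** L) ** m" by (simp add: mul_assoc)
      also have "\<dots> = (V ** L)\<star> ** (H ** m)" unfolding HP by (simp add: mul_assoc)
      finally have hx: "H ** (V ** (L ** m)) = (V ** L)\<star> ** (H ** m)" .
      have "m = ?h + V ** (L ** m)"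
        by (simp add: mul_distribs) (rule eq_matI; simp)
      then have "H ** m = H ** ?h + H ** (V ** (L ** m))"
        using mul_add_right[of ?h "V ** (L ** m)" H] by simp
      then have "sform g (H ** m) = sform g (H ** ?h) + sform g (H ** (V ** (L ** m)))"
        using sform_add[OF gc Hc[OF hc(1)] Hc[OF hc(2)]] by simp
      also have "sform g (H ** ?h) = 0" using dec[OF m] polar by blast
      also have "H ** (V ** (L ** m)) = (V ** L)\<star> ** (H ** m)"
        using hx .
      also have "sform g \<dots> = sform (V ** (L ** g)) (H ** m)"
        using sform_adj[OF gc Hc[OF mc] star_carrier[OF mul_carrier[OF V L]]] by (simp add: mul_assoc)
      also have "\<dots> = 0" by (simp add: g(2) sform_def mul_index zero_prod_def)
      finally show ?thesis by simp
    qed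
    then have "H_form t N H g m = 0" if "m \<in> M" for m
      using that H_form_eq_sform[OF H(1) gc subsetD[OF MD(1) that]] by simp
    then have "g \<in> H_perp t N H M"
      unfolding H_perp_def using gc by simp
    then show ?thesis using nd g unfolding H_nondegenerate_def by blast
  qed
  have "M = fixed N (V ** L)"
  proof (intro equalityI subsetI CollectI conjI)
    fix f assume f: "f \<in> M"
    then show fc: "f \<in> mats N 1" using MD(1) by blast
    note [simp] = dimD[OF fc]
    have "f + V ** (- (L ** f)) = 0\<^sub>m N 1" using zero dec[OF f] by blast
    then have e: "f - V ** (L ** f) = 0\<^sub>m N 1"
      by (simp add: mul_distribs) (metis add_uminus_minus_mat fc mul_carrier[OF V mul_carrier[OF L fc]])
    have "f = V ** (L ** f)" by (rule mat_diff_eq_0[OF e]) (rule carrier_matI; simp)+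
    then show "V ** L ** f = f" by (simp add: mul_assoc)
  next
    fix f assume "f \<in> fixed N (V ** L)"
    then have fc: "f \<in> mats N 1" and e: "V ** L ** f = f" by auto
    have "V ** (L ** f) \<in> M" by (rule VM, rule mul_carrier[OF L fc])
    then show "f \<in> M" using e dimD[OF fc] by (simp add: mul_assoc)
  qed
  then show ?thesis using V L LV HP by blast
qed

text \<open>For \<open>H\<close>-self-adjoint \<open>P\<close> the pairing of \<open>f\<close> with \<open>P m\<close> is that of \<open>P f\<close> with \<open>m\<close>.\<close>

lemma H_perp_eq_kernel:
  assumes H: "H \<in> mats N N" "ht_invertible t H" "H\<star> = H"
    and P: "P \<in> mats N N" "P ** P = P" and HP: "H ** P = P\<star> ** H"
  shows "H_perp t N H (fixed N P) = ker N P"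
proof -
  note [simp] = dimD[OF H(1)] dimD[OF P(1)]
  note i = ht_invD[OF H(2,1)]
  note [simp] = dimD[OF i(1)]
  have adj: "sform f (H ** (P ** m)) = sform (P ** f) (H ** m)"
    if f: "f \<in> mats N 1" and m: "m \<in> mats N 1" for f m
  proof -
    note [simp] = dimD[OF f] dimD[OF m]
    have "H ** (P ** m) = P\<star> ** (H ** m)" using mul_cancel_assoc[OF HP, of m] by (simp add: mul_assoc)
    moreover have "H ** m \<in> mats N 1" "P\<star> \<in> mats N N" by (rule carrier_matI; simp)+
    ultimately show ?thesis using sform_adj[OF f, of "H ** m" "P\<star>"] by simp
  qed
  have "P ** f = 0\<^sub>m N 1" if f: "f \<in> mats N 1"
    and z: "\<And>m. m \<in> mats N 1 \<Longrightarrow> P ** m = m \<Longrightarrow> sform f (H ** m) = 0" for f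
  proof (rule sform_nondegenerate)
    note [simp] = dimD[OF f]
    show "P ** f \<in> mats N 1" by (rule carrier_matI; simp)
    fix m :: "ht mat" assume m: "m \<in> mats N 1"
    note [simp] = dimD[OF m]
    have uc: "ht_inv t H ** m \<in> mats N 1" "P ** (ht_inv t H ** m) \<in> mats N 1"
      by (rule carrier_matI; simp)+
    have "sform f (H ** (P ** (ht_inv t H ** m))) = 0"
      by (rule z[OF uc(2)]) (simp add: mul_cancel_assoc[OF P(2)])
    then show "sform (P ** f) m = 0"
      unfolding adj[OF f uc(1)] by (simp add: mul_cancel_assoc[OF i(2)])
  qed
  moreover have "sform f (H ** m) = 0"
    if f: "f \<in> mats N 1" "P ** f = 0\<^sub>m N 1" and m: "m \<in> mats N 1" "P ** m = m" for f m
  proof -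
    have "sform f (H ** (P ** m)) = sform (0\<^sub>m N 1) (H ** m)" using adj[OF f(1) m(1)] f(2) by simp
    also have "\<dots> = 0" using dimD[OF m(1)] by (simp add: sform_def zero_prod_def)
    finally show ?thesis using m(2) by simp
  qed
  ultimately show ?thesis
    unfolding H_perp_def using H_form_eq_sform[OF H(1)] by auto
qed

lemma kernel_right_submodule:
  assumes P: "P \<in> mats N N"
  shows "right_submodule t N (ker N P)"
proof -
  note [simp] = dimD[OF P]
  show ?thesis
    unfolding right_submodule_def
    by (auto simp: right_scale_eq_mul mul_add_right simp flip: mul_assoc)
qed

lemma range_right_submodule:
  assumes P: "P \<in> mats N N"
  shows "right_submodule t N (fixed N P)"
proof -
  note [simp] = dimD[OF P]
  show ?thesis
    unfolding right_submodule_def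
    by (auto simp: right_scale_eq_mul mul_add_right simp flip: mul_assoc)
qed

lemma self_adjoint_range_nondegenerate:
  assumes H: "H \<in> mats N N" "ht_invertible t H" "H\<star> = H"
    and P: "P \<in> mats N N" "P ** P = P" and HP: "H ** P = P\<star> ** H"
  shows "H_nondegenerate t N H (fixed N P)"
  unfolding H_nondegenerate_def H_perp_eq_kernel[OF assms]
  using dimD[OF P(1)] by auto

lemma complementary_projection:
  assumes H: "H \<in> mats N N" "H\<star> = H"
    and P: "P \<in> mats N N" "P ** P = P" and HP: "H ** P = P\<star> ** H"
  shows "one N - P \<in> mats N N" "(one N - P) ** (one N - P) = one N - P"
    "H ** (one N - P) = (one N - P)\<star> ** H"
    "f \<in> mats N 1 \<Longrightarrow> (one N - P) ** f = f \<longleftrightarrow> P ** f = 0\<^sub>m N 1"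
proof -
  note [simp] = dimD[OF H(1)] dimD[OF P(1)]
  show "one N - P \<in> mats N N" by (rule carrier_matI; simp)
  show "(one N - P) ** (one N - P) = one N - P"
    by (simp add: mul_distribs P(2)) (rule eq_matI; simp)
  show "H ** (one N - P) = (one N - P)\<star> ** H"
    by (simp add: mul_distribs star_distribs HP)
  assume f: "f \<in> mats N 1"
  note [simp] = dimD[OF f]
  have e: "(one N - P) ** f = f - P ** f" by (simp add: mul_distribs)
  show "(one N - P) ** f = f \<longleftrightarrow> P ** f = 0\<^sub>m N 1"
  proof
    assume a: "(one N - P) ** f = f"
    show "P ** f = 0\<^sub>m N 1"
    proof (rule eq_matI, goal_cases)
      case (1 i j)
      then show ?case using arg_cong[OF a[unfolded e], of "\<lambda>M. M $$ (i, j)"] by simp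
    qed auto
  next
    assume "P ** f = 0\<^sub>m N 1"
    then show "(one N - P) ** f = f" unfolding e by (intro eq_matI) auto
  qed
qed

lemma projection_eqI:
  assumes P: "P \<in> mats N N" "P ** P = P" and Q: "Q \<in> mats N N"
    and r: "\<And>f. f \<in> mats N 1 \<Longrightarrow> P ** f = f \<Longrightarrow> Q ** f = f"
    and k: "\<And>f. f \<in> mats N 1 \<Longrightarrow> P ** f = 0\<^sub>m N 1 \<Longrightarrow> Q ** f = 0\<^sub>m N 1"
  shows "Q = P"
proof (rule mat_eq_by_columns[OF Q P(1)])
  fix h :: "ht mat" assume h: "h \<in> mats N 1"
  note [simp] = dimD[OF P(1)] dimD[OF Q] dimD[OF h]
  have "Q ** (P ** h) = P ** h" by (rule r) (auto simp: mul_cancel_assoc[OF P(2)])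
  moreover have "Q ** (h - P ** h) = 0\<^sub>m N 1"
    by (rule k) (auto simp: mul_distribs mul_cancel_assoc[OF P(2)])
  then have "Q ** h - Q ** (P ** h) = 0\<^sub>m N 1" by (simp add: mul_distribs)
  then have "Q ** h = Q ** (P ** h)" by (rule mat_diff_eq_0) (rule carrier_matI; simp)+
  ultimately show "Q ** h = P ** h" by simp
qed

text \<open>The orthogonal companion is non-degenerate too, so both have bases; together these are the columns
  of an invertible matrix with \<open>N\<close> rows and \<open>k1 + k2\<close> columns.\<close>

lemma nondegenerate_splitting:
  assumes H: "H \<in> mats N N" "ht_invertible t H" "H\<star> = H"
    and M: "right_submodule t N M" and nd: "H_nondegenerate t N H M"
  shows "\<exists>k1 k2 V1 L1 V2 L2. V1 \<in> mats N k1 \<and> L1 \<in> mats k1 N \<and> L1 ** V1 = one k1 \<and>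
    V2 \<in> mats N k2 \<and> L2 \<in> mats k2 N \<and> L2 ** V2 = one k2 \<and> k1 + k2 = N \<and>
    V1 ** L1 + V2 ** L2 = one N \<and> L1 ** V2 = 0\<^sub>m k1 k2 \<and> L2 ** V1 = 0\<^sub>m k2 k1 \<and>
    H ** (V1 ** L1) = (V1 ** L1)\<star> ** H \<and> M = fixed N (V1 ** L1)"
proof -
  obtain k1 V1 L1 where V1: "V1 \<in> mats N k1" and L1: "L1 \<in> mats k1 N"
    and LV1: "L1 ** V1 = one k1" and HP: "H ** (V1 ** L1) = (V1 ** L1)\<star> ** H"
    and M1: "M = fixed N (V1 ** L1)"
    using nondegenerate_submodule_basis[OF H(1,3) M nd] by blast
  note [simp] = dimD[OF H(1)] dimD[OF V1] dimD[OF L1]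
  define P where "P = V1 ** L1"
  have P: "P \<in> mats N N" "P ** P = P" "H ** P = P\<star> ** H"
    using HP unfolding P_def by (auto simp: mul_assoc mul_cancel_assoc[OF LV1])
  note [simp] = dimD[OF P(1)]
  note c = complementary_projection[OF H(1,3) P]
  let ?M2 = "ker N P"
  have M2: "?M2 = fixed N (one N - P)" using c(4) by blast
  have nd2: "H_nondegenerate t N H ?M2"
    unfolding M2 by (rule self_adjoint_range_nondegenerate[OF H c(1-3)])
  obtain k2 V2 L2 where V2: "V2 \<in> mats N k2" and L2: "L2 \<in> mats k2 N"
    and LV2: "L2 ** V2 = one k2" and HP2: "H ** (V2 ** L2) = (V2 ** L2)\<star> ** H"
    and M2': "?M2 = fixed N (V2 ** L2)"
    using nondegenerate_submodule_basis[OF H(1,3) kernel_right_submodule[OF P(1)] nd2] by blast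
  note [simp] = dimD[OF V2] dimD[OF L2]
  have P2: "V2 ** L2 \<in> mats N N" "V2 ** L2 ** (V2 ** L2) = V2 ** L2"
    by (auto simp: mul_assoc mul_cancel_assoc[OF LV2])
  have e: "one N - P = V2 ** L2"
  proof (rule projection_eqI[OF P2 c(1)])
    fix f :: "ht mat" assume f: "f \<in> mats N 1"
    show "(one N - P) ** f = f" if "V2 ** L2 ** f = f" using that M2 M2' f by blast
    assume "V2 ** L2 ** f = 0\<^sub>m N 1"
    then have "f \<in> H_perp t N H ?M2" unfolding M2' H_perp_eq_kernel[OF H P2 HP2] using f by blast
    then have "(one N - P) ** f = 0\<^sub>m N 1" unfolding M2 H_perp_eq_kernel[OF H c(1-3)] by blast
    then show "(one N - P) ** f = 0\<^sub>m N 1" .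
  qed
  have sum: "V1 ** L1 + V2 ** L2 = one N"
    unfolding P_def[symmetric] e[symmetric] by (rule eq_matI) simp_all
  have "P ** (one N - P) = 0\<^sub>m N N" "(one N - P) ** P = 0\<^sub>m N N"
    by (simp_all add: mul_distribs P(2)) (rule eq_matI; simp)+
  then have z: "V1 ** L1 ** (V2 ** L2) = 0\<^sub>m N N" "V2 ** L2 ** (V1 ** L1) = 0\<^sub>m N N"
    unfolding e unfolding P_def by auto
  have "L1 ** V2 = L1 ** (V1 ** L1 ** (V2 ** L2)) ** V2"
    by (simp add: mul_assoc mul_cancel_assoc[OF LV1] LV2)
  then have LV12: "L1 ** V2 = 0\<^sub>m k1 k2" unfolding z by simp
  have "L2 ** V1 = L2 ** (V2 ** L2 ** (V1 ** L1)) ** V1"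
    by (simp add: mul_assoc mul_cancel_assoc[OF LV2] LV1)
  then have LV21: "L2 ** V1 = 0\<^sub>m k2 k1" unfolding z by simp
  let ?X = "V1 ** (inl k1 k2)\<star> + V2 ** (inr k1 k2)\<star>"
  let ?Y = "inl k1 k2 ** L1 + inr k1 k2 ** L2"
  have X: "?X \<in> mats N (k1 + k2)" and Y: "?Y \<in> mats (k1 + k2) N"
    by (rule carrier_matI; simp)+
  have "?Y ** ?X = inl k1 k2 ** (inl k1 k2)\<star> + inr k1 k2 ** (inr k1 k2)\<star>"
    by (simp add: mul_distribs mul_assoc mul_cancel_assoc[OF LV1] mul_cancel_assoc[OF LV2]
        mul_cancel_assoc[OF LV12] mul_cancel_assoc[OF LV21]) (rule eq_matI; simp)
  then have YX: "?Y ** ?X = one (k1 + k2)" by (simp only: direct_sum_total)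
  have "?X ** ?Y = V1 ** L1 + V2 ** L2"
    by (simp add: mul_distribs mul_assoc) (rule eq_matI; simp)
  then have XY: "?X ** ?Y = one N" by (simp only: sum)
  have "k1 + k2 = N"
    using left_invertible_imp_le[OF X Y YX] left_invertible_imp_le[OF Y X XY] by simp
  then show ?thesis using V1 L1 LV1 V2 L2 LV2 sum LV12 LV21 HP M1 by blast
qed

section \<open>Compressions of minimal realizations\<close>

lemma intertwining_resolvent:
  assumes A: "A \<in> mats N N" and A': "A' \<in> mats k k" and V: "V \<in> mats N k"
    and AV: "A ** V = V ** A'"
    and inv: "regular A x" "regular A' x"
  shows "res A x ** V = V ** res A' x"
proof -
  note [simp] = dimD[OF A] dimD[OF A'] dimD[OF V]
    res_carrier(2-)[OF inv(1) A] res_carrier(2-)[OF inv(2) A']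
  have "res A x ** V = res A x ** V ** (res A' x - x *s (A' ** res A' x))"
    unfolding res_diff(1)[OF inv(2) A'] by simp
  also have "\<dots> = (res A x - x *s (res A x ** A)) ** V ** res A' x"
    by (simp add: mul_distribs mul_assoc mul_cancel_assoc[OF AV])
  also have "\<dots> = V ** res A' x"
    unfolding res_diff(2)[OF inv(1) A] by simp
  finally show ?thesis .
qed

lemma observableD:
  assumes C: "C \<in> mats n N" and A: "A \<in> mats N N" and "observable t n N C A"
    and h: "h \<in> mats N 1" "\<And>k. C ** mpow A k ** h = 0\<^sub>m n 1"
  shows "h = 0\<^sub>m N 1"
  using assms(3) h unfolding observable_iff[OF C A] by blast

lemma controllableI:
  assumes A: "A \<in> mats N N" and B: "B \<in> mats N n"
    and "\<And>h. h \<in> mats 1 N \<Longrightarrow> (\<And>k. h ** mpow A k ** B = 0\<^sub>m 1 n) \<Longrightarrow> h = 0\<^sub>m 1 N"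
  shows "controllable t n N A B"
proof -
  have "0\<^sub>m 1 N ** mpow A k ** B = 0\<^sub>m 1 n" for k
    using dimD[OF B] mpow_dim[OF A] by simp
  then show ?thesis unfolding controllable_def using assms(3) by blast
qed

lemma controllableD:
  assumes "controllable t n N A B" and h: "h \<in> mats 1 N" "\<And>k. h ** mpow A k ** B = 0\<^sub>m 1 n"
  shows "h = 0\<^sub>m 1 N"
  using assms unfolding controllable_def by blast

text \<open>The term \<open>Z C'\<close> in the intertwining relation vanishes on the unobservable part, so \<open>V\<close> maps
  unobservable vectors to unobservable vectors.\<close>

lemma observable_compression:
  assumes C: "C \<in> mats n N" and A: "A \<in> mats N N" and obs: "observable t n N C A"
    and V: "V \<in> mats N k" and L: "L \<in> mats k N" and LV: "L ** V = one k"
    and A': "A' \<in> mats k k" and C': "C' \<in> mats n k" and G: "G \<in> mats n n"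
    and CV: "C ** V = G ** C'" and Z: "Z \<in> mats N n" and AV: "A ** V = V ** A' + Z ** C'"
  shows "observable t n k C' A'"
proof (unfold observable_iff[OF C' A'], intro ballI impI)
  fix h :: "ht mat" assume h: "h \<in> mats k 1" and z: "\<forall>j. C' ** mpow A' j ** h = 0\<^sub>m n 1"
  note [simp] = dimD[OF C] dimD[OF A] dimD[OF V] dimD[OF L]
    dimD[OF A'] dimD[OF C'] dimD[OF G] dimD[OF Z] dimD[OF h]
    mpow_dim[OF A] mpow_dim[OF A']
  have z': "C' ** (mpow A' j ** h) = 0\<^sub>m n 1" for j using z by (simp add: mul_assoc)
  have CV': "C ** (V ** X) = G ** (C' ** X)" if "dim_row X = k" for X
    using that mul_cancel_assoc[OF CV, of X] by (simp add: mul_assoc)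
  have AV': "A ** (V ** X) = V ** (A' ** X) + Z ** (C' ** X)" if "dim_row X = k" for X
    using that mul_cancel_assoc[OF AV, of X] by (simp add: mul_assoc mul_distribs)
  have "C ** mpow A i ** (V ** (mpow A' j ** h)) = 0\<^sub>m n 1" for i j
  proof (induction i arbitrary: j)
    case 0
    show ?case by (simp add: CV' z')
  next
    case (Suc i)
    have "C ** mpow A (Suc i) ** (V ** (mpow A' j ** h)) =
        C ** mpow A i ** (V ** (A' ** (mpow A' j ** h))) + C ** (mpow A i ** (Z ** (C' ** (mpow A' j ** h))))"
      by (simp add: mul_assoc AV' mul_distribs)
    also have "A' ** (mpow A' j ** h) = mpow A' (Suc j) ** h"
      unfolding mpow_Suc_left[OF A'] by (simp add: mul_assoc)
    also have "C ** mpow A i ** (V ** (mpow A' (Suc j) ** h)) = 0\<^sub>m n 1" by (rule Suc)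
    finally show ?case unfolding z' by simp
  qed
  from this[of _ 0] have "V ** h = 0\<^sub>m N 1"
    by (intro observableD[OF C A obs]) (auto simp: mul_assoc)
  then have "L ** (V ** h) = 0\<^sub>m k 1" by simp
  then show "h = 0\<^sub>m k 1" by (simp add: mul_cancel_assoc[OF LV])
qed

text \<open>The dual of the preceding lemma, for uncontrollable row vectors.\<close>

lemma controllable_compression:
  assumes A: "A \<in> mats N N" and B: "B \<in> mats N n" and con: "controllable t n N A B"
    and V: "V \<in> mats N k" and L: "L \<in> mats k N" and LV: "L ** V = one k"
    and A': "A' \<in> mats k k" and B': "B' \<in> mats k n" and G: "G \<in> mats n n"
    and LB: "L ** B = B' ** G" and Z: "Z \<in> mats n N" and LA: "L ** A = A' ** L + B' ** Z"
  shows "controllable t n k A' B'"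
proof (rule controllableI[OF A' B'])
  fix h assume h: "h \<in> mats 1 k" and z: "\<And>j. h ** mpow A' j ** B' = 0\<^sub>m 1 n"
  note [simp] = dimD[OF A] dimD[OF B] dimD[OF V] dimD[OF L]
    dimD[OF A'] dimD[OF B'] dimD[OF G] dimD[OF Z] dimD[OF h]
    mpow_dim[OF A] mpow_dim[OF A']
  have "h ** mpow A' j ** L ** (mpow A i ** B) = 0\<^sub>m 1 n" for i j
  proof (induction i arbitrary: j)
    case 0
    have "h ** mpow A' j ** L ** B = h ** mpow A' j ** B' ** G" by (simp add: mul_assoc LB)
    then show ?case unfolding z by simp
  next
    case (Suc i)
    have "h ** mpow A' j ** L ** (mpow A (Suc i) ** B) = h ** mpow A' j ** (L ** A) ** (mpow A i ** B)"
      unfolding mpow_Suc_left[OF A] by (simp add: mul_assoc)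
    also have "\<dots> = h ** mpow A' (Suc j) ** L ** (mpow A i ** B) + h ** mpow A' j ** B' ** (Z ** (mpow A i ** B))"
      unfolding LA by (simp add: mul_assoc mul_distribs)
    also have "\<dots> = 0\<^sub>m 1 n" unfolding Suc z by simp
    finally show ?case .
  qed
  from this[of 0] have "h ** L = 0\<^sub>m 1 N"
    by (intro controllableD[OF con]) (auto simp: mul_assoc)
  then have "h ** L ** V = 0\<^sub>m 1 k" by simp
  then show "h = 0\<^sub>m 1 k" by (simp add: mul_assoc LV)
qed

subsection \<open>J-unitary functions\<close>

lemma J_unitary_near_0:
  assumes R: "rational_fun t n R" and "J_unitary_fun t J R"
  shows "\<forall>\<^sub>F x in nhds 0. the (R x) ** J ** (the (R (- x)))\<star> = J"
  using rational_near_0_dom[OF R] eventually_nhds_0_minus[OF rational_near_0_dom[OF R]]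
  by eventually_elim (use assms(2) in \<open>simp add: J_unitary_fun_def\<close>)

lemma J_unitary_funI:
  assumes R: "rational_fun t n R" and J: "J \<in> mats n n"
    and near: "\<forall>\<^sub>F x in nhds 0. the (R x) ** J ** (the (R (- x)))\<star> = J"
  shows "J_unitary_fun t J R"
  unfolding J_unitary_fun_def
proof (intro allI impI)
  fix x assume x: "x \<in> dom R \<and> - x \<in> dom R"
  have "realizable_at n (\<lambda>x. the (R x) ** J ** (the (R (- x)))\<star>) x"
    by (intro realizable_at_mult realizable_at_const[OF J] realizable_at_adjoint
        rational_realizable_at[OF R]) (use x in auto)
  from realizable_at_unique[OF this realizable_at_const[OF J] near]
  show "the (R x) ** J ** (the (R (- x)))\<star> = J" .
qed

lemma J_unitary_left_inverse:
  assumes J: "J \<in> mats n n" "J ** J = one n" and F: "F \<in> mats n n" and f: "f \<in> mats n n"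
    and "F ** J ** f\<star> = J"
  shows "J ** f\<star> ** J ** F = one n"
proof -
  note [simp] = dimD[OF J(1)] dimD[OF F] dimD[OF f]
  have "F ** (J ** f\<star> ** J) = F ** J ** f\<star> ** J" by (simp add: mul_assoc)
  also have "\<dots> = one n" by (simp add: assms)
  finally show ?thesis by (intro one_sided_inverse[OF F, rotated]) (auto simp: carrier_matI)
qed

text \<open>Here \<open>F\<^sub>j\<close> and \<open>f\<^sub>j\<close> are the values of the two factors at opposite points.  With \<open>g\<^sub>j = J f\<^sub>j\<star> J\<close> the
  hypotheses say \<open>F\<^sub>1 F\<^sub>2 g\<^sub>2 g\<^sub>1 = 1\<close> and \<open>g\<^sub>1 F\<^sub>1 F\<^sub>2 = F\<^sub>2\<close>; together they give \<open>g\<^sub>1 = F\<^sub>2 g\<^sub>2 g\<^sub>1\<close>.\<close>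

lemma J_unitary_factors:
  assumes J: "J \<in> mats n n" "J ** J = one n"
    and F: "F1 \<in> mats n n" "F2 \<in> mats n n" "f1 \<in> mats n n" "f2 \<in> mats n n"
    and prod: "(F1 ** F2) ** J ** (f1 ** f2)\<star> = J" and left: "J ** f1\<star> ** J ** (F1 ** F2) = F2"
  shows "F1 ** J ** f1\<star> = J" "F2 ** J ** f2\<star> = J"
proof -
  note [simp] = dimD[OF J(1)] F[THEN dimD(1)] F[THEN dimD(2)]
  note cJ = mul_cancel_assoc[OF J(2)]
  define g1 where "g1 = J ** f1\<star> ** J"
  define g2 where "g2 = J ** f2\<star> ** J"
  have [simp]: "dim_row g1 = n" "dim_col g1 = n" "dim_row g2 = n" "dim_col g2 = n"
    by (simp_all add: g1_def g2_def)
  have "F1 ** F2 ** (g2 ** g1) = (F1 ** F2) ** J ** (f1 ** f2)\<star> ** J"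
    by (simp add: g1_def g2_def mul_assoc cJ star_mul)
  then have W: "F1 ** F2 ** (g2 ** g1) = one n" unfolding prod by (simp add: J)
  have "g1 = g1 ** (F1 ** F2 ** (g2 ** g1))" unfolding W by simp
  also have "\<dots> = J ** f1\<star> ** J ** (F1 ** F2) ** (g2 ** g1)" by (simp add: g1_def mul_assoc)
  also have "\<dots> = F2 ** (g2 ** g1)" unfolding left ..
  finally have g1: "F2 ** (g2 ** g1) = g1" by simp
  have 1: "F1 ** g1 = one n" using W by (simp add: mul_assoc g1)
  have "F1 ** J ** f1\<star> = F1 ** g1 ** J" by (simp add: g1_def mul_assoc J)
  then show "F1 ** J ** f1\<star> = J" unfolding 1 by simp
  have 2: "g1 ** F1 = one n" by (rule one_sided_inverse[OF _ _ 1]) (rule carrier_matI; simp)+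
  have "F2 ** g2 = F2 ** (g2 ** g1) ** F1" by (simp add: mul_assoc 2)
  also have "\<dots> = one n" unfolding g1 by (rule 2)
  finally have 3: "F2 ** g2 = one n" .
  have "F2 ** J ** f2\<star> = F2 ** g2 ** J" by (simp add: g2_def mul_assoc J)
  then show "F2 ** J ** f2\<star> = J" unfolding 3 by simp
qed

end

section \<open>Supporting projections\<close>

text \<open>The assumption \<open>input\<close> is the formula for \<open>B\<close> in terms of \<open>H\<close>, multiplied by \<open>H\<close>.\<close>

locale J_unitary_realization = ht_algebra +
  fixes n N :: nat and J C A B H D1 D2 :: "ht mat"
  assumes J: "J \<in> mats n n" "J\<star> = J" "J ** J = one n"
    and C: "C \<in> mats n N" and A: "A \<in> mats N N" and B: "B \<in> mats N n"
    and obs: "observable t n N C A" and con: "controllable t n N A B"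
    and H: "H \<in> mats N N" "ht_invertible t H" "H\<star> = H"
    and lyapunov: "A\<star> ** H + H ** A = - (C\<star> ** J ** C)"
    and input: "H ** B = - (C\<star> ** J ** (D1 ** D2))"
    and D1: "D1 \<in> mats n n" "D1 ** J ** D1\<star> = J"
    and D2: "D2 \<in> mats n n" "D2 ** J ** D2\<star> = J"
begin

lemmas dims [simp] = J(1)[THEN dimD(1)] J(1)[THEN dimD(2)] dimD[OF C]
  dimD[OF A] dimD[OF B] dimD[OF H(1)] dimD[OF D1(1)] dimD[OF D2(1)]

definition G1 :: "ht mat" where "G1 = J ** D1\<star> ** J"
definition G2 :: "ht mat" where "G2 = J ** D2\<star> ** J"

lemma G_dims [simp]: "dim_row G1 = n" "dim_col G1 = n" "dim_row G2 = n" "dim_col G2 = n"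
  by (simp_all add: G1_def G2_def)

lemma D_inverse: "D1 ** G1 = one n" "G1 ** D1 = one n" "D2 ** G2 = one n" "G2 ** D2 = one n"
proof -
  have "D1 ** G1 = D1 ** J ** D1\<star> ** J" by (simp add: G1_def mul_assoc)
  then show 1: "D1 ** G1 = one n" by (simp add: D1 J)
  have "D2 ** G2 = D2 ** J ** D2\<star> ** J" by (simp add: G2_def mul_assoc)
  then show 2: "D2 ** G2 = one n" by (simp add: D2 J)
  show "G1 ** D1 = one n" by (rule one_sided_inverse[OF _ _ 1]) (rule carrier_matI; simp)+
  show "G2 ** D2 = one n" by (rule one_sided_inverse[OF _ _ 2]) (rule carrier_matI; simp)+
qed

lemmas D_inverse_assoc = D_inverse[THEN mul_cancel_assoc]

lemma ht_inv_D: "ht_inv t D1 = G1" "ht_inv t D2 = G2"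
  by (rule ht_inv_eq, rule ht_inverse_ofI[of _ n], auto simp: D_inverse)+

text \<open>This is \<open>B D\<inverse> C\<close>.\<close>

abbreviation Y :: "ht mat" where "Y \<equiv> B ** (G2 ** (G1 ** C))"

text \<open>In other words, \<open>B D\<inverse> C\<close> is the sum of \<open>A\<close> and its \<open>H\<close>-adjoint \<open>H\<inverse> A\<star> H\<close>.\<close>

lemma H_Y: "H ** Y = A\<star> ** H + H ** A"
proof -
  have "H ** Y = H ** B ** (G2 ** (G1 ** C))" by (simp add: mul_assoc)
  also have "\<dots> = - (C\<star> ** J ** C)"
    unfolding input by (simp add: mul_distribs mul_assoc D_inverse_assoc)
  finally show ?thesis using lyapunov by simp
qed

lemma H_A: "H ** A = H ** Y - A\<star> ** H"
  unfolding H_Y by (rule eq_matI) simp_all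

lemma Y_star_H: "Y\<star> ** H = H ** Y"
proof -
  have "Y\<star> ** H = (H ** Y)\<star>" by (simp add: star_mul[of H Y] H(3))
  also have "\<dots> = H ** A + A\<star> ** H" unfolding H_Y by (simp add: star_distribs H(3))
  also have "\<dots> = H ** Y" unfolding H_Y by (rule eq_matI) simp_all
  finally show ?thesis .
qed

lemma H_cancel:
  assumes "P \<in> mats N b" "Q \<in> mats N b" "H ** P = H ** Q"
  shows "P = Q"
proof -
  note i = ht_invD[OF H(2,1)]
  note [simp] = dimD[OF assms(1)] dimD[OF assms(2)] dimD[OF i(1)]
  have "P = ht_inv t H ** (H ** P)" by (simp add: mul_cancel_assoc[OF i(3)])
  also have "\<dots> = Q" unfolding assms(3) by (simp add: mul_cancel_assoc[OF i(3)])
  finally show ?thesis .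
qed

text \<open>The supporting projections of the factorizations of \<open>R\<close> solve this Riccati equation.\<close>

definition supporting :: "ht mat \<Rightarrow> bool" where
  "supporting P \<longleftrightarrow> P \<in> mats N N \<and> P ** A - A ** P = P ** Y ** (one N - P)"

text \<open>Invariance gives \<open>P A - A P = P A (1 - P)\<close>.  Here \<open>A\<close> may be replaced by \<open>B D\<inverse> C\<close>: the difference
  is up to sign the \<open>H\<close>-adjoint of \<open>A\<close>, which leaves the kernel of the self-adjoint \<open>P\<close> invariant.\<close>

lemma supporting_of_invariant:
  assumes P: "P \<in> mats N N" and HP: "H ** P = P\<star> ** H" and inv: "P ** A ** P = A ** P"
  shows "supporting P"
proof -
  note [simp] = dimD[OF P]
  have inv': "P ** (A ** P) = A ** P" using inv by (simp add: mul_assoc)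
  have s1: "P\<star> ** (A\<star> ** P\<star>) = P\<star> ** A\<star>"
    using arg_cong[OF inv, of ht_star_mat] by (simp add: star_mul mul_assoc)
  have HPX: "H ** (P ** X) = P\<star> ** (H ** X)" if "dim_row X = N" for X
    using mul_cancel_assoc[OF HP, of X] that by (simp add: mul_assoc)
  have HAX: "H ** (A ** X) = H ** (Y ** X) - A\<star> ** (H ** X)" if "dim_row X = N" for X
    using mul_cancel_assoc[OF H_A, of X] that by (simp add: mul_distribs mul_assoc)
  have s2: "P\<star> ** (A\<star> ** (P\<star> ** H)) = P\<star> ** (A\<star> ** H)"
    using mul_cancel_assoc[OF s1, of H] by (simp add: mul_assoc)
  have "P ** A - A ** P = P ** A - P ** (A ** P)" by (simp add: inv')
  also have "\<dots> = P ** Y ** (one N - P)"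
  proof (rule H_cancel[of _ N])
    have "H ** (P ** A - P ** (A ** P)) = P\<star> ** (H ** A) - P\<star> ** (H ** (A ** P))"
      by (simp add: mul_distribs HPX)
    also have "\<dots> = P\<star> ** (H ** Y) - P\<star> ** (H ** (Y ** P))"
      unfolding H_A
      by (simp add: mul_distribs HAX HP s2) (rule eq_matI; simp)
    also have "\<dots> = H ** (P ** Y ** (one N - P))"
      by (simp add: mul_distribs HPX mul_assoc)
    finally show "H ** (P ** A - P ** (A ** P)) = H ** (P ** Y ** (one N - P))" .
  qed (rule carrier_matI; simp)+
  finally show ?thesis using P unfolding supporting_def by simp
qed

text \<open>The right-hand side of the Riccati equation depends on \<open>C P\<close> and \<open>P B\<close> only, so the difference of two
  solutions commutes with \<open>A\<close>; as \<open>C\<close> annihilates it, it is zero by observability.\<close>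

lemma supporting_unique:
  assumes P: "supporting P" and Q: "supporting Q" and CPQ: "C ** P = C ** Q" and PQB: "P ** B = Q ** B"
  shows "P = Q"
proof -
  have Pc: "P \<in> mats N N" and Qc: "Q \<in> mats N N"
    using P Q by (auto simp: supporting_def)
  note [simp] = dimD[OF Pc] dimD[OF Qc]
  have "P ** Y ** (one N - P) = P ** B ** (G2 ** (G1 ** C)) - P ** B ** (G2 ** (G1 ** (C ** P)))"
    by (simp add: mul_distribs mul_assoc)
  also have "\<dots> = Q ** Y ** (one N - Q)"
    unfolding CPQ PQB by (simp add: mul_distribs mul_assoc)
  finally have e: "P ** A - A ** P = Q ** A - A ** Q"
    using P Q unfolding supporting_def by simp
  let ?W = "P - Q"
  have W: "A ** ?W = ?W ** A"
  proof (simp add: mul_distribs, rule eq_matI, goal_cases)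
    case (1 i j)
    then show ?case using arg_cong[OF e, of "\<lambda>M. M $$ (i, j)"] by (simp add: algebra_simps)
  qed auto
  have CW: "C ** ?W = 0\<^sub>m n N" by (simp add: mul_distribs CPQ) (rule eq_matI; simp)
  note [simp] = mpow_dim[OF A]
  have WA: "mpow A k ** ?W = ?W ** mpow A k" for k
  proof (induction k)
    case (Suc k)
    have "mpow A (Suc k) ** ?W = mpow A k ** (?W ** A)" by (simp add: mul_assoc W)
    also have "\<dots> = mpow A k ** ?W ** A" by (simp add: mul_assoc)
    also have "\<dots> = ?W ** mpow A (Suc k)" unfolding Suc by (simp add: mul_assoc)
    finally show ?case .
  qed simp
  have "?W = 0\<^sub>m N N"
  proof (rule observable_cancel[OF C A obs, of _ N])
    fix k
    have "C ** mpow A k ** ?W = C ** ?W ** mpow A k" by (simp add: mul_assoc WA)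
    then show "C ** mpow A k ** ?W = C ** mpow A k ** 0\<^sub>m N N" unfolding CW by simp
  qed (rule carrier_matI; simp)+
  then show ?thesis by (rule mat_diff_eq_0[OF _ Pc Qc])
qed

text \<open>The Riccati equation is invariant under \<open>H\<close>-adjoints, because \<open>B D\<inverse> C\<close> is self-adjoint and is the sum
  of \<open>A\<close> and its adjoint.\<close>

lemma supporting_adjoint:
  assumes P: "supporting P" and Q: "Q \<in> mats N N" and HQ: "H ** Q = P\<star> ** H"
  shows "supporting Q"
proof -
  have Pc: "P \<in> mats N N" and e: "P ** A - A ** P = P ** Y ** (one N - P)"
    using P by (auto simp: supporting_def)
  note [simp] = dimD[OF Pc] dimD[OF Q]
  have HQX: "H ** (Q ** X) = P\<star> ** (H ** X)" if "dim_row X = N" for X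
    using mul_cancel_assoc[OF HQ, of X] that by (simp add: mul_assoc)
  have HAX: "H ** (A ** X) = H ** (Y ** X) - A\<star> ** (H ** X)" if "dim_row X = N" for X
    using mul_cancel_assoc[OF H_A, of X] that by (simp add: mul_distribs mul_assoc)
  have YHX: "Y\<star> ** (H ** X) = H ** (Y ** X)" if "dim_row X = N" for X
    using mul_cancel_assoc[OF Y_star_H, of X] that by (simp add: mul_assoc)
  have expand: "(P ** Z ** (one N - P))\<star> ** H = Z\<star> ** (P\<star> ** H) - P\<star> ** (Z\<star> ** (P\<star> ** H))"
    if "dim_row Z = N" "dim_col Z = N" for Z
    using that by (simp add: star_distribs mul_distribs mul_assoc)
  have "(P ** A - A ** P)\<star> ** H = (P ** Y ** (one N - P))\<star> ** H" by (simp only: e)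
  moreover have "(P ** A - A ** P)\<star> ** H = A\<star> ** (P\<star> ** H) - P\<star> ** (A\<star> ** H)"
    by (simp add: star_distribs mul_distribs mul_assoc)
  moreover have "(P ** Y ** (one N - P))\<star> ** H = Y\<star> ** (P\<star> ** H) - P\<star> ** (Y\<star> ** (P\<star> ** H))"
    by (rule expand) simp_all
  ultimately have s: "A\<star> ** (P\<star> ** H) - P\<star> ** (A\<star> ** H) = H ** (Y ** Q) - P\<star> ** (H ** (Y ** Q))"
    by (simp add: YHX flip: HQ)
  have "Q ** A - A ** Q = Q ** Y ** (one N - Q)"
  proof (rule H_cancel[of _ N])
    have "H ** (Q ** A - A ** Q) = P\<star> ** (H ** A) - H ** (A ** Q)"
      by (simp add: mul_distribs HQX)
    also have "\<dots> = P\<star> ** (H ** Y) - H ** (Y ** Q) + (A\<star> ** (P\<star> ** H) - P\<star> ** (A\<star> ** H))"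
      unfolding H_A by (simp add: mul_distribs HAX HQ) (rule eq_matI; simp)
    also have "\<dots> = P\<star> ** (H ** Y) - P\<star> ** (H ** (Y ** Q))"
      unfolding s by (rule eq_matI) simp_all
    also have "\<dots> = H ** (Q ** Y ** (one N - Q))"
      by (simp add: mul_distribs HQX mul_assoc)
    finally show "H ** (Q ** A - A ** Q) = H ** (Q ** Y ** (one N - Q))" .
  qed (rule carrier_matI; simp)+
  then show ?thesis using Q by (simp add: supporting_def)
qed

text \<open>Up to invertible factors \<open>B\<close> is the \<open>H\<close>-adjoint of \<open>C\<close>.\<close>

lemma adjoint_input_eq:
  assumes P: "P \<in> mats N N" and Q: "Q \<in> mats N N" and HQ: "H ** Q = P\<star> ** H"
    and CPQ: "C ** P = C ** Q"
  shows "P ** B = Q ** B"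
proof (rule H_cancel[of _ n])
  note [simp] = dimD[OF P] dimD[OF Q]
  have HP: "H ** P = Q\<star> ** H"
    using arg_cong[OF HQ, of ht_star_mat] by (simp add: star_mul H(3))
  have "H ** (P ** B) = Q\<star> ** (H ** B)" using mul_cancel_assoc[OF HP, of B] by (simp add: mul_assoc)
  also have "\<dots> = - ((C ** Q)\<star> ** (J ** (D1 ** D2)))"
    unfolding input by (simp add: star_mul mul_distribs mul_assoc)
  also have "\<dots> = P\<star> ** (H ** B)"
    unfolding input CPQ[symmetric] by (simp add: star_mul mul_distribs mul_assoc)
  also have "\<dots> = H ** (Q ** B)" using mul_cancel_assoc[OF HQ, of B] by (simp add: mul_assoc)
  finally show "H ** (P ** B) = H ** (Q ** B)" .
qed (rule carrier_matI; simp add: dimD[OF P] dimD[OF Q])+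

abbreviation R0 :: "real \<Rightarrow> ht mat" where "R0 x \<equiv> tf (D1 ** D2) C A B x"
abbreviation left_factor :: "ht mat \<Rightarrow> real \<Rightarrow> ht mat" where
  "left_factor P x \<equiv> tf D1 C A (P ** B ** G2) x"
abbreviation right_factor :: "ht mat \<Rightarrow> real \<Rightarrow> ht mat" where
  "right_factor P x \<equiv> tf D2 (G1 ** C ** (one N - P)) A B x"

text \<open>In the product of the transfer functions the quadratic term contains
  \<open>r (P A - A P) r\<close>, where \<open>r\<close> is the resolvent, and \<open>x r (P A - A P) r = P r - r P\<close>.\<close>

lemma supporting_factorization:
  assumes P: "supporting P" and inv: "regular A x"
  shows "left_factor P x ** right_factor P x = R0 x"
proof -
  have Pc: "P \<in> mats N N" and e: "P ** A - A ** P = P ** Y ** (one N - P)"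
    using P by (auto simp: supporting_def)
  let ?r = "res A x"
  note [simp] = dimD[OF Pc] res_carrier(2-)[OF inv A]
  have "x *s (?r ** (P ** Y ** (one N - P)) ** ?r) = ?r ** P ** (x *s (A ** ?r)) - (x *s (?r ** A)) ** P ** ?r"
    unfolding e[symmetric] by (simp add: mul_distribs mul_assoc) (rule eq_matI; simp add: algebra_simps)
  also have "x *s (A ** ?r) = ?r - one N"
    using res_diff(1)[OF inv A] by (intro eq_matI) (auto simp flip: res_diff(1)[OF inv A])
  also have "x *s (?r ** A) = ?r - one N"
    by (intro eq_matI) (auto simp flip: res_diff(2)[OF inv A])
  also have "?r ** P ** (?r - one N) - (?r - one N) ** P ** ?r = P ** ?r - ?r ** P"
    by (simp add: mul_distribs mul_assoc) (rule eq_matI; simp)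
  finally have k: "x *s (?r ** (P ** Y ** (one N - P)) ** ?r) = P ** ?r - ?r ** P" .
  have "left_factor P x ** right_factor P x = D1 ** D2 + x *s (C ** ?r ** P ** B) + x *s (C ** (one N - P) ** ?r ** B)
      + x *s (C ** (x *s (?r ** (P ** Y ** (one N - P)) ** ?r)) ** B)"
    unfolding tf_eq
    by (simp add: mul_distribs mul_assoc D_inverse_assoc D_inverse) (rule eq_matI; simp add: algebra_simps)
  also have "\<dots> = R0 x"
    unfolding tf_eq k by (simp add: mul_distribs mul_assoc) (rule eq_matI; simp add: algebra_simps)
  finally show ?thesis .
qed

text \<open>The Lyapunov equation collapses the product of \<open>((1 + x A)\<inverse>)\<star> C\<star> J\<close> with \<open>R(x)\<close> to
  \<open>- H (1 - x A)\<inverse> B\<close>.\<close>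

lemma adjoint_left_factor:
  assumes P: "P \<in> mats N N" and Q: "Q \<in> mats N N" and HQ: "H ** Q = P\<star> ** H"
    and inv: "regular A x" "regular A (- x)"
  shows "J ** (left_factor P (- x))\<star> ** J ** R0 x = right_factor Q x"
proof -
  let ?r = "res A x" let ?s = "res A (- x)"
  note [simp] = dimD[OF P] dimD[OF Q] res_carrier(2-)[OF inv(1) A] res_carrier(2-)[OF inv(2) A]
  have r: "x *s (A ** ?r) = ?r - one N"
    by (intro eq_matI) (auto simp flip: res_diff(1)[OF inv(1) A])
  have "(?s - (- x) *s (A ** ?s))\<star> = one N" by (simp only: res_diff(1)[OF inv(2) A] star_one)
  then have "?s\<star> + x *s (?s\<star> ** A\<star>) = one N"
    by (simp add: star_distribs) (simp add: mat_eq_iff)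
  then have s: "x *s (?s\<star> ** A\<star>) = one N - ?s\<star>"
    by (intro eq_matI) (auto simp flip: \<open>?s\<star> + x *s (?s\<star> ** A\<star>) = one N\<close>)
  have "?s\<star> ** (C\<star> ** (J ** R0 x)) = ?s\<star> ** (C\<star> ** J ** (D1 ** D2)) + x *s (?s\<star> ** (C\<star> ** J ** C) ** ?r ** B)"
    unfolding tf_eq by (simp add: mul_distribs mul_assoc)
  also have "C\<star> ** J ** (D1 ** D2) = - (H ** B)" unfolding input by (rule eq_matI) simp_all
  also have "C\<star> ** J ** C = - (A\<star> ** H + H ** A)" unfolding lyapunov by (rule eq_matI) simp_all
  also have "x *s (?s\<star> ** - (A\<star> ** H + H ** A) ** ?r ** B) =
      - ((x *s (?s\<star> ** A\<star>)) ** (H ** ?r ** B) + ?s\<star> ** H ** (x *s (A ** ?r)) ** B)"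
    by (simp add: mul_distribs mul_assoc) (rule eq_matI; simp add: algebra_simps)
  also have "?s\<star> ** - (H ** B) + \<dots> = - (H ** (?r ** B))"
    unfolding r s by (simp add: mul_distribs mul_assoc) (rule eq_matI; simp add: algebra_simps)
  finally have key: "?s\<star> ** (C\<star> ** (J ** R0 x)) = - (H ** (?r ** B))" .
  have R0d: "dim_row (R0 x) = n" "dim_col (R0 x) = n" by (simp_all add: tf_eq)
  have BH: "B\<star> ** H = - (D2\<star> ** (D1\<star> ** (J ** C)))"
    using arg_cong[OF input, of ht_star_mat] by (simp add: star_distribs H(3) J(2) mul_assoc)
  have GD: "G2\<star> ** D2\<star> = one n" using arg_cong[OF D_inverse(3), of ht_star_mat] by (simp add: star_mul)
  have JBH: "J ** (G2\<star> ** (B\<star> ** H)) = - (G1 ** C)"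
    unfolding BH by (simp add: mul_distribs mul_cancel_assoc[OF GD] G1_def mul_assoc)
  have BHX: "J ** (G2\<star> ** (B\<star> ** (H ** X))) = - (G1 ** (C ** X))" if "dim_row X = N" for X
  proof -
    have "J ** (G2\<star> ** (B\<star> ** (H ** X))) = J ** (G2\<star> ** (B\<star> ** H)) ** X"
      using that by (simp add: mul_assoc)
    also have "\<dots> = - (G1 ** (C ** X))" unfolding JBH using that by (simp add: mul_distribs mul_assoc)
    finally show ?thesis .
  qed
  have "J ** (left_factor P (- x))\<star> ** J ** R0 x = G1 ** R0 x
      - x *s (J ** (G2\<star> ** (B\<star> ** (P\<star> ** (?s\<star> ** (C\<star> ** (J ** R0 x)))))))"
    unfolding tf_eq[of D1] G1_def using R0d
    by (simp add: star_distribs mul_distribs mul_assoc) (rule eq_matI; simp)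
  also have "\<dots> = G1 ** R0 x + x *s (J ** (G2\<star> ** (B\<star> ** (H ** (Q ** (?r ** B))))))"
    unfolding key using R0d mul_cancel_assoc[OF HQ, of "?r ** B"]
    by (simp add: mul_distribs mul_assoc) (rule eq_matI; simp)
  also have "\<dots> = right_factor Q x"
    unfolding tf_eq
    by (simp add: BHX mul_distribs mul_assoc D_inverse_assoc) (rule eq_matI; simp add: algebra_simps)
  finally show ?thesis .
qed

end

section \<open>The correspondence\<close>

locale factorization_problem = J_unitary_realization +
  fixes R :: "real \<rightharpoonup> ht mat"
  assumes R: "rational_fun t n R" and R_real: "is_realization t n R N (D1 ** D2) C A B"
    and R_unitary: "J_unitary_fun t J R"
begin

abbreviation factorizations :: "((real \<rightharpoonup> ht mat) \<times> (real \<rightharpoonup> ht mat)) set" where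
  "factorizations \<equiv> J_unitary_minimal_factorizations t n J R D1 D2"

abbreviation subspaces :: "ht mat set set" where
  "subspaces \<equiv> nondegenerate_invariant_subspaces t N A H"

abbreviation supp :: "(real \<rightharpoonup> ht mat) \<Rightarrow> (real \<rightharpoonup> ht mat) \<Rightarrow> ht mat set \<Rightarrow> bool" where
  "supp \<equiv> supported_by t n N C A B H D1 D2"

lemma R_near_0: "\<forall>\<^sub>F x in nhds 0. the (R x) = R0 x"
  using rational_near_0[OF R R_real] by eventually_elim simp

lemma left_sys: "P \<in> mats N N \<Longrightarrow> is_sys n N D1 C A (P ** B ** G2)"
  and right_sys: "P \<in> mats N N \<Longrightarrow> is_sys n N D2 (G1 ** C ** (one N - P)) A B"
  and R0_sys: "is_sys n N (D1 ** D2) C A B"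
  by (auto simp: is_sys_def)

text \<open>By observability a left factor determines \<open>P B\<close>, and by controllability a right factor
  determines \<open>C P\<close>.\<close>

lemma left_factor_near_0_eq:
  assumes P: "P \<in> mats N N" and Q: "Q \<in> mats N N"
    and eq: "\<forall>\<^sub>F x in nhds 0. left_factor P x = left_factor Q x"
  shows "P ** B = Q ** B"
proof -
  note [simp] = dimD[OF P] dimD[OF Q] mpow_dim[OF A]
  note mk = markov_eq_of_tf_eq(2)[OF left_sys[OF P] left_sys[OF Q] eq]
  have "P ** B ** G2 = Q ** B ** G2"
    by (rule observable_cancel[OF C A obs _ _ mk]) (rule carrier_matI; simp)+
  then have "P ** B ** G2 ** D2 = Q ** B ** G2 ** D2" by simp
  then show ?thesis by (simp add: mul_assoc D_inverse)
qed

lemma right_factor_near_0_eq: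
  assumes P: "P \<in> mats N N" and Q: "Q \<in> mats N N"
    and eq: "\<forall>\<^sub>F x in nhds 0. right_factor P x = right_factor Q x"
  shows "C ** P = C ** Q"
proof -
  note [simp] = dimD[OF P] dimD[OF Q] mpow_dim[OF A]
  note mk = markov_eq_of_tf_eq(2)[OF right_sys[OF P] right_sys[OF Q] eq]
  have "G1 ** C ** (one N - P) = G1 ** C ** (one N - Q)"
    by (rule controllable_cancel[OF A B con _ _ mk]) (rule carrier_matI; simp)+
  then have "D1 ** (G1 ** C ** (one N - P)) = D1 ** (G1 ** C ** (one N - Q))" by simp
  then have e: "C - C ** P = C - C ** Q" by (simp add: mul_assoc D_inverse_assoc mul_distribs)
  show ?thesis
  proof (rule eq_matI, goal_cases)
    case (1 i j)
    then show ?case using arg_cong[OF e, of "\<lambda>M. M $$ (i, j)"] by simp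
  qed auto
qed

lemma supporting_projection_of_subspace:
  assumes M: "M \<in> subspaces"
  shows "\<exists>P. P \<in> mats N N \<and> P ** P = P \<and> H ** P = P\<star> ** H \<and> supporting P \<and>
    M = fixed N P \<and> (\<forall>P'. is_H_projection t N H M P' \<longleftrightarrow> P' = P)"
proof -
  have M': "right_submodule t N M" "H_nondegenerate t N H M" "\<And>f. f \<in> M \<Longrightarrow> A ** f \<in> M"
    using M unfolding nondegenerate_invariant_subspaces_def by auto
  obtain k V L where V: "V \<in> mats N k" and L: "L \<in> mats k N" and LV: "L ** V = one k"
    and HP: "H ** (V ** L) = (V ** L)\<star> ** H" and Meq: "M = fixed N (V ** L)"
    using nondegenerate_submodule_basis[OF H(1,3) M'(1,2)] by blast
  define P where "P = V ** L"
  note [simp] = dimD[OF V] dimD[OF L]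
  have P: "P \<in> mats N N" "P ** P = P" "H ** P = P\<star> ** H"
    using HP unfolding P_def by (auto simp: mul_assoc mul_cancel_assoc[OF LV])
  note [simp] = dimD[OF P(1)]
  have MP: "M = fixed N P" using Meq unfolding P_def .
  have perp: "H_perp t N H M = ker N P"
    unfolding MP by (rule H_perp_eq_kernel[OF H P])
  have "P ** A ** P = A ** P"
  proof (rule mat_eq_by_columns)
    fix h :: "ht mat" assume h: "h \<in> mats N 1"
    note [simp] = dimD[OF h]
    have "P ** h \<in> M" unfolding MP by (auto simp: mul_cancel_assoc[OF P(2)])
    then have "A ** (P ** h) \<in> M" by (rule M'(3))
    then have "P ** (A ** (P ** h)) = A ** (P ** h)" unfolding MP by blast
    then show "P ** A ** P ** h = A ** P ** h" by (simp add: mul_assoc)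
  qed (rule carrier_matI; simp)+
  then have sup: "supporting P" by (rule supporting_of_invariant[OF P(1,3)])
  have "is_H_projection t N H M P' \<longleftrightarrow> P' = P" for P'
  proof
    assume "is_H_projection t N H M P'"
    then have a: "P' \<in> mats N N" "\<And>f. f \<in> M \<Longrightarrow> P' ** f = f"
      "\<And>f. f \<in> H_perp t N H M \<Longrightarrow> P' ** f = 0\<^sub>m N 1"
      unfolding is_H_projection_def by auto
    show "P' = P"
      by (rule projection_eqI[OF P(1,2) a(1)]) (use a(2,3) MP perp in blast)+
  next
    assume "P' = P"
    then show "is_H_projection t N H M P'"
      unfolding is_H_projection_def perp using P(1) MP by blast
  qed
  with P sup MP show ?thesis by blast
qed

lemma supp_near_0:
  assumes M: "M \<in> subspaces" and R12: "rational_fun t n R1" "rational_fun t n R2"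
    and s: "supp R1 R2 M" and P: "\<forall>P'. is_H_projection t N H M P' \<longleftrightarrow> P' = P"
  shows "\<forall>\<^sub>F x in nhds 0. R1 x = Some (left_factor P x)" "\<forall>\<^sub>F x in nhds 0. R2 x = Some (right_factor P x)"
proof -
  have "is_realization t n R1 N D1 C A (P ** B ** G2)"
    "is_realization t n R2 N D2 (G1 ** C ** (one N - P)) A B"
    using s P unfolding supported_by_def ht_inv_D by auto
  then show "\<forall>\<^sub>F x in nhds 0. R1 x = Some (left_factor P x)"
    "\<forall>\<^sub>F x in nhds 0. R2 x = Some (right_factor P x)"
    using rational_near_0 R12 by blast+
qed

lemma factorizationsD:
  assumes "(R1, R2) \<in> factorizations"
  shows "rational_fun t n R1" "rational_fun t n R2" "J_unitary_fun t J R1" "J_unitary_fun t J R2"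
    "R1 0 = Some D1" "R2 0 = Some D2"
    "\<And>x. x \<in> dom R \<Longrightarrow> x \<in> dom R1 \<Longrightarrow> x \<in> dom R2 \<Longrightarrow> the (R x) = the (R1 x) ** the (R2 x)"
    "\<exists>N1 N2. has_degree t n R1 N1 \<and> has_degree t n R2 N2 \<and> has_degree t n R (N1 + N2)"
  using assms unfolding J_unitary_minimal_factorizations_def minimal_factorization_def factorization_def
  by auto

lemma subspace_unique:
  assumes F: "(R1, R2) \<in> factorizations" and M: "M \<in> subspaces" "M' \<in> subspaces"
    and s: "supp R1 R2 M" "supp R1 R2 M'"
  shows "M = M'"
proof -
  note r = factorizationsD(1,2)[OF F]
  obtain P where P: "P \<in> mats N N" "supporting P" "M = fixed N P"
    "\<forall>P'. is_H_projection t N H M P' \<longleftrightarrow> P' = P"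
    using supporting_projection_of_subspace[OF M(1)] by blast
  obtain Q where Q: "Q \<in> mats N N" "supporting Q" "M' = fixed N Q"
    "\<forall>P'. is_H_projection t N H M' P' \<longleftrightarrow> P' = Q"
    using supporting_projection_of_subspace[OF M(2)] by blast
  note p = supp_near_0[OF M(1) r s(1) P(4)] and q = supp_near_0[OF M(2) r s(2) Q(4)]
  have "\<forall>\<^sub>F x in nhds 0. left_factor P x = left_factor Q x"
    using p(1) q(1) by eventually_elim simp
  moreover have "\<forall>\<^sub>F x in nhds 0. right_factor P x = right_factor Q x"
    using p(2) q(2) by eventually_elim simp
  ultimately have "P = Q"
    using supporting_unique[OF P(2) Q(2)] left_factor_near_0_eq[OF P(1) Q(1)]
      right_factor_near_0_eq[OF P(1) Q(1)] by blast
  then show ?thesis using P(3) Q(3) by simp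
qed

lemma factorization_unique:
  assumes F: "(R1, R2) \<in> factorizations" "(S1, S2) \<in> factorizations" and M: "M \<in> subspaces"
    and s: "supp R1 R2 M" "supp S1 S2 M"
  shows "R1 = S1 \<and> R2 = S2"
proof -
  note r = factorizationsD(1,2)[OF F(1)] and r' = factorizationsD(1,2)[OF F(2)]
  obtain P where P: "\<forall>P'. is_H_projection t N H M P' \<longleftrightarrow> P' = P"
    using supporting_projection_of_subspace[OF M] by blast
  note p = supp_near_0[OF M r s(1) P] and q = supp_near_0[OF M r' s(2) P]
  have "\<forall>\<^sub>F x in nhds 0. the (R1 x) = the (S1 x)"
    using p(1) q(1) by eventually_elim simp
  moreover have "\<forall>\<^sub>F x in nhds 0. the (R2 x) = the (S2 x)"
    using p(2) q(2) by eventually_elim simp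
  ultimately show ?thesis using rational_fun_eqI r r' by blast
qed

text \<open>Triangularity of \<open>A\<close> with respect to the submodule, and the Riccati equation for the other corner, give
  the intertwining relations that the compressions need.\<close>

lemma factorization_of_subspace:
  assumes M: "M \<in> subspaces" and R_deg: "has_degree t n R N"
  shows "\<exists>R1 R2. (R1, R2) \<in> factorizations \<and> supp R1 R2 M"
proof -
  have M': "right_submodule t N M" "H_nondegenerate t N H M"
    using M unfolding nondegenerate_invariant_subspaces_def by auto
  obtain P where P: "P \<in> mats N N" "P ** P = P" "H ** P = P\<star> ** H" "supporting P"
    "M = fixed N P" "\<forall>P'. is_H_projection t N H M P' \<longleftrightarrow> P' = P"
    using supporting_projection_of_subspace[OF M] by blast
  obtain k1 k2 V1 L1 V2 L2 where V1: "V1 \<in> mats N k1" and L1: "L1 \<in> mats k1 N"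
    and LV1: "L1 ** V1 = one k1" and V2: "V2 \<in> mats N k2" and L2: "L2 \<in> mats k2 N"
    and LV2: "L2 ** V2 = one k2" and kN: "k1 + k2 = N" and tot: "V1 ** L1 + V2 ** L2 = one N"
    and LV12: "L1 ** V2 = 0\<^sub>m k1 k2" and LV21: "L2 ** V1 = 0\<^sub>m k2 k1"
    and HP1: "H ** (V1 ** L1) = (V1 ** L1)\<star> ** H" and M1: "M = fixed N (V1 ** L1)"
    using nondegenerate_splitting[OF H M'] by blast
  note [simp] = dimD[OF P(1)] dimD[OF V1] dimD[OF L1] dimD[OF V2]
    dimD[OF L2] mpow_dim[OF A]
  have VL: "V1 ** L1 \<in> mats N N" "V1 ** L1 ** (V1 ** L1) = V1 ** L1"
    by (auto simp: mul_assoc mul_cancel_assoc[OF LV1])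
  have perp: "H_perp t N H M = ker N (V1 ** L1)"
    unfolding M1 by (rule H_perp_eq_kernel[OF H VL HP1])
  have "is_H_projection t N H M (V1 ** L1)"
    unfolding is_H_projection_def perp using VL(1) M1 by blast
  then have PVL: "P = V1 ** L1" using P(6) by simp
  have P2: "one N - P = V2 ** L2"
    unfolding PVL tot[symmetric] by (rule eq_matI) simp_all
  have riccati: "P ** A - A ** P = P ** Y ** (one N - P)" using P(4) by (simp add: supporting_def)
  have PP2: "(one N - P) ** P = 0\<^sub>m N N" by (simp add: mul_distribs P(2)) (rule eq_matI; simp)
  have "(P ** A - A ** P) ** P = P ** Y ** ((one N - P) ** P)" unfolding riccati by (simp add: mul_assoc)
  then have "P ** A ** P - A ** P = 0\<^sub>m N N" unfolding PP2 by (simp add: mul_distribs mul_assoc P(2))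
  then have inv: "P ** A ** P = A ** P" by (rule mat_diff_eq_0) (rule carrier_matI; simp)+
  note cLV = mul_cancel_assoc[OF LV1] mul_cancel_assoc[OF LV2] mul_cancel_assoc[OF LV12] mul_cancel_assoc[OF LV21]
  define A1 where "A1 = L1 ** A ** V1"
  define A2 where "A2 = L2 ** A ** V2"
  have A1: "A1 \<in> mats k1 k1" and A2: "A2 \<in> mats k2 k2" by (auto simp: A1_def A2_def)
  note [simp] = dimD[OF A1] dimD[OF A2]
  have PV1: "P ** V1 = V1" by (simp add: PVL mul_assoc LV1)
  have LP: "L1 ** P = L1" by (simp add: PVL cLV)
  have PV2: "(one N - P) ** V2 = V2" by (simp add: P2 mul_assoc LV2)
  have "A ** V1 = A ** P ** V1" by (simp add: mul_assoc PV1)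
  also have "\<dots> = V1 ** A1" unfolding inv[symmetric] by (simp add: mul_assoc PV1) (simp add: PVL A1_def mul_assoc)
  finally have AV1: "A ** V1 = V1 ** A1" .
  have "L2 ** A = L2 ** A ** (V1 ** L1 + V2 ** L2)" unfolding tot by simp
  also have "\<dots> = L2 ** (A ** V1) ** L1 + A2 ** L2" by (simp add: A2_def mul_distribs mul_assoc)
  also have "\<dots> = A2 ** L2" unfolding AV1 by (simp add: mul_assoc cLV) (rule eq_matI; simp)
  finally have LA2: "A2 ** L2 = L2 ** A" by simp
  have "L1 ** (P ** A - A ** P) = L1 ** A - A1 ** L1"
    by (simp add: mul_distribs mul_cancel_assoc[OF LP]) (simp add: PVL A1_def mul_assoc)
  moreover have "L1 ** (P ** Y ** (one N - P)) = L1 ** B ** G2 ** (G1 ** C ** (one N - P))"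
    by (simp add: mul_assoc mul_cancel_assoc[OF LP])
  ultimately have LA': "L1 ** A - A1 ** L1 = L1 ** B ** G2 ** (G1 ** C ** (one N - P))"
    unfolding riccati by simp
  have LA1: "L1 ** A = A1 ** L1 + L1 ** B ** G2 ** (G1 ** C ** (one N - P))"
    unfolding LA'[symmetric] by (rule eq_matI) simp_all
  have "A ** V2 = (V1 ** L1 + V2 ** L2) ** A ** V2" unfolding tot by simp
  also have "\<dots> = V2 ** A2 + V1 ** (L1 ** A) ** V2"
    by (simp add: A2_def mul_distribs mul_assoc) (rule eq_matI; simp)
  also have "\<dots> = V2 ** A2 + (V1 ** L1 ** B ** G2) ** (G1 ** C ** V2)"
    unfolding LA1 by (simp add: mul_add_left mul_add_right mul_assoc LV12 PV2) (rule eq_matI; simp)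
  finally have AV2: "A ** V2 = V2 ** A2 + (V1 ** L1 ** B ** G2) ** (G1 ** C ** V2)" .
  have s1: "is_sys n k1 D1 (C ** V1) A1 (L1 ** B ** G2)" and s2: "is_sys n k2 D2 (G1 ** C ** V2) A2 (L2 ** B)"
    by (auto simp: is_sys_def)
  note c1 = is_sysD[OF s1] and c2 = is_sysD[OF s2]
  have o1: "observable t n k1 (C ** V1) A1"
    by (rule observable_compression[OF C A obs V1 L1 LV1 A1 c1(2) one_carrier, of "0\<^sub>m N n"])
       (auto simp: AV1)
  have o2: "observable t n k2 (G1 ** C ** V2) A2"
    by (rule observable_compression[OF C A obs V2 L2 LV2 A2 c2(2) D1(1) _ _ AV2])
       (auto simp: mul_assoc D_inverse_assoc)
  have n1: "controllable t n k1 A1 (L1 ** B ** G2)"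
    by (rule controllable_compression[OF A B con V1 L1 LV1 A1 c1(4) D2(1) _ _ LA1])
       (auto simp: mul_assoc D_inverse)
  have n2: "controllable t n k2 A2 (L2 ** B)"
    by (rule controllable_compression[OF A B con V2 L2 LV2 A2 c2(4) one_carrier, of "0\<^sub>m n N"])
       (auto simp: LA2)
  obtain R1 where R1: "rational_fun t n R1" "is_realization t n R1 N D1 C A (P ** B ** G2)"
    using rational_fun_exists[OF left_sys[OF P(1)]] by blast
  obtain R2 where R2: "rational_fun t n R2" "is_realization t n R2 N D2 (G1 ** C ** (one N - P)) A B"
    using rational_fun_exists[OF right_sys[OF P(1)]] by blast
  have near1: "\<forall>\<^sub>F x in nhds 0. the (R1 x) = left_factor P x"
    using rational_near_0[OF R1] by eventually_elim simp
  have near2: "\<forall>\<^sub>F x in nhds 0. the (R2 x) = right_factor P x"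
    using rational_near_0[OF R2] by eventually_elim simp
  have supp: "supp R1 R2 M"
    unfolding supported_by_def ht_inv_D using P(6) R1(2) R2(2) by blast
  have "is_realization t n R1 k1 D1 (C ** V1) A1 (L1 ** B ** G2)"
  proof (rule is_realizationI[OF R1(1) s1])
    show "\<forall>\<^sub>F x in nhds 0. the (R1 x) = tf D1 (C ** V1) A1 (L1 ** B ** G2) x"
      using near1 eventually_pencil[OF A] eventually_pencil[OF A1]
    proof eventually_elim
      case (elim x)
      note [simp] = res_carrier(2-)[OF elim(2) A] res_carrier(2-)[OF elim(3) A1]
      note i = intertwining_resolvent[OF A A1 V1 AV1 elim(2,3)]
      show ?case unfolding elim(1) tf_eq
        by (simp add: PVL mul_assoc mul_cancel_assoc[OF i])
    qed
  qed
  then have deg1: "has_degree t n R1 k1"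
    unfolding has_degree_def minimal_realization_def using o1 n1 by blast
  have "is_realization t n R2 k2 D2 (G1 ** C ** V2) A2 (L2 ** B)"
  proof (rule is_realizationI[OF R2(1) s2])
    show "\<forall>\<^sub>F x in nhds 0. the (R2 x) = tf D2 (G1 ** C ** V2) A2 (L2 ** B) x"
      using near2 eventually_pencil[OF A] eventually_pencil[OF A2]
    proof eventually_elim
      case (elim x)
      note [simp] = res_carrier(2-)[OF elim(2) A] res_carrier(2-)[OF elim(3) A2]
      note i = intertwining_resolvent[OF A2 A L2 LA2 elim(3,2)]
      show ?case unfolding elim(1) tf_eq P2
        by (simp add: mul_assoc mul_cancel_assoc[OF i])
    qed
  qed
  then have deg2: "has_degree t n R2 k2"
    unfolding has_degree_def minimal_realization_def using o2 n2 by blast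
  have "the (R x) = the (R1 x) ** the (R2 x)" if x: "x \<in> dom R" "x \<in> dom R1" "x \<in> dom R2" for x
  proof (rule realizable_at_unique[OF rational_realizable_at[OF R x(1)]])
    show "realizable_at n (\<lambda>x. the (R1 x) ** the (R2 x)) x"
      by (intro realizable_at_mult rational_realizable_at R1(1) R2(1) x)
    show "\<forall>\<^sub>F x in nhds 0. the (R x) = the (R1 x) ** the (R2 x)"
      using R_near_0 near1 near2 eventually_pencil[OF A]
      by eventually_elim (simp add: supporting_factorization[OF P(4)])
  qed
  then have fact: "minimal_factorization t n R R1 R2"
    unfolding minimal_factorization_def factorization_def
    using R1(1) R2(1) deg1 deg2 R_deg kN by blast
  note inv_near = eventually_pencil[OF A] eventually_nhds_0_minus[OF eventually_pencil[OF A]]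
  have "\<forall>\<^sub>F x in nhds 0. the (R1 x) ** J ** (the (R1 (- x)))\<star> = J \<and> the (R2 x) ** J ** (the (R2 (- x)))\<star> = J"
    using near1 near2 R_near_0 J_unitary_near_0[OF R R_unitary]
      eventually_nhds_0_minus[OF near1] eventually_nhds_0_minus[OF near2]
      eventually_nhds_0_minus[OF R_near_0] inv_near
  proof eventually_elim
    case (elim x)
    note f = supporting_factorization[OF P(4) elim(8)] supporting_factorization[OF P(4) elim(9)]
    have prod: "(left_factor P x ** right_factor P x) ** J ** (left_factor P (- x) ** right_factor P (- x))\<star> = J"
      unfolding f using elim by simp
    have left: "J ** (left_factor P (- x))\<star> ** J ** (left_factor P x ** right_factor P x) = right_factor P x"
      unfolding f by (rule adjoint_left_factor[OF P(1,1,3) elim(8,9)])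
    have F: "left_factor P x \<in> mats n n" "right_factor P x \<in> mats n n"
      "left_factor P (- x) \<in> mats n n" "right_factor P (- x) \<in> mats n n"
      by (rule tf_carrier[OF left_sys[OF P(1)] elim(8)] tf_carrier[OF right_sys[OF P(1)] elim(8)]
          tf_carrier[OF left_sys[OF P(1)] elim(9)] tf_carrier[OF right_sys[OF P(1)] elim(9)])+
    show ?case
      using J_unitary_factors[OF J(1,3) F prod left] elim by simp
  qed
  then have "J_unitary_fun t J R1" "J_unitary_fun t J R2"
    by (auto intro!: J_unitary_funI[OF R1(1) J(1)] J_unitary_funI[OF R2(1) J(1)] elim: eventually_mono)
  moreover have "R1 0 = Some D1" "R2 0 = Some D2" using R1(2) R2(2) by (auto simp: is_realization_sys)
  ultimately have "(R1, R2) \<in> factorizations"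
    using fact unfolding J_unitary_minimal_factorizations_def by simp
  then show ?thesis using supp by blast
qed

text \<open>The projection onto the first state space of the series connection supports the factorization.
  Its \<open>H\<close>-adjoint supports the same factorization, because \<open>R1\<close> is \<open>J\<close>-unitary.\<close>

lemma subspace_of_factorization:
  assumes F: "(R1, R2) \<in> factorizations" and R_deg: "has_degree t n R N"
  shows "\<exists>M. M \<in> subspaces \<and> supp R1 R2 M"
proof -
  note f = factorizationsD[OF F]
  obtain N1 N2 where deg: "has_degree t n R1 N1" "has_degree t n R2 N2" "has_degree t n R (N1 + N2)"
    using f(8) by blast
  have N: "N = N1 + N2" using has_degree_unique[OF R R_deg deg(3)] .
  obtain D1' C1 A1 B1 where m1: "minimal_realization t n R1 N1 D1' C1 A1 B1"
    using deg(1) unfolding has_degree_def by blast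
  obtain D2' C2 A2 B2 where m2: "minimal_realization t n R2 N2 D2' C2 A2 B2"
    using deg(2) unfolding has_degree_def by blast
  have "D1' = D1" "D2' = D2"
    using m1 m2 f(5,6) unfolding minimal_realization_def is_realization_def by auto
  then have r1: "is_realization t n R1 N1 D1 C1 A1 B1" and r2: "is_realization t n R2 N2 D2 C2 A2 B2"
    using m1 m2 unfolding minimal_realization_def by auto
  have s1: "is_sys n N1 D1 C1 A1 B1" and s2: "is_sys n N2 D2 C2 A2 B2"
    using r1 r2 by (auto simp: is_realization_sys)
  note c1 = is_sysD[OF s1] and c2 = is_sysD[OF s2]
  let ?E = "inl N1 N2" let ?F = "inr N1 N2"
  define Cp where "Cp = prodC N1 N2 D1 C1 C2"
  define Ap where "Ap = prodA N1 N2 A1 B1 C2 A2"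
  define Bp where "Bp = prodB N1 N2 B1 D2 B2"
  note p = product_system[OF s1 s2, folded Cp_def Ap_def Bp_def]
  have sp: "is_sys n N (D1 ** D2) Cp Ap Bp" using p(1) N by simp
  have near1: "\<forall>\<^sub>F x in nhds 0. R1 x = Some (tf D1 C1 A1 B1 x)" by (rule rational_near_0[OF f(1) r1])
  have near2: "\<forall>\<^sub>F x in nhds 0. R2 x = Some (tf D2 C2 A2 B2 x)" by (rule rational_near_0[OF f(2) r2])
  have "\<forall>\<^sub>F x in nhds 0. R0 x = tf (D1 ** D2) Cp Ap Bp x"
    using near1 near2 R_near_0 rational_near_0_dom[OF R] eventually_pencil[OF c1(3)] eventually_pencil[OF c2(3)]
  proof eventually_elim
    case (elim x)
    then have "x \<in> dom R1" "x \<in> dom R2" by auto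
    then show ?case using f(7)[of x] elim p(3)[OF elim(5,6)] by simp
  qed
  note mk = markov_eq_of_tf_eq(2)[OF R0_sys sp this]
  obtain U V where U: "U \<in> mats N N" and V: "V \<in> mats N N" and UV: "U ** V = one N"
    and VU: "V ** U = one N" and CU: "Cp = C ** U" and UA: "U ** Ap = A ** U" and UB: "U ** Bp = B"
    using state_space_isomorphism[OF R0_sys obs con sp mk] by blast
  have E: "?E \<in> mats N N1" and F': "?F \<in> mats N N2" using N by auto
  note cp = is_sysD[OF sp]
  note [simp] = N[symmetric] c1(5-) c2(5-) cp(7-) dimD[OF U] dimD[OF V] dimD[OF E] dimD[OF F']
  note VUX = mul_cancel_assoc[OF VU]
  have CpE: "Cp ** ?E = C1" and CpF: "Cp ** ?F = D1 ** C2"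
    unfolding Cp_def prodC_def by (simp_all add: mul_distribs mul_assoc) (rule eq_matI; simp)+
  have ApE: "Ap ** ?E = ?E ** A1"
    unfolding Ap_def prodA_def by (simp add: mul_distribs mul_assoc) (rule eq_matI; simp)
  have EAp: "?E\<star> ** Ap = A1 ** ?E\<star> + B1 ** C2 ** ?F\<star>"
    unfolding Ap_def prodA_def by (simp add: mul_distribs mul_assoc) (rule eq_matI; simp)
  have FAp: "?F\<star> ** Ap = A2 ** ?F\<star>"
    unfolding Ap_def prodA_def by (simp add: mul_distribs mul_assoc) (rule eq_matI; simp)
  have EBp: "?E\<star> ** Bp = B1 ** D2" and FBp: "?F\<star> ** Bp = B2"
    unfolding Bp_def prodB_def by (simp_all add: mul_distribs mul_assoc) (rule eq_matI; simp)+
  have tot: "?E ** ?E\<star> + ?F ** ?F\<star> = one N" using direct_sum_total[of N1 N2] by simp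
  have AUX: "A = U ** Ap ** V" unfolding UA by (simp add: mul_assoc UV)
  have VA: "V ** A = Ap ** V" unfolding AUX by (simp add: mul_assoc VUX)
  have VB: "V ** B = Bp" unfolding UB[symmetric] by (simp add: VUX)
  have CV: "C = Cp ** V" unfolding CU by (simp add: mul_assoc UV)
  define P where "P = U ** (?E ** (?E\<star> ** V))"
  have P: "P \<in> mats N N" by (auto simp: P_def)
  note [simp] = dimD[OF P]
  have PP: "P ** P = P" unfolding P_def by (simp add: mul_assoc VUX)
  have "one N - P = U ** (?E ** ?E\<star> + ?F ** ?F\<star>) ** V - P" unfolding tot by (simp add: UV)
  also have "\<dots> = U ** (?F ** (?F\<star> ** V))"
    unfolding P_def by (simp add: mul_distribs mul_assoc) (rule eq_matI; simp)
  finally have P2: "one N - P = U ** (?F ** (?F\<star> ** V))" .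
  have PB: "P ** B = U ** (?E ** (B1 ** D2))" by (simp add: P_def mul_assoc VB EBp)
  have CP2: "C ** (one N - P) = D1 ** (C2 ** (?F\<star> ** V))"
    unfolding P2 CV by (simp add: mul_assoc VUX mul_cancel_assoc[OF CpF])
  \<comment> \<open>The Riccati equation holds because \<open>Ap\<close> is block triangular with corner \<open>B1 C2\<close>.\<close>
  have PA: "P ** A = U ** (?E ** (A1 ** (?E\<star> ** V))) + U ** (?E ** (B1 ** (C2 ** (?F\<star> ** V))))"
    by (simp add: P_def mul_assoc VA mul_cancel_assoc[OF EAp] mul_distribs)
  have AP: "A ** P = U ** (?E ** (A1 ** (?E\<star> ** V)))"
    unfolding AUX P_def by (simp add: mul_assoc VUX mul_cancel_assoc[OF ApE])
  have "P ** Y ** (one N - P) = P ** B ** (G2 ** (G1 ** (C ** (one N - P))))" by (simp add: mul_assoc)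
  also have "\<dots> = U ** (?E ** (B1 ** (C2 ** (?F\<star> ** V))))"
    unfolding PB CP2 by (simp add: mul_assoc D_inverse_assoc)
  also have "\<dots> = P ** A - A ** P" unfolding PA AP by (rule eq_matI) simp_all
  finally have sup: "supporting P" using P by (simp add: supporting_def)
  have left: "\<forall>\<^sub>F x in nhds 0. the (R1 x) = left_factor P x"
    using near1 eventually_pencil[OF A] eventually_pencil[OF c1(3)]
  proof eventually_elim
    case (elim x)
    note [simp] = res_carrier(2-)[OF elim(2) A] res_carrier(2-)[OF elim(3) c1(3)]
    have UE: "U ** ?E \<in> mats N N1" by auto
    have i: "res A x ** (U ** ?E) = U ** ?E ** res A1 x"
      by (rule intertwining_resolvent[OF A c1(3) UE _ elim(2,3)])
         (simp add: AUX mul_assoc VUX ApE)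
    have CUE: "C ** (U ** ?E) = C1" using CpE unfolding CU by (simp add: mul_assoc)
    have "C ** res A x ** (P ** B ** G2) = C ** (res A x ** (U ** ?E)) ** B1"
      unfolding PB by (simp add: mul_assoc D_inverse)
    also have "\<dots> = C1 ** res A1 x ** B1"
      unfolding i using mul_cancel_assoc[OF CUE, of "res A1 x ** B1"] by (simp add: mul_assoc)
    finally show ?case using elim(1) by (simp add: tf_eq)
  qed
  have right: "\<forall>\<^sub>F x in nhds 0. the (R2 x) = right_factor P x"
    using near2 eventually_pencil[OF A] eventually_pencil[OF c2(3)]
  proof eventually_elim
    case (elim x)
    note [simp] = res_carrier(2-)[OF elim(2) A] res_carrier(2-)[OF elim(3) c2(3)]
    have FV: "?F\<star> ** V \<in> mats N2 N" by auto
    have i: "res A2 x ** (?F\<star> ** V) = ?F\<star> ** V ** res A x"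
      by (rule intertwining_resolvent[OF c2(3) A FV _ elim(3,2)])
         (simp add: VA mul_assoc mul_cancel_assoc[OF FAp])
    have "G1 ** C ** (one N - P) ** res A x ** B = G1 ** (C ** (one N - P)) ** res A x ** B" by (simp add: mul_assoc)
    also have "\<dots> = C2 ** (?F\<star> ** V ** res A x) ** B"
      unfolding CP2 by (simp add: mul_assoc D_inverse_assoc)
    also have "\<dots> = C2 ** res A2 x ** B2"
      unfolding i[symmetric] by (simp add: mul_assoc VB FBp)
    finally show ?case using elim(1) by (simp add: tf_eq)
  qed
  \<comment> \<open>Both \<open>P\<close> and its adjoint \<open>Q\<close> describe the right factor as \<open>J R1(-x)\<star> J R(x)\<close>.\<close>
  note i = ht_invD[OF H(2,1)]
  define Q where "Q = ht_inv t H ** (P\<star> ** H)"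
  have Q: "Q \<in> mats N N" using dimD[OF i(1)] by (auto simp: Q_def)
  have HQ: "H ** Q = P\<star> ** H" unfolding Q_def using dimD[OF i(1)] by (simp add: mul_cancel_assoc[OF i(2)])
  have "\<forall>\<^sub>F x in nhds 0. right_factor P x = right_factor Q x"
    using J_unitary_near_0[OF f(1,3)] left eventually_nhds_0_minus[OF left]
      eventually_pencil[OF A] eventually_nhds_0_minus[OF eventually_pencil[OF A]]
  proof eventually_elim
    case (elim x)
    have F: "left_factor P x \<in> mats n n" "left_factor P (- x) \<in> mats n n"
      "right_factor P x \<in> mats n n"
      by (rule tf_carrier[OF left_sys[OF P] elim(4)] tf_carrier[OF left_sys[OF P] elim(5)]
          tf_carrier[OF right_sys[OF P] elim(4)])+
    have "left_factor P x ** J ** (left_factor P (- x))\<star> = J" using elim by simp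
    note inv = J_unitary_left_inverse[OF J(1,3) F(1,2) this]
    have "right_factor Q x = J ** (left_factor P (- x))\<star> ** J ** R0 x"
      by (rule adjoint_left_factor[OF P Q HQ elim(4,5), symmetric])
    also have "\<dots> = J ** (left_factor P (- x))\<star> ** J ** left_factor P x ** right_factor P x"
      unfolding supporting_factorization[OF sup elim(4), symmetric]
      using dimD[OF F(1)] dimD[OF F(2)] dimD[OF F(3)] by (simp add: mul_assoc)
    also have "\<dots> = right_factor P x" unfolding inv using dimD[OF F(3)] by simp
    finally show ?case by simp
  qed
  then have CPQ: "C ** P = C ** Q" by (rule right_factor_near_0_eq[OF P Q])
  have "P = Q"
    by (rule supporting_unique[OF sup supporting_adjoint[OF sup Q HQ] CPQ adjoint_input_eq[OF P Q HQ CPQ]])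
  then have HP: "H ** P = P\<star> ** H" using HQ by simp
  define M where "M = fixed N P"
  have PAP: "P ** (A ** P) = A ** P" unfolding AP by (simp add: P_def mul_assoc VUX)
  have "A ** f \<in> M" if "f \<in> M" for f
  proof -
    have fc: "f \<in> mats N 1" and Pf: "P ** f = f" using that by (auto simp: M_def)
    note [simp] = dimD[OF fc]
    have "P ** (A ** (P ** f)) = P ** (A ** P) ** f" by (simp add: mul_assoc)
    also have "\<dots> = A ** (P ** f)" unfolding PAP by (simp add: mul_assoc)
    finally show ?thesis unfolding Pf by (auto simp: M_def)
  qed
  then have MS: "M \<in> subspaces"
    unfolding nondegenerate_invariant_subspaces_def
    using range_right_submodule[OF P] self_adjoint_range_nondegenerate[OF H P PP HP] unfolding M_def by blast
  have perp: "H_perp t N H M = ker N P"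
    unfolding M_def by (rule H_perp_eq_kernel[OF H P PP HP])
  have proj: "is_H_projection t N H M P"
    unfolding is_H_projection_def perp using P by (auto simp: M_def)
  have "supp R1 R2 M"
    unfolding supported_by_def ht_inv_D
    using proj is_realizationI[OF f(1) left_sys[OF P] left] is_realizationI[OF f(2) right_sys[OF P] right]
    by blast
  then show ?thesis using MS by blast
qed

end

theorem theorem4p8:
  fixes t :: real and n N :: nat
    and J D C A B H D1 D2 :: "ht mat" and R :: "real \<rightharpoonup> ht mat"
  assumes "t \<noteq> 0"
    and "J \<in> carrier_mat n n" and "ht_star_mat J = J" and "ht_inverse_of t J J"
    and "rational_fun t n R"
    and "minimal_realization t n R N D C A B"
    and "J_unitary_fun t J R"
    and "associated_matrix t N J D C A B H"
    and "D1 \<in> carrier_mat n n" and "D2 \<in> carrier_mat n n"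
    and "D = D1 \<odot>\<^bsub>t\<^esub> D2" and "J_unitary_mat t J D1" and "J_unitary_mat t J D2"
  shows "\<exists>\<Phi>. bij_betw \<Phi> (J_unitary_minimal_factorizations t n J R D1 D2)
                         (nondegenerate_invariant_subspaces t N A H)
           \<and> (\<forall>(R1, R2) \<in> J_unitary_minimal_factorizations t n J R D1 D2.
                supported_by t n N C A B H D1 D2 R1 R2 (\<Phi> (R1, R2)))"
proof -
  interpret ht_algebra t by unfold_locales (rule assms(1))
  have r: "is_realization t n R N (D1 ** D2) C A B" "observable t n N C A" "controllable t n N A B"
    using assms(6,11) unfolding minimal_realization_def by auto
  have c: "C \<in> carrier_mat n N" "A \<in> carrier_mat N N" "B \<in> carrier_mat N n"
    using r(1) unfolding is_realization_def by auto
  have JJ: "J ** J = one n" using assms(2,4) unfolding ht_inverse_of_def by auto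
  have h: "H \<in> carrier_mat N N" "ht_invertible t H" "ht_star_mat H = H"
    "ht_star_mat A ** H + H ** A = - (ht_star_mat C ** J ** C)"
    and b: "B = - (ht_inv t H ** ht_star_mat C ** J ** (D1 ** D2))"
    using assms(8,11) unfolding associated_matrix_def by auto
  note i = ht_invD[OF h(2,1)]
  have hb: "H ** B = - (ht_star_mat C ** J ** (D1 ** D2))"
  proof -
    note [simp] = dimD[OF h(1)] dimD[OF i(1)] dimD[OF c(1)]
      dimD[OF assms(2)] dimD[OF assms(9)] dimD[OF assms(10)]
    show ?thesis
      unfolding b by (simp add: mul_distribs mul_assoc mul_cancel_assoc[OF i(2)])
  qed
  interpret factorization_problem t n N J C A B H D1 D2 R
    by unfold_locales (use assms r c JJ h hb in \<open>simp_all add: J_unitary_mat_def\<close>)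
  have deg: "has_degree t n R N" using assms(6) unfolding has_degree_def by blast
  define \<Phi> where "\<Phi> p = (THE M. M \<in> subspaces \<and> supp (fst p) (snd p) M)" for p
  have \<Phi>: "\<Phi> (R1, R2) = M" if "(R1, R2) \<in> factorizations" "M \<in> subspaces" "supp R1 R2 M" for R1 R2 M
    unfolding \<Phi>_def using that subspace_unique[OF that(1)] by (intro the_equality) auto
  have \<Phi>': "\<Phi> (R1, R2) \<in> subspaces \<and> supp R1 R2 (\<Phi> (R1, R2))" if "(R1, R2) \<in> factorizations" for R1 R2
  proof -
    note ex = subspace_of_factorization[OF that deg]
    obtain M where M: "M \<in> subspaces" "supp R1 R2 M"
      using ex by blast
    then show ?thesis using \<Phi>[OF that M] by simp
  qed
  have "bij_betw \<Phi> factorizations subspaces"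
  proof (rule bij_betw_imageI)
    show "inj_on \<Phi> factorizations"
    proof (rule inj_onI)
      fix p q assume p: "p \<in> factorizations" and q: "q \<in> factorizations" and eq: "\<Phi> p = \<Phi> q"
      obtain R1 R2 S1 S2 where pq: "p = (R1, R2)" "q = (S1, S2)" by fastforce
      show "p = q"
        using factorization_unique[of R1 R2 S1 S2 "\<Phi> p"] \<Phi>'[of R1 R2] \<Phi>'[of S1 S2] p q eq
        unfolding pq by simp
    qed
    show "\<Phi> ` factorizations = subspaces"
    proof (intro equalityI subsetI)
      fix M assume "M \<in> \<Phi> ` factorizations"
      then show "M \<in> subspaces" using \<Phi>' by force
    next
      fix M assume M: "M \<in> subspaces"
      from factorization_of_subspace[OF M deg] obtain R1 R2
        where F: "(R1, R2) \<in> factorizations" and S: "supp R1 R2 M" by blast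
      show "M \<in> \<Phi> ` factorizations" by (rule image_eqI[where x = "(R1, R2)"]) (use \<Phi>[OF F M S] F in simp_all)
    qed
  qed
  moreover have "\<forall>(R1, R2) \<in> factorizations. supp R1 R2 (\<Phi> (R1, R2))"
    using \<Phi>' by blast
  ultimately show ?thesis by blast
qed

end
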